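(* Let $\mathcal{H}_A=\mathcal{H}_B=\mathbb{C}^d$ and let $\mathcal{P}=(\mathcal{P}^{\mathrm{yes}},\mathcal{P}^{\mathrm{no}})$ be a property of bipartite mixed states in $\mathcal{D}(\mathcal{H}_A\otimes\mathcal{H}_B)$ that is unitarily invariant on $\mathcal{H}_B$ and such that $\mathcal{P}^{\mathrm{yes}}$ consists only of pure states. Let $0<s<c\le 1$. If there is a $(c,s)$-tester for $\mathcal{P}$ with sample complexity $N_0$, then there is a one-way LOCC tester from Bob to Alice that is a $(c,s)$-tester for $\mathcal{P}$ with sample complexity at most $\lceil 200\ln(1/s+10)(c-s)^{-4}\rceil\cdot N_0$ (in particular $O(N_0)$ for fixed $c,s$).
   Context: A property is a pair of disjoint sets of states; a $(c,s)$-tester with sample complexity $N$ is an operator $0\preceq\mathcal{T}\preceq I$ on $(\mathcal{H}_A\otimes\mathcal{H}_B)^{\otimes N}$ with $\mathrm{tr}[\mathcal{T}\rho^{\otimes N}]\ge c$ for yes-instances and $\le s$ for no-instances. Unitary invariance on $\mathcal{H}_B$: for every unitary $U$ on $\mathcal{H}_B$, $(I\otimes U)\rho(I\otimes U)^\dagger$ stays in the same set $\mathcal{P}^{\mathrm{yes}}$ or $\mathcal{P}^{\mathrm{no}}$ as $\rho$. A one-way LOCC tester from Bob to Alice is one implementable as: Bob performs a measurement on $\mathcal{H}_B^{\otimes N}$ and sends the classical outcome to Alice; Alice then performs a measurement (depending on the message) on $\mathcal{H}_A^{\otimes N}$ and accepts or rejects. *)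

theory Defs
  imports Complex_Main
begin

text \<open>Operators on a finite-dimensional Hilbert space with computational basis
  indexed by a finite set I are represented as matrices 'i => 'i => complex,
  required to vanish outside I x I.\<close>

type_synonym 'i op = "'i \<Rightarrow> 'i \<Rightarrow> complex"

definition supported_on :: "'i set \<Rightarrow> 'i op \<Rightarrow> bool" where
  "supported_on I M \<longleftrightarrow> (\<forall>i j. i \<notin> I \<or> j \<notin> I \<longrightarrow> M i j = 0)"

definition psd_on :: "'i set \<Rightarrow> 'i op \<Rightarrow> bool" where
  "psd_on I M \<longleftrightarrow> (\<forall>v::'i \<Rightarrow> complex.
      Im (\<Sum>i\<in>I. \<Sum>j\<in>I. cnj (v i) * M i j * v j) = 0 \<and>
      Re (\<Sum>i\<in>I. \<Sum>j\<in>I. cnj (v i) * M i j * v j) \<ge> 0)"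

definition id_op :: "'i set \<Rightarrow> 'i op" where
  "id_op I = (\<lambda>i j. if i \<in> I \<and> i = j then 1 else 0)"

definition is_effect :: "'i set \<Rightarrow> 'i op \<Rightarrow> bool" where
  "is_effect I T \<longleftrightarrow> supported_on I T \<and> psd_on I T \<and> psd_on I (\<lambda>i j. id_op I i j - T i j)"

definition trace_on :: "'i set \<Rightarrow> 'i op \<Rightarrow> complex" where
  "trace_on I M = (\<Sum>i\<in>I. M i i)"

definition density_on :: "'i set \<Rightarrow> 'i op \<Rightarrow> bool" where
  "density_on I \<rho> \<longleftrightarrow> supported_on I \<rho> \<and> psd_on I \<rho> \<and> trace_on I \<rho> = 1"

text \<open>Basis of H_A \<otimes> H_B = C^d \<otimes> C^d: pairs (Alice index, Bob index).\<close>
definition bip_idx :: "nat \<Rightarrow> (nat \<times> nat) set" where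
  "bip_idx d = {0..<d} \<times> {0..<d}"

text \<open>Basis of (H_A \<otimes> H_B)^{\<otimes> N}: lists of N pairs.\<close>
definition copies_idx :: "nat \<Rightarrow> nat \<Rightarrow> (nat \<times> nat) list set" where
  "copies_idx d N = {xs. length xs = N \<and> set xs \<subseteq> bip_idx d}"

text \<open>Basis of a single party's N-copy space (C^d)^{\<otimes> N}.\<close>
definition party_idx :: "nat \<Rightarrow> nat \<Rightarrow> nat list set" where
  "party_idx d N = {xs. length xs = N \<and> set xs \<subseteq> {0..<d}}"

definition tensor_power :: "nat \<Rightarrow> 'i op \<Rightarrow> 'i list op" where
  "tensor_power N \<rho> = (\<lambda>xs ys. if length xs = N \<and> length ys = N
       then (\<Prod>k<N. \<rho> (xs ! k) (ys ! k)) else 0)"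

definition tr_prod :: "'i set \<Rightarrow> 'i op \<Rightarrow> 'i op \<Rightarrow> complex" where
  "tr_prod I T \<sigma> = (\<Sum>x\<in>I. \<Sum>y\<in>I. T x y * \<sigma> y x)"

definition is_tester ::
  "nat \<Rightarrow> nat \<Rightarrow> (nat \<times> nat) list op \<Rightarrow> (nat \<times> nat) op set \<Rightarrow> (nat \<times> nat) op set
   \<Rightarrow> real \<Rightarrow> real \<Rightarrow> bool" where
  "is_tester d N T Pyes Pno c s \<longleftrightarrow>
     is_effect (copies_idx d N) T \<and>
     (\<forall>\<rho>\<in>Pyes. Re (tr_prod (copies_idx d N) T (tensor_power N \<rho>)) \<ge> c) \<and>
     (\<forall>\<rho>\<in>Pno. Re (tr_prod (copies_idx d N) T (tensor_power N \<rho>)) \<le> s)"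

definition is_property :: "nat \<Rightarrow> (nat \<times> nat) op set \<Rightarrow> (nat \<times> nat) op set \<Rightarrow> bool" where
  "is_property d Pyes Pno \<longleftrightarrow> Pyes \<inter> Pno = {} \<and>
     (\<forall>\<rho>\<in>Pyes \<union> Pno. density_on (bip_idx d) \<rho>)"

definition unitary_on :: "nat \<Rightarrow> nat op \<Rightarrow> bool" where
  "unitary_on d U \<longleftrightarrow> supported_on {0..<d} U \<and>
     (\<forall>i<d. \<forall>j<d. (\<Sum>k<d. U i k * cnj (U j k)) = (if i = j then 1 else 0)) \<and>
     (\<forall>i<d. \<forall>j<d. (\<Sum>k<d. cnj (U k i) * U k j) = (if i = j then 1 else 0))"

text \<open>(I \<otimes> U) \<rho> (I \<otimes> U)^\<dagger>\<close>
definition conj_B :: "nat \<Rightarrow> nat op \<Rightarrow> (nat \<times> nat) op \<Rightarrow> (nat \<times> nat) op" where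
  "conj_B d U \<rho> = (\<lambda>(a, b) (a', b'). \<Sum>c<d. \<Sum>c'<d. U b c * \<rho> (a, c) (a', c') * cnj (U b' c'))"

definition unitarily_invariant_B :: "nat \<Rightarrow> (nat \<times> nat) op set \<Rightarrow> (nat \<times> nat) op set \<Rightarrow> bool" where
  "unitarily_invariant_B d Pyes Pno \<longleftrightarrow> (\<forall>U. unitary_on d U \<longrightarrow>
     (\<forall>\<rho>\<in>Pyes. conj_B d U \<rho> \<in> Pyes) \<and> (\<forall>\<rho>\<in>Pno. conj_B d U \<rho> \<in> Pno))"

definition pure_state :: "nat \<Rightarrow> (nat \<times> nat) op \<Rightarrow> bool" where
  "pure_state d \<rho> \<longleftrightarrow> density_on (bip_idx d) \<rho> \<and>
     (\<exists>v. (\<forall>i. i \<notin> bip_idx d \<longrightarrow> v i = 0) \<and> \<rho> = (\<lambda>i j. v i * cnj (v j)))"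

text \<open>One-way LOCC from Bob to Alice: Bob measures a POVM {B m | m \<in> K} on H_B^{\<otimes> N},
  sends m; Alice accepts with effect A m on H_A^{\<otimes> N}. Acceptance operator
  T = \<Sum>_m A m \<otimes> B m (tensor factors arranged copy by copy).\<close>
definition oneway_LOCC_BA :: "nat \<Rightarrow> nat \<Rightarrow> (nat \<times> nat) list op \<Rightarrow> bool" where
  "oneway_LOCC_BA d N T \<longleftrightarrow> (\<exists>(K::nat set) A B. finite K \<and>
     (\<forall>m\<in>K. is_effect (party_idx d N) (A m)) \<and>
     (\<forall>m\<in>K. supported_on (party_idx d N) (B m) \<and> psd_on (party_idx d N) (B m)) \<and>
     (\<lambda>u w. \<Sum>m\<in>K. B m u w) = id_op (party_idx d N) \<and>
     T = (\<lambda>xs ys. \<Sum>m\<in>K. A m (map fst xs) (map fst ys) * B m (map snd xs) (map snd ys)))"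

end

(*
  The yes-states are pure, so all purifications of Alice's marginal that differ by a unitary of Bob
  lie in the same set. Averaging T0 over Bob's unitaries therefore yields an effect M of Alice alone:
  if J is the twirl of the unnormalised maximally entangled state on the N0 copies, then J commutes
  with X^N0 (x) 1 for every matrix X, hence so does K = sqrt J, and M = tr_B (K T0 K) gives on every
  pure state psi an average of the acceptance probabilities of T0 on (1 (x) U) psi. Instead of Haar
  measure, J is the element of least Frobenius norm in the closed convex hull of the orbit;
  uniqueness makes it invariant.

  A mixed no-state rho is unmasked by t * N0 swap tests, each of which is one-way LOCC (both parties
  measure symmetric/antisymmetric on a pair of copies and compare) and accepts with probability
  (1 + tr rho^2) / 2. Writing rho >= phi phi^* with |phi|^2 = l >= tr rho^2, the test M accepts with
  probability at most s + N0 (1 - l), and the swap tests damp the excess to (c - s) / 4 once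
  t >= 3 / (c - s).

  Finally this block is repeated k = O(ln (1/s + 10) / (c - s)^2) times with a threshold:
  the Chernoff bound gives soundness s, and Chebyshev's inequality bounds the failure probability on
  yes-states by p (1 - p) / (k (p - tau)^2) <= 1 - c, which works for c = 1 as well.
*)

theory Submission
  imports Defs "HOL-Analysis.Analysis" "HOL-Computational_Algebra.Polynomial"
begin

section \<open>The spectral theorem on a finite index set\<close>

text \<open>A bipartite vector is (X (x) 1) applied to the unnormalised maximally entangled vector,
  with X its coefficient matrix, which is arbitrary. Invariance of J gives commutation only with
  unitary X, and X^n is not linear in X, so passing to all X needs an argument: unit-modulus
  diagonals, then all diagonals, then Hermitian matrices through their spectral decomposition, then
  all matrices through a polynomial identity in one parameter. The square root is there for
  positivity: K T0 K is positive semidefinite, which J T0 need not be, and commutation moves both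
  factors K past X^n and merges them into J. The bound M <= 1 comes from tr_B J = 1. Swap tests cost
  no completeness, since pure states pass them with certainty. Their number grows with N0 because
  the excess N0 (1 - l) does. With g = c - s, one block separates c from s + g/4; the threshold c -
  g/4 leaves a margin g/4 above it and g/2 below it. A block uses at most (9/g) N0 copies and there
  are at most 17 ln(1/s + 10) / g^2 blocks, so the count is of order g^(-3), inside the claimed
  g^(-4).\<close>

lemma convergent_subsequence_on_finite:
  fixes f :: "nat \<Rightarrow> 'i \<Rightarrow> complex"
  assumes "finite I" and "\<And>k i. i \<in> I \<Longrightarrow> cmod (f k i) \<le> B"
  shows "\<exists>r l. strict_mono (r::nat \<Rightarrow> nat) \<and> (\<forall>i\<in>I. (\<lambda>k. f (r k) i) \<longlonglongrightarrow> l i)"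
  using assms
proof (induction I)
  case empty
  show ?case by (intro exI[of _ id]) (auto simp: strict_mono_def)
next
  case (insert a I)
  then obtain r l where r: "strict_mono (r::nat \<Rightarrow> nat)" and l: "\<forall>i\<in>I. (\<lambda>k. f (r k) i) \<longlonglongrightarrow> l i"
    by auto
  have "bounded (range (\<lambda>k. f (r k) a))"
    using insert.prems by (intro boundedI[of _ B]) auto
  then obtain b r' where r': "strict_mono (r'::nat \<Rightarrow> nat)" and b: "((\<lambda>k. f (r k) a) \<circ> r') \<longlonglongrightarrow> b"
    using bounded_imp_convergent_subsequence by blast
  show ?case
  proof (intro exI conjI ballI)
    show "strict_mono (r \<circ> r')" using r r' by (rule strict_mono_o)
    fix i assume i: "i \<in> insert a I"
    show "(\<lambda>k. f ((r \<circ> r') k) i) \<longlonglongrightarrow> (l(a := b)) i"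
    proof (cases "i = a")
      case True
      then show ?thesis using b by (simp add: o_def)
    next
      case False
      then have "(\<lambda>k. f (r k) i) \<longlonglongrightarrow> l i" using i l by auto
      from LIMSEQ_subseq_LIMSEQ[OF this r'] show ?thesis using False by (simp add: o_def)
    qed
  qed
qed

definition inner_on :: "'i set \<Rightarrow> ('i \<Rightarrow> complex) \<Rightarrow> ('i \<Rightarrow> complex) \<Rightarrow> complex" where
  "inner_on I v w = (\<Sum>i\<in>I. cnj (v i) * w i)"

text \<open>The result is not cut off outside \<open>I\<close>; \<open>inner_on\<close> ignores
  those entries, so eigenvector equations are stated on \<open>I\<close> only.\<close>

definition mat_vec :: "'i set \<Rightarrow> 'i op \<Rightarrow> ('i \<Rightarrow> complex) \<Rightarrow> ('i \<Rightarrow> complex)" where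
  "mat_vec I M v = (\<lambda>i. \<Sum>j\<in>I. M i j * v j)"

definition hermitian_on :: "'i set \<Rightarrow> 'i op \<Rightarrow> bool" where
  "hermitian_on I M \<longleftrightarrow> (\<forall>i\<in>I. \<forall>j\<in>I. M j i = cnj (M i j))"

lemma inner_on_self: "inner_on I v v = of_real (\<Sum>i\<in>I. (cmod (v i))\<^sup>2)"
  unfolding inner_on_def of_real_sum
  by (intro sum.cong refl) (simp only: complex_norm_square mult.commute)

lemma inner_on_cnj: "cnj (inner_on I v w) = inner_on I w v"
  by (simp add: inner_on_def mult.commute)

lemma inner_on_add_right: "inner_on I v (\<lambda>i. w i + u i) = inner_on I v w + inner_on I v u"
  by (simp add: inner_on_def sum.distrib algebra_simps)

lemma inner_on_diff_right: "inner_on I v (\<lambda>i. w i - u i) = inner_on I v w - inner_on I v u"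
  by (simp add: inner_on_def sum_subtractf algebra_simps)

lemma inner_on_scale_right: "inner_on I v (\<lambda>i. a * w i) = a * inner_on I v w"
  by (simp add: inner_on_def sum_distrib_left algebra_simps)

lemma inner_on_add_left: "inner_on I (\<lambda>i. w i + u i) v = inner_on I w v + inner_on I u v"
  by (simp add: inner_on_def sum.distrib algebra_simps)

lemma inner_on_scale_left: "inner_on I (\<lambda>i. a * w i) v = cnj a * inner_on I w v"
  by (simp add: inner_on_def sum_distrib_left algebra_simps)

lemma inner_on_mat_vec: "inner_on I v (mat_vec I M w) = (\<Sum>i\<in>I. \<Sum>j\<in>I. cnj (v i) * M i j * w j)"
  by (simp add: inner_on_def mat_vec_def sum_distrib_left algebra_simps)

lemma inner_on_mat_vec_adjoint:
  assumes "hermitian_on I M"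
  shows "inner_on I v (mat_vec I M w) = inner_on I (mat_vec I M v) w"
proof -
  have "inner_on I v (mat_vec I M w) = (\<Sum>j\<in>I. \<Sum>i\<in>I. cnj (v i) * M i j * w j)"
    unfolding inner_on_mat_vec by (rule sum.swap)
  also have "\<dots> = inner_on I (mat_vec I M v) w"
    unfolding inner_on_def mat_vec_def cnj_sum sum_distrib_right
  proof (intro sum.cong refl)
    fix j i assume "j \<in> I" "i \<in> I"
    then have *: "M i j = cnj (M j i)" using assms unfolding hermitian_on_def by blast
    show "cnj (v i) * M i j * w j = cnj (M j i * v i) * w j"
      by (simp only: complex_cnj_mult *[symmetric] mult.commute)
  qed
  finally show ?thesis .
qed

text \<open>For small t of sign opposite to b the linear term wins. Replacing a by
  \<open>\<bar>a\<bar> + 1\<close> gives a positive leading coefficient, so the vertex of the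
  parabola can be used as t.\<close>

lemma nonneg_quadratic_linear_zero:
  fixes a b :: real
  assumes "\<And>t. 0 \<le> t * b + t\<^sup>2 * a"
  shows "b = 0"
proof (rule ccontr)
  assume b: "b \<noteq> 0"
  define A where "A = \<bar>a\<bar> + 1"
  have A: "A > 0" "a \<le> A" by (auto simp: A_def)
  let ?t = "- b / (2 * A)"
  have "?t * b + ?t\<^sup>2 * a \<le> ?t * b + ?t\<^sup>2 * A" using A by (intro add_left_mono mult_left_mono) auto
  also have "\<dots> = - (b\<^sup>2) / (4 * A)"
    using A(1) by (simp add: field_simps power2_eq_square)
  also have "\<dots> < 0" using A b by (simp add: divide_neg_pos)
  finally show False using assms[of ?t] by linarith
qed

text \<open>A minimiser of the Rayleigh quotient on the orthogonal complement of known eigenvectors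
  is again an eigenvector.\<close>

lemma next_eigenvector:
  fixes M :: "'i op" and u :: "nat \<Rightarrow> 'i \<Rightarrow> complex"
  assumes fin: "finite I" and herm: "hermitian_on I M"
    and eig: "\<And>k i. k < m \<Longrightarrow> i \<in> I \<Longrightarrow> mat_vec I M (u k) i = of_real (l k) * u k i"
    and z: "\<And>k. k < m \<Longrightarrow> inner_on I (u k) z = 0" "inner_on I z z \<noteq> 0"
  shows "\<exists>v \<mu>. (\<forall>k<m. inner_on I (u k) v = 0) \<and> inner_on I v v = 1 \<and> (\<forall>i\<in>I. mat_vec I M v i = of_real (\<mu>::real) * v i)"
proof -
  define S where "S = {v. \<forall>k<m. inner_on I (u k) v = 0}"
  define q where "q v = Re (inner_on I v (mat_vec I M v))" for v
  define Q where "Q = q ` {v \<in> S. inner_on I v v = 1}"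
  have scaleS: "(\<lambda>i. a * v i) \<in> S" if "v \<in> S" for a v
    using that by (auto simp: S_def inner_on_scale_right)
  have addS: "(\<lambda>i. v i + w i) \<in> S" if "v \<in> S" "w \<in> S" for v w
    using that by (auto simp: S_def inner_on_add_right)
  have qscale: "q (\<lambda>i. of_real a * v i) = a\<^sup>2 * q v" for a v
  proof -
    have "mat_vec I M (\<lambda>i. of_real a * v i) = (\<lambda>i. of_real a * mat_vec I M v i)"
      by (simp add: mat_vec_def sum_distrib_left algebra_simps)
    then show ?thesis by (simp add: q_def inner_on_scale_left inner_on_scale_right power2_eq_square)
  qed
  have normalise: "\<exists>a>0. inner_on I (\<lambda>i. of_real a * v i) (\<lambda>i. of_real a * v i) = 1
      \<and> a\<^sup>2 * Re (inner_on I v v) = 1" if "inner_on I v v \<noteq> 0" for v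
  proof -
    define r where "r = (\<Sum>i\<in>I. (cmod (v i))\<^sup>2)"
    have r: "inner_on I v v = of_real r" by (simp add: r_def inner_on_self)
    have "r \<noteq> 0" using that r by auto
    moreover have "r \<ge> 0" by (simp add: r_def sum_nonneg)
    ultimately have "r > 0" by simp
    define a where "a = 1 / sqrt r"
    have a: "a > 0" "a\<^sup>2 * r = 1" using \<open>r > 0\<close> by (simp_all add: a_def power_divide)
    have "inner_on I (\<lambda>i. of_real a * v i) (\<lambda>i. of_real a * v i) = of_real (a\<^sup>2 * r)"
      unfolding inner_on_scale_left inner_on_scale_right r by (simp add: power2_eq_square)
    then show ?thesis using a r by (intro exI[of _ a]) auto
  qed
  have unit_bound: "cmod (v i) \<le> 1" if "inner_on I v v = 1" "i \<in> I" for v i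
  proof -
    have "(cmod (v i))\<^sup>2 \<le> (\<Sum>i\<in>I. (cmod (v i))\<^sup>2)"
      using fin that by (intro member_le_sum) auto
    also have "\<dots> = 1" using that(1) unfolding inner_on_self by (metis of_real_eq_1_iff)
    finally show ?thesis by (simp add: power_le_one_iff)
  qed
  have Qne: "Q \<noteq> {}"
  proof -
    from normalise[OF z(2)] obtain a where "inner_on I (\<lambda>i. of_real a * z i) (\<lambda>i. of_real a * z i) = 1" by blast
    moreover have "(\<lambda>i. of_real a * z i) \<in> S" using z(1) by (intro scaleS) (auto simp: S_def)
    ultimately show ?thesis by (auto simp: Q_def)
  qed
  define C where "C = (\<Sum>i\<in>I. \<Sum>j\<in>I. cmod (M i j))"
  have lb: "- C \<le> q v" if "inner_on I v v = 1" for v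
  proof -
    have "cmod (inner_on I v (mat_vec I M v)) \<le> C"
      unfolding inner_on_mat_vec C_def
    proof (intro sum_norm_le)
      fix i j assume ij: "i \<in> I" "j \<in> I"
      have "cmod (v i) * cmod (M i j) * cmod (v j) \<le> 1 * cmod (M i j) * 1"
        using unit_bound[OF that] ij by (intro mult_mono) auto
      then show "cmod (cnj (v i) * M i j * v j) \<le> cmod (M i j)" by (simp add: norm_mult)
    qed
    moreover have "- cmod (inner_on I v (mat_vec I M v)) \<le> q v"
      unfolding q_def using abs_Re_le_cmod[of "inner_on I v (mat_vec I M v)"] by linarith
    ultimately show ?thesis by linarith
  qed
  have bdd: "bdd_below Q" using lb by (auto simp: Q_def intro!: bdd_belowI2)
  define \<mu> where "\<mu> = Inf Q"
  have inf_le: "\<mu> \<le> q v" if "v \<in> S" "inner_on I v v = 1" for v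
    unfolding \<mu>_def using bdd that by (intro cInf_lower) (auto simp: Q_def)
  have "\<exists>v. v \<in> S \<and> inner_on I v v = 1 \<and> q v < \<mu> + 1 / real (Suc k)" for k
  proof -
    have "Inf Q < \<mu> + 1 / real (Suc k)" by (simp add: \<mu>_def)
    then obtain y where "y \<in> Q" "y < \<mu> + 1 / real (Suc k)"
      using cInf_lessD[OF Qne] by blast
    then show ?thesis by (auto simp: Q_def)
  qed
  then obtain f where f: "\<And>k. f k \<in> S" "\<And>k. inner_on I (f k) (f k) = 1" "\<And>k. q (f k) < \<mu> + 1 / real (Suc k)"
    by metis
  obtain r v where r: "strict_mono (r::nat \<Rightarrow> nat)" and lim: "\<forall>i\<in>I. (\<lambda>k. f (r k) i) \<longlonglongrightarrow> v i"
    using convergent_subsequence_on_finite[OF fin, of f 1] unit_bound f by blast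
  have "inner_on I (u j) v = 0" if "j < m" for j
  proof (rule LIMSEQ_unique)
    show "(\<lambda>k. inner_on I (u j) (f (r k))) \<longlonglongrightarrow> inner_on I (u j) v"
      unfolding inner_on_def using lim by (intro tendsto_intros) auto
    show "(\<lambda>k. inner_on I (u j) (f (r k))) \<longlonglongrightarrow> 0" using f(1) that by (simp add: S_def)
  qed
  then have vS: "v \<in> S" by (simp add: S_def)
  have "(\<lambda>k. inner_on I (f (r k)) (f (r k))) \<longlonglongrightarrow> inner_on I v v"
    unfolding inner_on_def using lim by (intro tendsto_intros) auto
  then have v1: "inner_on I v v = 1" using f(2) by (simp add: LIMSEQ_const_iff)
  have qlim: "(\<lambda>k. q (f (r k))) \<longlonglongrightarrow> q v"
    unfolding q_def inner_on_mat_vec using lim by (intro tendsto_intros) auto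
  have "(\<lambda>k. \<mu> + 1 / real (Suc k)) \<longlonglongrightarrow> \<mu> + 0"
    by (intro tendsto_intros LIMSEQ_Suc[OF lim_1_over_n])
  from LIMSEQ_subseq_LIMSEQ[OF this r] have "(\<lambda>k. \<mu> + 1 / real (Suc (r k))) \<longlonglongrightarrow> \<mu>" by (simp add: o_def)
  then have "q v \<le> \<mu>" using qlim f(3) by (intro LIMSEQ_le[OF qlim]) (auto intro: less_imp_le)
  then have qv: "q v = \<mu>" using inf_le[OF vS v1] by simp
  \<comment> \<open>Homogeneity extends the minimality of \<mu> from unit vectors to all of
    \<open>S\<close>.\<close>
  have key: "\<mu> * Re (inner_on I w w) \<le> q w" if "w \<in> S" for w
  proof (cases "inner_on I w w = 0")
    case True
    then have "(\<Sum>i\<in>I. (cmod (w i))\<^sup>2) = 0" unfolding inner_on_self by (metis of_real_eq_0_iff)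
    then have "\<forall>i\<in>I. w i = 0" using fin by (auto simp: sum_nonneg_eq_0_iff)
    then have "q w = 0" by (simp add: q_def inner_on_def)
    then show ?thesis using True by simp
  next
    case False
    from normalise[OF this] obtain a where a: "a > 0"
      "inner_on I (\<lambda>i. of_real a * w i) (\<lambda>i. of_real a * w i) = 1" "a\<^sup>2 * Re (inner_on I w w) = 1" by blast
    have "\<mu> \<le> a\<^sup>2 * q w" using inf_le[OF scaleS[OF that] a(2)] by (simp add: qscale)
    then have "a\<^sup>2 * (\<mu> * Re (inner_on I w w)) \<le> a\<^sup>2 * q w" using a(3) by (simp add: algebra_simps)
    then show ?thesis using a(1) by simp
  qed
  \<comment> \<open>On \<open>S\<close> the form of M - \<mu> is nonnegative, and it vanishes at the
    minimiser v.\<close>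
  define A where "A w = (\<lambda>i. mat_vec I M w i - of_real \<mu> * w i)" for w
  have A_add: "A (\<lambda>i. v i + of_real t * w i) = (\<lambda>i. A v i + of_real t * A w i)" for v w t
    by (simp add: A_def mat_vec_def fun_eq_iff algebra_simps sum.distrib sum_distrib_left)
  have hA: "Re (inner_on I w (A w)) = q w - \<mu> * Re (inner_on I w w)" for w
    by (simp add: A_def inner_on_diff_right inner_on_scale_right q_def)
  have symA: "inner_on I w (A v) = inner_on I (A w) v" for v w
  proof -
    have "inner_on I (A w) v = cnj (inner_on I v (A w))" by (simp add: inner_on_cnj)
    also have "\<dots> = cnj (inner_on I v (mat_vec I M w)) - of_real \<mu> * cnj (inner_on I v w)"
      by (simp add: A_def inner_on_diff_right inner_on_scale_right)
    also have "\<dots> = inner_on I w (A v)"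
      by (simp add: A_def inner_on_diff_right inner_on_scale_right inner_on_cnj inner_on_mat_vec_adjoint[OF herm])
    finally show ?thesis by simp
  qed
  define w where "w = A v"
  \<comment> \<open>M is Hermitian and each u k is an eigenvector, so M maps the orthogonal
    complement \<open>S\<close> into itself.\<close>
  have wS: "w \<in> S"
  proof -
    have "inner_on I (u k) (mat_vec I M v) = 0" if "k < m" for k
    proof -
      have "inner_on I (u k) (mat_vec I M v) = inner_on I (mat_vec I M (u k)) v" by (rule inner_on_mat_vec_adjoint[OF herm])
      also have "\<dots> = inner_on I (\<lambda>i. of_real (l k) * u k i) v"
        unfolding inner_on_def using eig[OF that] by (intro sum.cong) auto
      also have "\<dots> = 0" using vS that by (simp add: inner_on_scale_left S_def)
      finally show ?thesis .
    qed
    then show ?thesis using vS by (simp add: w_def A_def S_def inner_on_diff_right inner_on_scale_right)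
  qed
  \<comment> \<open>First-order condition: moving v in the direction w = A v changes the form by 2t
    times the squared norm of w, up to second order, so w vanishes on \<open>I\<close>.\<close>
  have "2 * Re (inner_on I w w) = 0"
  proof (rule nonneg_quadratic_linear_zero)
    fix t :: real
    let ?x = "\<lambda>i. v i + of_real t * w i"
    have "?x \<in> S" using vS wS scaleS addS by blast
    then have "0 \<le> Re (inner_on I ?x (A ?x))" using key hA by simp
    also have "inner_on I ?x (A ?x) = inner_on I v (A v) + of_real t * (inner_on I v (A w) + inner_on I w (A v))
        + of_real (t\<^sup>2) * inner_on I w (A w)"
      unfolding A_add by (simp add: inner_on_add_left inner_on_add_right inner_on_scale_left inner_on_scale_right
        algebra_simps power2_eq_square)
    also have "Re \<dots> = t * (2 * Re (inner_on I w w)) + t\<^sup>2 * Re (inner_on I w (A w))"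
      using hA[of v] qv v1 symA[of v w] by (simp add: w_def)
    finally show "0 \<le> t * (2 * Re (inner_on I w w)) + t\<^sup>2 * Re (inner_on I w (A w))" .
  qed
  then have "(\<Sum>i\<in>I. (cmod (w i))\<^sup>2) = 0" by (simp add: inner_on_self)
  then have "\<forall>i\<in>I. w i = 0" using fin by (auto simp: sum_nonneg_eq_0_iff)
  then have "\<forall>i\<in>I. mat_vec I M v i = of_real \<mu> * v i" by (simp add: w_def A_def)
  then show ?thesis using vS v1 unfolding S_def by blast
qed

text \<open>r is the basis vector at a minus its projection onto the span of the V k. It serves
  twice: a nonzero residual starts the search for the next eigenvector, and vanishing residuals
  express completeness.\<close>

lemma residual_inner_product:
  fixes V :: "nat \<Rightarrow> 'i \<Rightarrow> complex"
  assumes fin: "finite I"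
    and on: "\<And>j k. j < m \<Longrightarrow> k < m \<Longrightarrow> inner_on I (V j) (V k) = (if j = k then 1 else 0)"
    and a: "a \<in> I"
  defines "r \<equiv> \<lambda>i. (if i = a then 1 else 0) - (\<Sum>k<m. cnj (V k a) * V k i)"
  shows "\<And>j. j < m \<Longrightarrow> inner_on I (V j) r = 0"
    and "inner_on I r r = of_real (1 - (\<Sum>k<m. (cmod (V k a))\<^sup>2))"
proof -
  have e: "inner_on I v (\<lambda>i. if i = a then 1 else 0) = cnj (v a)" for v
    using fin a by (simp add: inner_on_def if_distrib cong: if_cong)
  have s: "inner_on I v (\<lambda>i. \<Sum>k<m. cnj (V k a) * V k i) = (\<Sum>k<m. cnj (V k a) * inner_on I v (V k))" for v
  proof -
    have "inner_on I v (\<lambda>i. \<Sum>k<m. cnj (V k a) * V k i) = (\<Sum>i\<in>I. \<Sum>k<m. cnj (V k a) * (cnj (v i) * V k i))"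
      by (simp add: inner_on_def sum_distrib_left algebra_simps)
    also have "\<dots> = (\<Sum>k<m. \<Sum>i\<in>I. cnj (V k a) * (cnj (v i) * V k i))" by (rule sum.swap)
    finally show ?thesis by (simp add: inner_on_def sum_distrib_left)
  qed
  show orth: "inner_on I (V j) r = 0" if "j < m" for j
  proof -
    have "(\<Sum>k<m. cnj (V k a) * inner_on I (V j) (V k)) = (\<Sum>k<m. if k = j then cnj (V k a) else 0)"
      using on that by (intro sum.cong) auto
    then show ?thesis using that unfolding r_def inner_on_diff_right e s by simp
  qed
  have "inner_on I w r = cnj (w a) - (\<Sum>k<m. cnj (V k a) * inner_on I w (V k))" for w
    unfolding r_def inner_on_diff_right e s ..
  then have "inner_on I r r = cnj (r a) - (\<Sum>k<m. cnj (V k a) * inner_on I r (V k))" .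
  also have "(\<Sum>k<m. cnj (V k a) * inner_on I r (V k)) = 0"
    using orth by (intro sum.neutral) (auto simp: inner_on_cnj[symmetric, of I r])
  finally have "inner_on I r r = cnj (r a)" by simp
  also have "\<dots> = 1 - (\<Sum>k<m. V k a * cnj (V k a))" by (simp add: r_def)
  finally show "inner_on I r r = of_real (1 - (\<Sum>k<m. (cmod (V k a))\<^sup>2))"
    by (simp only: of_real_diff of_real_1 of_real_sum complex_norm_square)
qed

text \<open>Counting: m orthonormal vectors have total squared mass m, so for m < card I some basis
  vector is not in their span and another eigenvector exists.\<close>

theorem spectral_theorem:
  fixes M :: "'i op"
  assumes fin: "finite I" and herm: "hermitian_on I M"
  obtains V :: "nat \<Rightarrow> 'i \<Rightarrow> complex" and l :: "nat \<Rightarrow> real" where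
    "\<And>j k. j < card I \<Longrightarrow> k < card I \<Longrightarrow> inner_on I (V j) (V k) = (if j = k then 1 else 0)"
    "\<And>i j. i \<in> I \<Longrightarrow> j \<in> I \<Longrightarrow> (\<Sum>k<card I. V k i * cnj (V k j)) = (if i = j then 1 else 0)"
    "\<And>k i. k < card I \<Longrightarrow> i \<in> I \<Longrightarrow> mat_vec I M (V k) i = of_real (l k) * V k i"
proof -
  have "\<exists>V l. (\<forall>j<m. \<forall>k<m. inner_on I (V j) (V k) = (if j = k then 1 else 0)) \<and>
      (\<forall>k<m. \<forall>i\<in>I. mat_vec I M (V k) i = of_real (l k :: real) * V k i)" if "m \<le> card I" for m
    using that
  proof (induction m)
    case 0
    then show ?case by auto
  next
    case (Suc m)
    then obtain V l where on: "\<And>j k. j < m \<Longrightarrow> k < m \<Longrightarrow> inner_on I (V j) (V k) = (if j = k then 1 else 0)"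
      and ev: "\<And>k i. k < m \<Longrightarrow> i \<in> I \<Longrightarrow> mat_vec I M (V k) i = of_real (l k :: real) * V k i"
      by fastforce
    have "\<exists>a\<in>I. (\<Sum>k<m. (cmod (V k a))\<^sup>2) < 1"
    proof (rule ccontr)
      assume "\<not> ?thesis"
      then have "(\<Sum>a\<in>I. 1) \<le> (\<Sum>a\<in>I. \<Sum>k<m. (cmod (V k a))\<^sup>2)" by (intro sum_mono) auto
      also have "\<dots> = (\<Sum>k<m. \<Sum>a\<in>I. (cmod (V k a))\<^sup>2)" by (rule sum.swap)
      also have "\<dots> = (\<Sum>k<m. 1)"
      proof (intro sum.cong refl)
        fix k assume "k \<in> {..<m}"
        then have "inner_on I (V k) (V k) = 1" using on by simp
        then show "(\<Sum>a\<in>I. (cmod (V k a))\<^sup>2) = 1" unfolding inner_on_self by (metis of_real_eq_1_iff)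
      qed
      finally show False using Suc.prems by simp
    qed
    then obtain a where a: "a \<in> I" "(\<Sum>k<m. (cmod (V k a))\<^sup>2) < 1" by blast
    have "\<exists>v \<mu>. (\<forall>k<m. inner_on I (V k) v = 0) \<and> inner_on I v v = 1 \<and> (\<forall>i\<in>I. mat_vec I M v i = of_real (\<mu>::real) * v i)"
    proof (rule next_eigenvector[OF fin herm])
      show "\<And>k i. k < m \<Longrightarrow> i \<in> I \<Longrightarrow> mat_vec I M (V k) i = of_real (l k) * V k i" by (rule ev)
      let ?z = "\<lambda>i. (if i = a then 1 else 0) - (\<Sum>k<m. cnj (V k a) * V k i)"
      show "\<And>k. k < m \<Longrightarrow> inner_on I (V k) ?z = 0"
        by (rule residual_inner_product(1)[OF fin on a(1)])
      have "inner_on I ?z ?z = of_real (1 - (\<Sum>k<m. (cmod (V k a))\<^sup>2))"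
        by (rule residual_inner_product(2)[OF fin on a(1)])
      then show "inner_on I ?z ?z \<noteq> 0" using a(2) by (metis diff_gt_0_iff_gt less_irrefl of_real_eq_0_iff)
    qed
    then obtain v \<mu> where v: "\<forall>k<m. inner_on I (V k) v = 0" "inner_on I v v = 1"
      "\<forall>i\<in>I. mat_vec I M v i = of_real (\<mu>::real) * v i" by blast
    have v': "\<forall>k<m. inner_on I v (V k) = 0" using v(1) by (metis inner_on_cnj complex_cnj_zero)
    show ?case
    proof (intro exI conjI)
      show "\<forall>j<Suc m. \<forall>k<Suc m. inner_on I ((V(m := v)) j) ((V(m := v)) k) = (if j = k then 1 else 0)"
        using on v v' by (auto simp: less_Suc_eq)
      show "\<forall>k<Suc m. \<forall>i\<in>I. mat_vec I M ((V(m := v)) k) i = of_real ((l(m := \<mu>)) k) * (V(m := v)) k i"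
        using ev v(3) by (auto simp: less_Suc_eq)
    qed
  qed
  from this[of "card I"] obtain V l where
    on: "\<And>j k. j < card I \<Longrightarrow> k < card I \<Longrightarrow> inner_on I (V j) (V k) = (if j = k then 1 else 0)"
    and ev: "\<And>k i. k < card I \<Longrightarrow> i \<in> I \<Longrightarrow> mat_vec I M (V k) i = of_real (l k :: real) * V k i"
    by fastforce
  \<comment> \<open>With card I eigenvectors, these defects are squared norms of residuals and sum
    to zero, so all residuals vanish.\<close>
  define b where "b a = 1 - (\<Sum>k<card I. (cmod (V k a))\<^sup>2)" for a
  define r where "r a = (\<lambda>i. (if i = a then 1 else 0) - (\<Sum>k<card I. cnj (V k a) * V k i))" for a
  have rr: "inner_on I (r a) (r a) = of_real (b a)" if "a \<in> I" for a
    unfolding r_def b_def by (rule residual_inner_product(2)[OF fin on that])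
  have b0: "b a \<ge> 0" if "a \<in> I" for a
  proof -
    have "b a = (\<Sum>i\<in>I. (cmod (r a i))\<^sup>2)" using rr[OF that] unfolding inner_on_self by (metis of_real_eq_iff)
    then show ?thesis by (simp add: sum_nonneg)
  qed
  have "(\<Sum>a\<in>I. b a) = real (card I) - (\<Sum>a\<in>I. \<Sum>k<card I. (cmod (V k a))\<^sup>2)"
    by (simp add: b_def sum_subtractf)
  also have "(\<Sum>a\<in>I. \<Sum>k<card I. (cmod (V k a))\<^sup>2) = (\<Sum>k<card I. \<Sum>a\<in>I. (cmod (V k a))\<^sup>2)"
    by (rule sum.swap)
  also have "\<dots> = (\<Sum>k<card I. 1)"
  proof (intro sum.cong refl)
    fix k assume "k \<in> {..<card I}"
    then have "inner_on I (V k) (V k) = 1" using on by simp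
    then show "(\<Sum>a\<in>I. (cmod (V k a))\<^sup>2) = 1" unfolding inner_on_self by (metis of_real_eq_1_iff)
  qed
  finally have "(\<Sum>a\<in>I. b a) = 0" by simp
  then have bz: "b a = 0" if "a \<in> I" for a using b0 fin that by (auto simp: sum_nonneg_eq_0_iff)
  have "r a i = 0" if "a \<in> I" "i \<in> I" for a i
  proof -
    have "(\<Sum>i\<in>I. (cmod (r a i))\<^sup>2) = 0" using rr[OF that(1)] bz[OF that(1)] unfolding inner_on_self by (metis of_real_eq_iff)
    then show ?thesis using fin that by (auto simp: sum_nonneg_eq_0_iff)
  qed
  then have compl: "(\<Sum>k<card I. V k i * cnj (V k j)) = (if i = j then 1 else 0)" if "i \<in> I" "j \<in> I" for i j
    using that by (auto simp: r_def mult.commute split: if_splits)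
  show ?thesis by (rule that[OF on compl ev])
qed

section \<open>Positive semidefinite operators\<close>

text \<open>Rectangular, so that a vector can be passed as a matrix with column type
  \<open>unit\<close>. Sums run over the contracted index set only.\<close>

definition mat_mult :: "'k set \<Rightarrow> ('i \<Rightarrow> 'k \<Rightarrow> complex) \<Rightarrow> ('k \<Rightarrow> 'j \<Rightarrow> complex) \<Rightarrow> 'i \<Rightarrow> 'j \<Rightarrow> complex" where
  "mat_mult I A B = (\<lambda>i j. \<Sum>k\<in>I. A i k * B k j)"

definition dagger :: "('i \<Rightarrow> 'j \<Rightarrow> complex) \<Rightarrow> 'j \<Rightarrow> 'i \<Rightarrow> complex" where
  "dagger A = (\<lambda>i j. cnj (A j i))"

lemma mat_mult_assoc: "mat_mult J (mat_mult I A B) C = mat_mult I A (mat_mult J B C)"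
proof (intro ext)
  fix i j
  have "mat_mult J (mat_mult I A B) C i j = (\<Sum>k\<in>J. \<Sum>m\<in>I. A i m * B m k * C k j)"
    by (simp add: mat_mult_def sum_distrib_right)
  also have "\<dots> = (\<Sum>m\<in>I. \<Sum>k\<in>J. A i m * B m k * C k j)" by (rule sum.swap)
  also have "\<dots> = mat_mult I A (mat_mult J B C) i j"
    by (simp add: mat_mult_def sum_distrib_left mult.assoc)
  finally show "mat_mult J (mat_mult I A B) C i j = mat_mult I A (mat_mult J B C) i j" .
qed

lemma trace_mat_mult_commute: "trace_on I (mat_mult J A B) = trace_on J (mat_mult I B A)"
  unfolding trace_on_def mat_mult_def by (subst sum.swap) (simp add: mult.commute)

lemma dagger_mat_mult: "dagger (mat_mult I A B) = mat_mult I (dagger B) (dagger A)"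
  by (simp add: dagger_def mat_mult_def fun_eq_iff mult.commute)

lemma dagger_dagger [simp]: "dagger (dagger A) = A"
  by (simp add: dagger_def)

lemma tr_prod_eq_trace: "tr_prod I A B = trace_on I (mat_mult I A B)"
  by (simp add: tr_prod_def trace_on_def mat_mult_def)

lemma mat_mult_id_left:
  assumes "finite I" "\<And>i j. i \<notin> I \<Longrightarrow> A i j = 0"
  shows "mat_mult I (id_op I) A = A"
proof (intro ext)
  fix i j
  have "mat_mult I (id_op I) A i j = (\<Sum>k\<in>I. if k = i then A k j else 0)"
    unfolding mat_mult_def id_op_def by (intro sum.cong) auto
  then show "mat_mult I (id_op I) A i j = A i j" using assms by simp
qed

lemma mat_mult_id_right:
  assumes "finite I" "\<And>i j. j \<notin> I \<Longrightarrow> A i j = 0"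
  shows "mat_mult I A (id_op I) = A"
proof (intro ext)
  fix i j
  have "mat_mult I A (id_op I) i j = (\<Sum>k\<in>I. if k = j then A i k else 0)"
    unfolding mat_mult_def id_op_def by (intro sum.cong) auto
  then show "mat_mult I A (id_op I) i j = A i j" using assms by simp
qed

lemma supported_on_mat_mult: "supported_on I A \<Longrightarrow> supported_on I B \<Longrightarrow> supported_on I (mat_mult J A B)"
  by (auto simp: supported_on_def mat_mult_def intro!: sum.neutral)

lemma supported_on_dagger: "supported_on I A \<Longrightarrow> supported_on I (dagger A)"
  by (auto simp: supported_on_def dagger_def)

lemma supported_on_id: "supported_on I (id_op I)"
  by (auto simp: supported_on_def id_op_def)

lemma mat_vec_mat_mult: "mat_vec I (mat_mult I A B) v = mat_vec I A (mat_vec I B v)"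
proof
  fix i
  have "mat_vec I (mat_mult I A B) v i = (\<Sum>j\<in>I. \<Sum>k\<in>I. A i k * B k j * v j)"
    by (simp add: mat_vec_def mat_mult_def sum_distrib_right)
  also have "\<dots> = (\<Sum>k\<in>I. \<Sum>j\<in>I. A i k * B k j * v j)" by (rule sum.swap)
  finally show "mat_vec I (mat_mult I A B) v i = mat_vec I A (mat_vec I B v) i"
    by (simp add: mat_vec_def sum_distrib_left mult.assoc)
qed

lemma mat_vec_cong: "(\<And>j. j \<in> I \<Longrightarrow> v j = w j) \<Longrightarrow> mat_vec I A v = mat_vec I A w"
  by (auto simp: mat_vec_def fun_eq_iff intro!: sum.cong)

lemma mat_vec_scale: "mat_vec I A (\<lambda>i. a * v i) = (\<lambda>i. a * mat_vec I A v i)"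
  by (simp add: mat_vec_def sum_distrib_left algebra_simps)

lemma mat_vec_add: "mat_vec I A (\<lambda>i. v i + w i) = (\<lambda>i. mat_vec I A v i + mat_vec I A w i)"
  by (simp add: mat_vec_def sum.distrib algebra_simps)

lemma psd_on_iff_inner_on:
  "psd_on I M \<longleftrightarrow> (\<forall>v. Im (inner_on I v (mat_vec I M v)) = 0 \<and> Re (inner_on I v (mat_vec I M v)) \<ge> 0)"
  by (simp add: psd_on_def inner_on_mat_vec)

text \<open>Polarisation: \<open>psd_on\<close> demands real values of the quadratic form, and
  testing v + w and v + i w compares h v w with h w v.\<close>

lemma psd_on_hermitian:
  assumes fin: "finite I" and psd: "psd_on I M"
  shows "hermitian_on I M"
  unfolding hermitian_on_def
proof (intro ballI)
  fix i j assume ij: "i \<in> I" "j \<in> I"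
  define h where "h v w = inner_on I v (mat_vec I M w)" for v w
  have real: "Im (h v v) = 0" for v using psd by (simp add: psd_on_iff_inner_on h_def)
  have add: "h (\<lambda>i. v i + w i) (\<lambda>i. v i + w i) = h v v + h v w + h w v + h w w" for v w
    by (simp add: h_def mat_vec_add inner_on_add_left inner_on_add_right)
  have im: "Im (h v w + h w v) = 0" for v w
    using real[of "\<lambda>i. v i + w i"] real[of v] real[of w] unfolding add by simp
  have "h v (\<lambda>i. \<i> * w i) + h (\<lambda>i. \<i> * w i) v = \<i> * (h v w - h w v)" for v w
    by (simp add: h_def mat_vec_scale inner_on_scale_left inner_on_scale_right algebra_simps)
  then have re: "Re (h v w - h w v) = 0" for v w
    using im[of v "\<lambda>i. \<i> * w i"] by simp
  define e where "e a = (\<lambda>i. if i = a then 1 else 0 :: complex)" for a :: 'a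
  have e: "h (e a) (e b) = M a b" if "a \<in> I" "b \<in> I" for a b
  proof -
    have "mat_vec I M (e b) = (\<lambda>i. M i b)"
    proof
      fix i
      have "mat_vec I M (e b) i = (\<Sum>j\<in>I. if j = b then M i j else 0)"
        unfolding mat_vec_def e_def by (intro sum.cong) auto
      then show "mat_vec I M (e b) i = M i b" using fin that by simp
    qed
    moreover have "inner_on I (e a) w = w a" for w
    proof -
      have "inner_on I (e a) w = (\<Sum>i\<in>I. if i = a then w i else 0)"
        unfolding inner_on_def e_def by (intro sum.cong) auto
      then show ?thesis using fin that by simp
    qed
    ultimately show ?thesis by (simp add: h_def)
  qed
  show "M j i = cnj (M i j)"
    using im[of "e i" "e j"] re[of "e i" "e j"] ij by (auto simp: e complex_eq_iff)
qed

text \<open>The root is the spectral sum with weights sqrt (l k). The last clause holds because a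
  matrix commuting with M maps eigenvectors to eigenvectors of the same eigenvalue, and K acts on
  each eigenspace as a scalar.\<close>

lemma psd_on_sqrt:
  fixes M :: "'i op"
  assumes fin: "finite I" and sup: "supported_on I M" and psd: "psd_on I M"
  obtains K where "supported_on I K" "dagger K = K" "mat_mult I K K = M"
    "\<And>C. supported_on I C \<Longrightarrow> mat_mult I C M = mat_mult I M C \<Longrightarrow> mat_mult I C K = mat_mult I K C"
proof -
  note herm = psd_on_hermitian[OF fin psd]
  obtain V l where on: "\<And>j k. j < card I \<Longrightarrow> k < card I \<Longrightarrow> inner_on I (V j) (V k) = (if j = k then 1 else 0)"
    and compl: "\<And>i j. i \<in> I \<Longrightarrow> j \<in> I \<Longrightarrow> (\<Sum>k<card I. V k i * cnj (V k j)) = (if i = j then 1 else 0)"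
    and ev: "\<And>k i. k < card I \<Longrightarrow> i \<in> I \<Longrightarrow> mat_vec I M (V k) i = of_real (l k :: real) * V k i"
    using spectral_theorem[OF fin herm] by blast
  have expand: "w i = (\<Sum>k<card I. inner_on I (V k) w * V k i)" if "i \<in> I" for w i
  proof -
    have "(\<Sum>k<card I. inner_on I (V k) w * V k i) = (\<Sum>k<card I. \<Sum>j\<in>I. V k i * cnj (V k j) * w j)"
      by (simp add: inner_on_def sum_distrib_left sum_distrib_right algebra_simps)
    also have "\<dots> = (\<Sum>j\<in>I. (\<Sum>k<card I. V k i * cnj (V k j)) * w j)"
      by (subst sum.swap) (simp add: sum_distrib_right)
    also have "\<dots> = (\<Sum>j\<in>I. if j = i then w j else 0)"
      using compl that by (intro sum.cong) auto
    finally show ?thesis using fin that by simp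
  qed
  \<comment> \<open>An eigenvector w for \<mu> is orthogonal to every V k whose eigenvalue differs
    from \<mu>.\<close>
  have eigen: "l k * inner_on I (V k) w = \<mu> * inner_on I (V k) w"
    if "\<And>i. i \<in> I \<Longrightarrow> mat_vec I M w i = of_real \<mu> * w i" "k < card I" for \<mu> w k
  proof -
    have "of_real \<mu> * inner_on I (V k) w = inner_on I (V k) (mat_vec I M w)"
      unfolding inner_on_def sum_distrib_left using that(1) by (intro sum.cong) auto
    also have "\<dots> = inner_on I (mat_vec I M (V k)) w" by (rule inner_on_mat_vec_adjoint[OF herm])
    also have "\<dots> = inner_on I (\<lambda>i. of_real (l k) * V k i) w"
      unfolding inner_on_def using ev[OF that(2)] by (intro sum.cong) auto
    finally show ?thesis by (simp only: inner_on_scale_left complex_cnj_complex_of_real)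
  qed
  have l0: "l k \<ge> 0" if "k < card I" for k
  proof -
    have "inner_on I (V k) (mat_vec I M (V k)) = inner_on I (V k) (\<lambda>i. of_real (l k) * V k i)"
      unfolding inner_on_def using ev[OF that] by (intro sum.cong) auto
    also have "\<dots> = of_real (l k)" using on that by (simp add: inner_on_scale_right)
    finally show ?thesis using psd unfolding psd_on_iff_inner_on by (metis Re_complex_of_real)
  qed
  define K where "K = (\<lambda>i j. if i \<in> I \<and> j \<in> I then \<Sum>k<card I. of_real (sqrt (l k)) * V k i * cnj (V k j) else 0)"
  have Ksup: "supported_on I K" by (auto simp: supported_on_def K_def)
  have Kadj: "dagger K = K"
    by (auto simp: dagger_def K_def fun_eq_iff algebra_simps)
  have Kv: "mat_vec I K w i = (\<Sum>k<card I. of_real (sqrt (l k)) * inner_on I (V k) w * V k i)" if "i \<in> I" for w i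
  proof -
    have "mat_vec I K w i = (\<Sum>j\<in>I. \<Sum>k<card I. of_real (sqrt (l k)) * V k i * cnj (V k j) * w j)"
      unfolding mat_vec_def K_def using that by (intro sum.cong) (auto simp: sum_distrib_right)
    also have "\<dots> = (\<Sum>k<card I. \<Sum>j\<in>I. of_real (sqrt (l k)) * V k i * cnj (V k j) * w j)" by (rule sum.swap)
    finally show ?thesis by (simp add: inner_on_def sum_distrib_left sum_distrib_right algebra_simps)
  qed
  \<comment> \<open>Stated for every eigenvector of M, not just the V k: it is applied below to C (V
    m).\<close>
  have Keig: "mat_vec I K w i = of_real (sqrt \<mu>) * w i"
    if "\<And>i. i \<in> I \<Longrightarrow> mat_vec I M w i = of_real \<mu> * w i" "i \<in> I" for \<mu> w i
  proof -
    have "mat_vec I K w i = (\<Sum>k<card I. of_real (sqrt \<mu>) * (inner_on I (V k) w * V k i))"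
      unfolding Kv[OF that(2)]
    proof (intro sum.cong refl)
      fix k assume "k \<in> {..<card I}"
      then have "of_real (l k) * inner_on I (V k) w = of_real \<mu> * inner_on I (V k) w" using eigen that(1) by simp
      then have "l k = \<mu> \<or> inner_on I (V k) w = 0" unfolding mult_cancel_right of_real_eq_iff by blast
      then show "of_real (sqrt (l k)) * inner_on I (V k) w * V k i = of_real (sqrt \<mu>) * (inner_on I (V k) w * V k i)"
        by (elim disjE) simp_all
    qed
    then show ?thesis using expand[OF that(2), of w] by (simp add: sum_distrib_left[symmetric])
  qed
  have basis_ext: "A = B" if "supported_on I A" "supported_on I B"
      "\<And>m i. m < card I \<Longrightarrow> i \<in> I \<Longrightarrow> mat_vec I A (V m) i = mat_vec I B (V m) i" for A B
  proof (intro ext)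
    fix i j
    have *: "C i j = (\<Sum>m<card I. mat_vec I C (V m) i * cnj (V m j))" if "i \<in> I" "j \<in> I" for C
    proof -
      have "(\<Sum>m<card I. mat_vec I C (V m) i * cnj (V m j)) = (\<Sum>m<card I. \<Sum>k\<in>I. C i k * (V m k * cnj (V m j)))"
        by (simp add: mat_vec_def sum_distrib_right mult.assoc)
      also have "\<dots> = (\<Sum>k\<in>I. C i k * (\<Sum>m<card I. V m k * cnj (V m j)))"
        by (subst sum.swap) (simp add: sum_distrib_left)
      also have "\<dots> = (\<Sum>k\<in>I. if k = j then C i k else 0)"
        using compl that by (intro sum.cong) auto
      finally show ?thesis using fin that by simp
    qed
    show "A i j = B i j"
    proof (cases "i \<in> I \<and> j \<in> I")
      case True
      then show ?thesis using that(3) *[of A] *[of B] by simp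
    next
      case False
      then show ?thesis using that(1,2) by (auto simp: supported_on_def)
    qed
  qed
  show thesis
  proof (rule that[OF Ksup Kadj])
    show "mat_mult I K K = M"
    proof (rule basis_ext)
      fix m i assume m: "m < card I" "i \<in> I"
      have "mat_vec I K (mat_vec I K (V m)) i = mat_vec I K (\<lambda>i. of_real (sqrt (l m)) * V m i) i"
        using Keig[of "V m" "l m"] ev m by (subst mat_vec_cong) auto
      also have "\<dots> = of_real (sqrt (l m)) * (of_real (sqrt (l m)) * V m i)"
        unfolding mat_vec_scale using Keig[of "V m" "l m"] ev m by auto
      also have "\<dots> = of_real (sqrt (l m) * sqrt (l m)) * V m i"
        by (simp only: of_real_mult mult.assoc)
      also have "sqrt (l m) * sqrt (l m) = l m" using l0[OF m(1)] by simp
      also have "of_real (l m) * V m i = mat_vec I M (V m) i" using ev[OF m] by simp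
      finally show "mat_vec I (mat_mult I K K) (V m) i = mat_vec I M (V m) i" by (simp add: mat_vec_mat_mult)
    qed (use Ksup sup supported_on_mat_mult in auto)
    fix C assume C: "supported_on I C" "mat_mult I C M = mat_mult I M C"
    show "mat_mult I C K = mat_mult I K C"
    proof (rule basis_ext)
      fix m i assume m: "m < card I" "i \<in> I"
      have "mat_vec I M (mat_vec I C (V m)) i = of_real (l m) * mat_vec I C (V m) i" for i
      proof -
        have "mat_vec I M (mat_vec I C (V m)) = mat_vec I C (mat_vec I M (V m))" using C(2) by (metis mat_vec_mat_mult)
        also have "\<dots> = mat_vec I C (\<lambda>i. of_real (l m) * V m i)" using ev m by (intro mat_vec_cong) auto
        finally show ?thesis by (simp add: mat_vec_scale)
      qed
      then have "mat_vec I K (mat_vec I C (V m)) i = of_real (sqrt (l m)) * mat_vec I C (V m) i"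
        using Keig m by blast
      also have "\<dots> = mat_vec I C (\<lambda>i. of_real (sqrt (l m)) * V m i) i" by (simp add: mat_vec_scale)
      also have "mat_vec I C (\<lambda>i. of_real (sqrt (l m)) * V m i) = mat_vec I C (mat_vec I K (V m))"
        using Keig[of "V m" "l m"] ev m by (intro mat_vec_cong) auto
      finally show "mat_vec I (mat_mult I C K) (V m) i = mat_vec I (mat_mult I K C) (V m) i" by (simp add: mat_vec_mat_mult)
    qed (use Ksup C supported_on_mat_mult in auto)
  qed
qed

lemma psd_onI_gram:
  assumes "\<And>i j. i \<in> I \<Longrightarrow> j \<in> I \<Longrightarrow> M i j = (\<Sum>k\<in>L. G i k * cnj (G j k))"
  shows "psd_on I M"
proof -
  have "(\<Sum>i\<in>I. \<Sum>j\<in>I. cnj (v i) * M i j * v j) = of_real (\<Sum>k\<in>L. (cmod (\<Sum>i\<in>I. cnj (v i) * G i k))\<^sup>2)" for v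
  proof -
    have "(\<Sum>i\<in>I. \<Sum>j\<in>I. cnj (v i) * M i j * v j)
        = (\<Sum>i\<in>I. \<Sum>j\<in>I. \<Sum>k\<in>L. (cnj (v i) * G i k) * cnj (cnj (v j) * G j k))"
      using assms by (intro sum.cong) (auto simp: sum_distrib_left sum_distrib_right algebra_simps)
    also have "\<dots> = (\<Sum>i\<in>I. \<Sum>k\<in>L. \<Sum>j\<in>I. (cnj (v i) * G i k) * cnj (cnj (v j) * G j k))"
      by (intro sum.cong refl sum.swap)
    also have "\<dots> = (\<Sum>k\<in>L. \<Sum>i\<in>I. \<Sum>j\<in>I. (cnj (v i) * G i k) * cnj (cnj (v j) * G j k))"
      by (rule sum.swap)
    also have "\<dots> = (\<Sum>k\<in>L. (\<Sum>i\<in>I. cnj (v i) * G i k) * cnj (\<Sum>i\<in>I. cnj (v i) * G i k))"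
      unfolding cnj_sum sum_product by simp
    finally show ?thesis by (simp only: of_real_sum complex_norm_square)
  qed
  then show ?thesis by (simp add: psd_on_def sum_nonneg)
qed

text \<open>The square root is a Gram factor. Together with \<open>psd_onI_gram\<close>, this
  reduces reindexing and tensor products of positive operators to operations on the factors.\<close>

lemma psd_on_gram:
  fixes M :: "'i op"
  assumes fin: "finite I" and psd: "psd_on I M"
  obtains G :: "'i \<Rightarrow> 'i \<Rightarrow> complex" where
    "\<And>i j. i \<in> I \<Longrightarrow> j \<in> I \<Longrightarrow> M i j = (\<Sum>k\<in>I. G i k * cnj (G j k))"
proof -
  \<comment> \<open>\<open>psd_on\<close> does not constrain entries outside \<open>I\<close>, while
    the square root wants a supported matrix.\<close>
  define M' where "M' = (\<lambda>i j. if i \<in> I \<and> j \<in> I then M i j else 0)"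
  have "supported_on I M'" by (auto simp: supported_on_def M'_def)
  moreover have "psd_on I M'" using psd by (simp add: psd_on_def M'_def cong: sum.cong)
  ultimately obtain K where K: "dagger K = K" "mat_mult I K K = M'"
    using psd_on_sqrt[OF fin] by blast
  have "M i j = (\<Sum>k\<in>I. K i k * cnj (K j k))" if "i \<in> I" "j \<in> I" for i j
  proof -
    have "M i j = M' i j" using that by (simp add: M'_def)
    also have "\<dots> = mat_mult I K (dagger K) i j" using K by simp
    finally show ?thesis by (simp add: mat_mult_def dagger_def)
  qed
  then show thesis by (rule that)
qed

lemma psd_on_cong:
  "(\<And>i j. i \<in> I \<Longrightarrow> j \<in> I \<Longrightarrow> M i j = N i j) \<Longrightarrow> psd_on I M \<longleftrightarrow> psd_on I N"
  by (simp add: psd_on_def cong: sum.cong)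

lemma psd_on_add:
  assumes "psd_on I M" "psd_on I N"
  shows "psd_on I (\<lambda>i j. M i j + N i j)"
  using assms by (simp add: psd_on_def algebra_simps sum.distrib)

lemma psd_on_sum:
  assumes "\<And>m. m \<in> L \<Longrightarrow> psd_on I (F m)"
  shows "psd_on I (\<lambda>i j. \<Sum>m\<in>L. F m i j)"
proof -
  have "(\<Sum>i\<in>I. \<Sum>j\<in>I. cnj (v i) * (\<Sum>m\<in>L. F m i j) * v j)
      = (\<Sum>m\<in>L. \<Sum>i\<in>I. \<Sum>j\<in>I. cnj (v i) * F m i j * v j)" for v
  proof -
    have "(\<Sum>i\<in>I. \<Sum>j\<in>I. cnj (v i) * (\<Sum>m\<in>L. F m i j) * v j)
        = (\<Sum>i\<in>I. \<Sum>j\<in>I. \<Sum>m\<in>L. cnj (v i) * F m i j * v j)"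
      by (simp add: sum_distrib_left sum_distrib_right)
    also have "\<dots> = (\<Sum>i\<in>I. \<Sum>m\<in>L. \<Sum>j\<in>I. cnj (v i) * F m i j * v j)"
      by (intro sum.cong refl sum.swap)
    also have "\<dots> = (\<Sum>m\<in>L. \<Sum>i\<in>I. \<Sum>j\<in>I. cnj (v i) * F m i j * v j)"
      by (rule sum.swap)
    finally show ?thesis .
  qed
  then show ?thesis using assms by (simp add: psd_on_def sum_nonneg)
qed

text \<open>f may repeat indices: the rows of the Gram factor are then repeated too.\<close>

lemma psd_on_reindex:
  assumes "finite I" "psd_on I M" "f ` J \<subseteq> I"
  shows "psd_on J (\<lambda>i j. M (f i) (f j))"
proof -
  obtain G where "\<And>i j. i \<in> I \<Longrightarrow> j \<in> I \<Longrightarrow> M i j = (\<Sum>k\<in>I. G i k * cnj (G j k))"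
    using psd_on_gram assms(1,2) by blast
  then show ?thesis
    using assms(3) by (intro psd_onI_gram[where L = I and G = "\<lambda>i. G (f i)"]) auto
qed

text \<open>f and g read off the two tensor coordinates of an index in L; the Gram factor is the
  product of the two Gram factors.\<close>

lemma psd_on_tensor:
  assumes "finite I" "finite J" "psd_on I M" "psd_on J N" "f ` L \<subseteq> I" "g ` L \<subseteq> J"
  shows "psd_on L (\<lambda>x y. M (f x) (f y) * N (g x) (g y))"
proof -
  obtain G where G: "\<And>i j. i \<in> I \<Longrightarrow> j \<in> I \<Longrightarrow> M i j = (\<Sum>k\<in>I. G i k * cnj (G j k))"
    using psd_on_gram assms(1,3) by blast
  obtain H where H: "\<And>i j. i \<in> J \<Longrightarrow> j \<in> J \<Longrightarrow> N i j = (\<Sum>k\<in>J. H i k * cnj (H j k))"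
    using psd_on_gram assms(2,4) by blast
  show ?thesis
  proof (rule psd_onI_gram[where L = "I \<times> J" and G = "\<lambda>x (k, m). G (f x) k * H (g x) m"])
    fix x y assume "x \<in> L" "y \<in> L"
    then have "M (f x) (f y) * N (g x) (g y)
        = (\<Sum>k\<in>I. \<Sum>m\<in>J. (G (f x) k * cnj (G (f y) k)) * (H (g x) m * cnj (H (g y) m)))"
      using G H assms(5,6) by (simp add: sum_product image_subset_iff)
    also have "\<dots> = (\<Sum>k\<in>I. \<Sum>m\<in>J. (G (f x) k * H (g x) m) * cnj (G (f y) k * H (g y) m))"
      by (simp add: algebra_simps)
    finally show "M (f x) (f y) * N (g x) (g y) = (\<Sum>p\<in>I \<times> J. (case p of (k, m) \<Rightarrow> G (f x) k * H (g x) m)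
        * cnj (case p of (k, m) \<Rightarrow> G (f y) k * H (g y) m))"
      by (simp add: sum.cartesian_product case_prod_beta)
  qed
qed

lemma psd_on_congruence:
  assumes "psd_on I M"
  shows "psd_on J (mat_mult I (dagger C) (mat_mult I M C))"
proof -
  have "(\<Sum>i\<in>J. \<Sum>j\<in>J. cnj (v i) * mat_mult I (dagger C) (mat_mult I M C) i j * v j)
      = (\<Sum>k\<in>I. \<Sum>m\<in>I. cnj (\<Sum>j\<in>J. C k j * v j) * M k m * (\<Sum>j\<in>J. C m j * v j))" for v
  proof -
    \<comment> \<open>v becomes a one-column matrix, so that associativity of the product does the
      regrouping.\<close>
    define u where "u = (\<lambda>(j::'b) (_::unit). v j)"
    have "(\<Sum>i\<in>J. \<Sum>j\<in>J. cnj (v i) * mat_mult I (dagger C) (mat_mult I M C) i j * v j)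
        = mat_mult J (dagger u) (mat_mult J (mat_mult I (dagger C) (mat_mult I M C)) u) () ()"
      by (simp add: mat_mult_def[of J] dagger_def u_def sum_distrib_left mult.assoc)
    also have "mat_mult J (dagger u) (mat_mult J (mat_mult I (dagger C) (mat_mult I M C)) u)
        = mat_mult I (dagger (mat_mult J C u)) (mat_mult I M (mat_mult J C u))"
      by (simp add: mat_mult_assoc dagger_mat_mult)
    also have "\<dots> () () = (\<Sum>k\<in>I. \<Sum>m\<in>I. cnj (\<Sum>j\<in>J. C k j * v j) * M k m * (\<Sum>j\<in>J. C m j * v j))"
      by (simp only: mat_mult_def dagger_def u_def sum_distrib_left mult.assoc)
    finally show ?thesis .
  qed
  note eq = this
  show ?thesis unfolding psd_on_def eq
  proof
    fix v
    show "Im (\<Sum>k\<in>I. \<Sum>m\<in>I. cnj (\<Sum>j\<in>J. C k j * v j) * M k m * (\<Sum>j\<in>J. C m j * v j)) = 0 \<and>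
      Re (\<Sum>k\<in>I. \<Sum>m\<in>I. cnj (\<Sum>j\<in>J. C k j * v j) * M k m * (\<Sum>j\<in>J. C m j * v j)) \<ge> 0"
      using assms[unfolded psd_on_def, THEN spec, of "\<lambda>k. \<Sum>j\<in>J. C k j * v j"] .
  qed
qed

lemma trace_psd:
  assumes fin: "finite I" and "psd_on I M"
  shows "Im (trace_on I M) = 0" "Re (trace_on I M) \<ge> 0"
proof -
  obtain G where G: "\<And>i j. i \<in> I \<Longrightarrow> j \<in> I \<Longrightarrow> M i j = (\<Sum>k\<in>I. G i k * cnj (G j k))"
    using psd_on_gram[OF assms] by blast
  have "trace_on I M = of_real (\<Sum>i\<in>I. \<Sum>k\<in>I. (cmod (G i k))\<^sup>2)"
    unfolding trace_on_def of_real_sum complex_norm_square using G by (intro sum.cong) auto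
  then show "Im (trace_on I M) = 0" "Re (trace_on I M) \<ge> 0" by (simp_all add: sum_nonneg)
qed

text \<open>With N = H H^dagger, cyclicity turns tr (M N) into the trace of the positive operator
  H^dagger M H.\<close>

lemma tr_prod_psd:
  assumes fin: "finite I" and M: "psd_on I M" and N: "psd_on I N"
  shows "Im (tr_prod I M N) = 0" "Re (tr_prod I M N) \<ge> 0"
proof -
  obtain H where H: "\<And>i j. i \<in> I \<Longrightarrow> j \<in> I \<Longrightarrow> N i j = (\<Sum>k\<in>I. H i k * cnj (H j k))"
    using psd_on_gram[OF fin N] by blast
  have "tr_prod I M N = trace_on I (mat_mult I M (mat_mult I H (dagger H)))"
    unfolding tr_prod_eq_trace trace_on_def mat_mult_def dagger_def using H by (intro sum.cong) auto
  also have "\<dots> = trace_on I (mat_mult I (dagger H) (mat_mult I M H))"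
    by (subst mat_mult_assoc[symmetric]) (rule trace_mat_mult_commute)
  finally show "Im (tr_prod I M N) = 0" "Re (tr_prod I M N) \<ge> 0"
    using trace_psd[OF fin psd_on_congruence[OF M, of I H]] by simp_all
qed

lemma tr_prod_diff_left:
  "tr_prod I (\<lambda>i j. M i j - N i j) R = tr_prod I M R - tr_prod I N R"
  by (simp add: tr_prod_def algebra_simps sum_subtractf)

lemma tr_prod_diff_right:
  "tr_prod I R (\<lambda>i j. M i j - N i j) = tr_prod I R M - tr_prod I R N"
  by (simp add: tr_prod_def algebra_simps sum_subtractf)

lemma tr_prod_add_left:
  "tr_prod I (\<lambda>i j. M i j + N i j) R = tr_prod I M R + tr_prod I N R"
  by (simp add: tr_prod_def algebra_simps sum.distrib)

lemma tr_prod_id: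
  assumes "finite I"
  shows "tr_prod I (id_op I) R = trace_on I R"
proof -
  have "tr_prod I (id_op I) R = (\<Sum>x\<in>I. \<Sum>y\<in>I. if y = x then R y x else 0)"
    unfolding tr_prod_def id_op_def by (intro sum.cong) auto
  then show ?thesis using assms by (simp add: trace_on_def)
qed

lemma psd_on_id:
  assumes "finite I"
  shows "psd_on I (id_op I)"
proof (rule psd_onI_gram[where L = I and G = "id_op I"])
  fix i j assume ij: "i \<in> I" "j \<in> I"
  have "(\<Sum>k\<in>I. id_op I i k * cnj (id_op I j k)) = (\<Sum>k\<in>I. if k = i then (if j = i then 1 else 0) else 0)"
    by (intro sum.cong) (auto simp: id_op_def)
  then show "id_op I i j = (\<Sum>k\<in>I. id_op I i k * cnj (id_op I j k))"
    using ij assms by (auto simp: id_op_def)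
qed

section \<open>Tensor powers\<close>

definition words :: "'i set \<Rightarrow> nat \<Rightarrow> 'i list set" where
  "words S n = {xs. length xs = n \<and> set xs \<subseteq> S}"

lemma copies_idx_eq: "copies_idx d n = words (bip_idx d) n"
  and party_idx_eq: "party_idx d n = words {0..<d} n"
  by (simp_all add: copies_idx_def party_idx_def words_def)

lemma finite_words: "finite S \<Longrightarrow> finite (words S n)"
  using finite_lists_length_eq[of S n] by (simp add: words_def conj_commute)

lemma finite_bip_idx: "finite (bip_idx d)"
  by (simp add: bip_idx_def)

lemma finite_copies_idx: "finite (copies_idx d n)"
  by (simp add: copies_idx_eq finite_words finite_bip_idx)

lemma finite_party_idx: "finite (party_idx d n)"
  by (simp add: party_idx_eq finite_words)

lemma words_0: "words S 0 = {[]}"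
  by (auto simp: words_def)

lemma words_Suc: "words S (Suc n) = (\<lambda>(x, xs). x # xs) ` (S \<times> words S n)"
  by (auto simp: words_def length_Suc_conv image_iff)

lemma sum_words_append:
  "(\<Sum>xs\<in>words S (m + n). f xs) = (\<Sum>xs\<in>words S m. \<Sum>ys\<in>words S n. f (xs @ ys))"
proof -
  have "(\<Sum>xs\<in>words S (m + n). f xs) = (\<Sum>(xs, ys)\<in>words S m \<times> words S n. f (xs @ ys))"
    by (rule sum.reindex_bij_witness[of _ "\<lambda>(xs, ys). xs @ ys" "\<lambda>xs. (take m xs, drop m xs)"])
       (auto simp: words_def dest: in_set_takeD in_set_dropD)
  then show ?thesis by (simp add: sum.cartesian_product)
qed

lemma sum_words_prod:
  fixes f :: "nat \<Rightarrow> 'i \<Rightarrow> complex"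
  shows "(\<Sum>xs\<in>words S n. \<Prod>k<n. f k (xs ! k)) = (\<Prod>k<n. \<Sum>s\<in>S. f k s)"
proof (induction n arbitrary: f)
  case 0
  show ?case by (simp add: words_0)
next
  case (Suc n)
  have "(\<Sum>xs\<in>words S (Suc n). \<Prod>k<Suc n. f k (xs ! k))
      = (\<Sum>(x, xs)\<in>S \<times> words S n. \<Prod>k<Suc n. f k ((x # xs) ! k))"
    unfolding words_Suc by (subst sum.reindex) (auto simp: inj_on_def case_prod_beta)
  also have "\<dots> = (\<Sum>x\<in>S. \<Sum>xs\<in>words S n. f 0 x * (\<Prod>k<n. f (Suc k) (xs ! k)))"
    by (simp add: sum.cartesian_product prod.lessThan_Suc_shift del: prod.lessThan_Suc)
  also have "\<dots> = (\<Sum>x\<in>S. f 0 x) * (\<Prod>k<n. \<Sum>s\<in>S. f (Suc k) s)"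
    using Suc.IH[of "\<lambda>k. f (Suc k)"] by (simp add: sum_distrib_right sum_distrib_left[symmetric])
  finally show ?case by (simp add: prod.lessThan_Suc_shift del: prod.lessThan_Suc)
qed

lemma sum_words_unzip:
  "(\<Sum>xs\<in>copies_idx d n. f (map fst xs) (map snd xs)) = (\<Sum>a\<in>party_idx d n. \<Sum>b\<in>party_idx d n. f a b)"
proof -
  have "(\<Sum>xs\<in>copies_idx d n. f (map fst xs) (map snd xs))
      = (\<Sum>(a, b)\<in>party_idx d n \<times> party_idx d n. f a b)"
  proof (rule sum.reindex_bij_witness[of _ "\<lambda>(a, b). zip a b" "\<lambda>xs. (map fst xs, map snd xs)"])
    fix p assume "p \<in> party_idx d n \<times> party_idx d n"
    then show "(case p of (a, b) \<Rightarrow> zip a b) \<in> copies_idx d n"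
      by (auto simp: copies_idx_def party_idx_def bip_idx_def dest: set_zip_leftD set_zip_rightD)
  qed (auto simp: copies_idx_def party_idx_def bip_idx_def zip_map_fst_snd)
  then show ?thesis by (simp add: sum.cartesian_product)
qed

lemma copies_iff: "xs \<in> copies_idx d n \<longleftrightarrow> map fst xs \<in> party_idx d n \<and> map snd xs \<in> party_idx d n"
  by (auto simp: copies_idx_def party_idx_def bip_idx_def subset_iff)

lemma map_fst_snd_eq_iff: "map fst xs = map fst ys \<and> map snd xs = map snd ys \<longleftrightarrow> xs = ys"
  by (metis zip_map_fst_snd)

lemma supported_tensor_power:
  assumes "supported_on S X"
  shows "supported_on (words S n) (tensor_power n X)"
  unfolding supported_on_def
proof (intro allI impI)
  fix xs ys :: "'a list" assume *: "xs \<notin> words S n \<or> ys \<notin> words S n"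
  show "tensor_power n X xs ys = 0"
  proof (cases "length xs = n \<and> length ys = n")
    case True
    then have "\<exists>k<n. xs ! k \<notin> S \<or> ys ! k \<notin> S"
      using * by (auto simp: words_def subset_iff in_set_conv_nth)
    then obtain k where "k < n" "X (xs ! k) (ys ! k) = 0"
      using assms unfolding supported_on_def by blast
    then have "(\<Prod>k<n. X (xs ! k) (ys ! k)) = 0" by (intro prod_zero) auto
    then show ?thesis using True by (simp add: tensor_power_def)
  qed (auto simp: tensor_power_def)
qed

lemma tensor_power_mat_mult:
  "mat_mult (words S n) (tensor_power n X) (tensor_power n Y) = tensor_power n (mat_mult S X Y)"
proof (intro ext)
  fix xs ys
  show "mat_mult (words S n) (tensor_power n X) (tensor_power n Y) xs ys = tensor_power n (mat_mult S X Y) xs ys"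
  proof (cases "length xs = n \<and> length ys = n")
    case True
    have "mat_mult (words S n) (tensor_power n X) (tensor_power n Y) xs ys
        = (\<Sum>zs\<in>words S n. \<Prod>k<n. X (xs ! k) (zs ! k) * Y (zs ! k) (ys ! k))"
      unfolding mat_mult_def using True
      by (intro sum.cong refl) (auto simp: tensor_power_def words_def prod.distrib)
    also have "\<dots> = (\<Prod>k<n. \<Sum>s\<in>S. X (xs ! k) s * Y s (ys ! k))"
      by (rule sum_words_prod)
    finally show ?thesis using True by (simp add: tensor_power_def mat_mult_def)
  qed (auto simp: tensor_power_def mat_mult_def intro!: sum.neutral)
qed

lemma dagger_tensor_power: "dagger (tensor_power n X) = tensor_power n (dagger X)"
  by (auto simp: dagger_def tensor_power_def fun_eq_iff)

lemma trace_tensor_power: "trace_on (words S n) (tensor_power n X) = trace_on S X ^ n"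
proof -
  have "trace_on (words S n) (tensor_power n X) = (\<Sum>xs\<in>words S n. \<Prod>k<n. X (xs ! k) (xs ! k))"
    unfolding trace_on_def by (intro sum.cong) (auto simp: tensor_power_def words_def)
  also have "\<dots> = (\<Prod>k<n. \<Sum>s\<in>S. X s s)" by (rule sum_words_prod)
  finally show ?thesis by (simp add: trace_on_def)
qed

lemma tensor_power_id: "tensor_power n (id_op S) = id_op (words S n)"
proof (intro ext)
  fix xs ys :: "'a list"
  show "tensor_power n (id_op S) xs ys = id_op (words S n) xs ys"
  proof (cases "xs \<in> words S n \<and> ys \<in> words S n")
    case True
    show ?thesis
    proof (cases "xs = ys")
      case True
      then show ?thesis using \<open>xs \<in> words S n \<and> ys \<in> words S n\<close>
        by (auto simp: tensor_power_def id_op_def words_def subset_iff intro!: prod.neutral)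
    next
      case False
      then obtain k where "k < n" "xs ! k \<noteq> ys ! k"
        using True by (auto simp: words_def list_eq_iff_nth_eq)
      then have "(\<Prod>k<n. id_op S (xs ! k) (ys ! k)) = 0"
        by (intro prod_zero) (auto simp: id_op_def)
      then show ?thesis using True False by (auto simp: tensor_power_def id_op_def words_def)
    qed
  next
    case False
    then show ?thesis
      using supported_tensor_power[OF supported_on_id[of S], of n] supported_on_id[of "words S n"]
      by (metis (no_types) supported_on_def)
  qed
qed

lemma psd_tensor_power:
  assumes "finite S" "psd_on S X"
  shows "psd_on (words S n) (tensor_power n X)"
proof -
  obtain G where G: "\<And>i j. i \<in> S \<Longrightarrow> j \<in> S \<Longrightarrow> X i j = (\<Sum>k\<in>S. G i k * cnj (G j k))"
    using psd_on_gram assms by blast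
  show ?thesis
  proof (rule psd_onI_gram[where L = "words S n" and G = "tensor_power n G"])
    fix xs ys assume xy: "xs \<in> words S n" "ys \<in> words S n"
    have "tensor_power n X xs ys = (\<Prod>k<n. \<Sum>s\<in>S. G (xs ! k) s * cnj (G (ys ! k) s))"
      using xy G by (auto simp: tensor_power_def words_def subset_iff intro!: prod.cong)
    also have "\<dots> = tensor_power n (mat_mult S G (dagger G)) xs ys"
      using xy by (simp add: tensor_power_def words_def mat_mult_def dagger_def)
    also have "\<dots> = mat_mult (words S n) (tensor_power n G) (dagger (tensor_power n G)) xs ys"
      by (simp add: tensor_power_mat_mult dagger_tensor_power)
    finally show "tensor_power n X xs ys = (\<Sum>zs\<in>words S n. tensor_power n G xs zs * cnj (tensor_power n G ys zs))"
      by (simp add: mat_mult_def dagger_def)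
  qed
qed

lemma tensor_power_Suc:
  assumes "xs \<in> words S (Suc n)" "ys \<in> words S (Suc n)"
  shows "tensor_power (Suc n) X xs ys = X (hd xs) (hd ys) * tensor_power n X (tl xs) (tl ys)"
proof -
  obtain x xs' where x: "xs = x # xs'" "length xs' = n"
    using assms(1) unfolding words_Suc by (auto simp: words_def)
  obtain y ys' where y: "ys = y # ys'" "length ys' = n"
    using assms(2) unfolding words_Suc by (auto simp: words_def)
  show ?thesis using x y
    by (simp add: tensor_power_def prod.lessThan_Suc_shift del: prod.lessThan_Suc)
qed

text \<open>Telescoping with X = Y + Z: the difference at n + 1 is X (x) (X^n - Y^n) + Z (x) Y^n, a
  sum of positive terms.\<close>

lemma psd_tensor_power_mono:
  assumes fin: "finite S" and Y: "psd_on S Y" and Z: "psd_on S Z"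
    and X: "\<And>i j. i \<in> S \<Longrightarrow> j \<in> S \<Longrightarrow> X i j = Y i j + Z i j"
  shows "psd_on (words S n) (\<lambda>xs ys. tensor_power n X xs ys - tensor_power n Y xs ys)"
proof (induction n)
  case 0
  show ?case by (simp add: psd_on_def tensor_power_def words_0)
next
  case (Suc n)
  have pX: "psd_on S X" using psd_on_add[OF Y Z] X psd_on_cong[of S X] by simp
  have hdtl: "hd ` words S (Suc n) \<subseteq> S" "tl ` words S (Suc n) \<subseteq> words S n"
    by (auto simp: words_Suc)
  have "psd_on (words S (Suc n)) (\<lambda>xs ys.
      X (hd xs) (hd ys) * (tensor_power n X (tl xs) (tl ys) - tensor_power n Y (tl xs) (tl ys))
      + Z (hd xs) (hd ys) * tensor_power n Y (tl xs) (tl ys))"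
    by (intro psd_on_add psd_on_tensor[where f = hd and g = tl, OF fin finite_words[OF fin] _ _ hdtl]
        pX Suc.IH[THEN psd_on_cong[THEN iffD1, rotated]] Z psd_tensor_power fin Y) simp
  moreover have "tensor_power (Suc n) X xs ys - tensor_power (Suc n) Y xs ys
     = X (hd xs) (hd ys) * (tensor_power n X (tl xs) (tl ys) - tensor_power n Y (tl xs) (tl ys))
      + Z (hd xs) (hd ys) * tensor_power n Y (tl xs) (tl ys)"
    if "xs \<in> words S (Suc n)" "ys \<in> words S (Suc n)" for xs ys
  proof -
    have "hd xs \<in> S" "hd ys \<in> S" using that hdtl by auto
    then have "X (hd xs) (hd ys) = Y (hd xs) (hd ys) + Z (hd xs) (hd ys)" by (rule X)
    then show ?thesis unfolding tensor_power_Suc[OF that] by (simp add: algebra_simps)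
  qed
  ultimately show ?case using psd_on_cong by (smt (verit, best))
qed

text \<open>The tensor product of E on the first m copies with F on the remaining ones.\<close>

definition tcat :: "nat \<Rightarrow> 'i list op \<Rightarrow> 'i list op \<Rightarrow> 'i list op" where
  "tcat m E F = (\<lambda>xs ys. E (take m xs) (take m ys) * F (drop m xs) (drop m ys))"

lemma tensor_power_append:
  assumes "length xs = m" "length ys = m" "length xs' = n" "length ys' = n"
  shows "tensor_power (m + n) X (xs @ xs') (ys @ ys') = tensor_power m X xs ys * tensor_power n X xs' ys'"
  using assms
proof (induction m arbitrary: xs ys)
  case 0
  then show ?case by (simp add: tensor_power_def)
next
  case (Suc m)
  then obtain a as b bs where ab: "xs = a # as" "ys = b # bs" by (metis length_Suc_conv)
  then show ?case using Suc.IH[of as bs] Suc.prems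
    by (simp add: tensor_power_def prod.lessThan_Suc_shift del: prod.lessThan_Suc)
qed

lemma words_take_drop:
  "xs \<in> words S (m + n) \<longleftrightarrow> take m xs \<in> words S m \<and> drop m xs \<in> words S n"
proof
  assume "xs \<in> words S (m + n)"
  then show "take m xs \<in> words S m \<and> drop m xs \<in> words S n"
    by (auto simp: words_def dest: in_set_takeD in_set_dropD)
next
  assume *: "take m xs \<in> words S m \<and> drop m xs \<in> words S n"
  then have "set (take m xs @ drop m xs) \<subseteq> S" unfolding set_append by (auto simp: words_def)
  moreover have "length (take m xs @ drop m xs) = m + n" unfolding length_append using * by (auto simp: words_def)
  ultimately show "xs \<in> words S (m + n)" by (simp add: words_def)
qed

lemma supported_tcat:
  assumes "supported_on (words S m) E" "supported_on (words S n) F"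
  shows "supported_on (words S (m + n)) (tcat m E F)"
  using assms by (auto simp: supported_on_def tcat_def words_take_drop)

lemma psd_tcat:
  assumes "finite S" "psd_on (words S m) E" "psd_on (words S n) F"
  shows "psd_on (words S (m + n)) (tcat m E F)"
  unfolding tcat_def using assms
  by (intro psd_on_tensor[where I = "words S m" and J = "words S n"] finite_words)
     (auto simp: words_take_drop)

lemma tcat_id: "tcat m (id_op (words S m)) (id_op (words S n)) = id_op (words S (m + n))"
proof (intro ext)
  fix xs ys :: "'a list"
  have "take m xs = take m ys \<and> drop m xs = drop m ys \<longleftrightarrow> xs = ys"
    by (metis append_take_drop_id)
  then show "tcat m (id_op (words S m)) (id_op (words S n)) xs ys = id_op (words S (m + n)) xs ys"
    by (auto simp: tcat_def id_op_def words_take_drop)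
qed

lemma tr_prod_tcat:
  "tr_prod (words S (m + n)) (tcat m E F) (tensor_power (m + n) X)
    = tr_prod (words S m) E (tensor_power m X) * tr_prod (words S n) F (tensor_power n X)"
proof -
  have "tr_prod (words S (m + n)) (tcat m E F) (tensor_power (m + n) X)
    = (\<Sum>xs\<in>words S m. \<Sum>xs'\<in>words S n. \<Sum>ys\<in>words S m. \<Sum>ys'\<in>words S n.
        (E xs ys * tensor_power m X ys xs) * (F xs' ys' * tensor_power n X ys' xs'))"
    unfolding tr_prod_def sum_words_append
    by (intro sum.cong refl) (auto simp: tcat_def words_def tensor_power_append)
  also have "\<dots> = (\<Sum>xs\<in>words S m. \<Sum>ys\<in>words S m. \<Sum>xs'\<in>words S n. \<Sum>ys'\<in>words S n.
        (E xs ys * tensor_power m X ys xs) * (F xs' ys' * tensor_power n X ys' xs'))"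
    by (intro sum.cong refl sum.swap)
  finally show ?thesis
    by (simp only: tr_prod_def sum_distrib_left[symmetric] sum_distrib_right[symmetric])
qed

section \<open>Composition of one-way LOCC tests\<close>

lemma effect_compl:
  assumes "is_effect I T"
  shows "is_effect I (\<lambda>i j. id_op I i j - T i j)"
  using assms supported_on_id[of I] by (auto simp: is_effect_def supported_on_def)

text \<open>The acceptance operator of an adaptive test: measure E on the first m copies, then run F
  on the rest if it accepted and G if it rejected.\<close>

definition branch :: "'i set \<Rightarrow> nat \<Rightarrow> 'i list op \<Rightarrow> 'i list op \<Rightarrow> 'i list op \<Rightarrow> 'i list op" where
  "branch S m E F G = (\<lambda>xs ys. tcat m E F xs ys + tcat m (\<lambda>i j. id_op (words S m) i j - E i j) G xs ys)"

text \<open>Rejecting means rejecting in whichever branch is taken. So the upper bound on a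
  \<open>branch\<close> is the positivity of another one.\<close>

lemma branch_compl:
  "id_op (words S (m + n)) xs ys - branch S m E F G xs ys
    = branch S m E (\<lambda>i j. id_op (words S n) i j - F i j) (\<lambda>i j. id_op (words S n) i j - G i j) xs ys"
  unfolding tcat_id[symmetric] by (simp add: branch_def tcat_def algebra_simps)

lemma effect_branch:
  assumes fin: "finite S" and E: "is_effect (words S m) E"
    and F: "is_effect (words S n) F" and G: "is_effect (words S n) G"
  shows "is_effect (words S (m + n)) (branch S m E F G)"
proof -
  have 1: "supported_on (words S (m + n)) (branch S m E F G)"
    "psd_on (words S (m + n)) (branch S m E F G)"
    if "is_effect (words S n) F" "is_effect (words S n) G" for F G
  proof -
    have "supported_on (words S (m + n)) (tcat m E F)"
      "supported_on (words S (m + n)) (tcat m (\<lambda>i j. id_op (words S m) i j - E i j) G)"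
      using that E effect_compl[OF E] by (auto simp: is_effect_def intro!: supported_tcat)
    then show "supported_on (words S (m + n)) (branch S m E F G)"
      by (simp add: supported_on_def branch_def)
    show "psd_on (words S (m + n)) (branch S m E F G)"
      unfolding branch_def using that E effect_compl[OF E]
      by (intro psd_on_add psd_tcat fin) (auto simp: is_effect_def)
  qed
  show ?thesis
    unfolding is_effect_def[of "words S (m + n)"] branch_compl
    using 1[OF F G] 1[OF effect_compl[OF F] effect_compl[OF G]] by blast
qed

lemma tr_prod_branch:
  assumes "finite S"
  shows "tr_prod (words S (m + n)) (branch S m E F G) (tensor_power (m + n) X)
    = tr_prod (words S m) E (tensor_power m X) * tr_prod (words S n) F (tensor_power n X)
      + (trace_on S X ^ m - tr_prod (words S m) E (tensor_power m X)) * tr_prod (words S n) G (tensor_power n X)"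
  unfolding branch_def tr_prod_add_left tr_prod_tcat tr_prod_diff_left tr_prod_id[OF finite_words[OF assms]]
    trace_tensor_power by simp

text \<open>Bob's measurement is separated from Alice's effects, since a threshold test on later copies
  must not depend, on Bob's side, on what Alice found on earlier ones.\<close>

definition bob_povm :: "nat \<Rightarrow> nat \<Rightarrow> nat set \<Rightarrow> (nat \<Rightarrow> nat list op) \<Rightarrow> bool" where
  "bob_povm d N K B \<longleftrightarrow> finite K \<and>
     (\<forall>m\<in>K. supported_on (party_idx d N) (B m) \<and> psd_on (party_idx d N) (B m)) \<and>
     (\<lambda>u w. \<Sum>m\<in>K. B m u w) = id_op (party_idx d N)"

definition aligned :: "nat \<Rightarrow> nat \<Rightarrow> nat set \<Rightarrow> (nat \<Rightarrow> nat list op) \<Rightarrow> (nat \<times> nat) list op \<Rightarrow> bool" where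
  "aligned d N K B T \<longleftrightarrow> (\<exists>A. (\<forall>m\<in>K. is_effect (party_idx d N) (A m)) \<and>
     T = (\<lambda>xs ys. \<Sum>m\<in>K. A m (map fst xs) (map fst ys) * B m (map snd xs) (map snd ys)))"

lemma oneway_LOCC_BA_iff: "oneway_LOCC_BA d N T \<longleftrightarrow> (\<exists>K B. bob_povm d N K B \<and> aligned d N K B T)"
  unfolding oneway_LOCC_BA_def bob_povm_def aligned_def by blast

lemma id_op_copies:
  "id_op (copies_idx d N) xs ys
    = id_op (party_idx d N) (map fst xs) (map fst ys) * id_op (party_idx d N) (map snd xs) (map snd ys)"
  using map_fst_snd_eq_iff[of xs ys] by (auto simp: id_op_def copies_iff)

lemma aligned_compl:
  assumes B: "bob_povm d N K B" and T: "aligned d N K B T"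
  shows "aligned d N K B (\<lambda>xs ys. id_op (copies_idx d N) xs ys - T xs ys)"
proof -
  obtain A where A: "\<forall>m\<in>K. is_effect (party_idx d N) (A m)"
    and T: "T = (\<lambda>xs ys. \<Sum>m\<in>K. A m (map fst xs) (map fst ys) * B m (map snd xs) (map snd ys))"
    using T unfolding aligned_def by blast
  have "id_op (party_idx d N) u w = (\<Sum>m\<in>K. B m u w)" for u w
    using B by (simp add: bob_povm_def fun_eq_iff)
  then have "id_op (copies_idx d N) xs ys - T xs ys
    = (\<Sum>m\<in>K. (id_op (party_idx d N) (map fst xs) (map fst ys) - A m (map fst xs) (map fst ys))
        * B m (map snd xs) (map snd ys))" for xs ys
    unfolding id_op_copies T by (simp add: sum_distrib_left algebra_simps sum_subtractf)
  then show ?thesis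
    unfolding aligned_def using A
    by (intro exI[of _ "\<lambda>m u w. id_op (party_idx d N) u w - A m u w"] conjI ballI effect_compl ext) auto
qed

text \<open>Positivity is a sum of tensor products; the bound by the identity is positivity of the
  complement, which is \<open>aligned\<close> as well.\<close>

lemma aligned_effect:
  assumes B: "bob_povm d N K B" and T: "aligned d N K B T"
  shows "is_effect (copies_idx d N) T"
proof -
  have 1: "supported_on (copies_idx d N) T \<and> psd_on (copies_idx d N) T" if T: "aligned d N K B T" for T
  proof -
    obtain A where A: "\<forall>m\<in>K. is_effect (party_idx d N) (A m)"
      and T: "T = (\<lambda>xs ys. \<Sum>m\<in>K. A m (map fst xs) (map fst ys) * B m (map snd xs) (map snd ys))"
      using T unfolding aligned_def by blast
    have "supported_on (copies_idx d N) T"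
      unfolding supported_on_def
    proof (intro allI impI)
      fix xs ys assume "xs \<notin> copies_idx d N \<or> ys \<notin> copies_idx d N"
      then show "T xs ys = 0" unfolding T
        using A B by (intro sum.neutral) (auto simp: copies_iff is_effect_def bob_povm_def supported_on_def)
    qed
    moreover have "psd_on (copies_idx d N) T"
      unfolding T using A B
      by (intro psd_on_sum psd_on_tensor[OF finite_party_idx[of d N] finite_party_idx[of d N]])
         (auto simp: is_effect_def bob_povm_def copies_iff)
    ultimately show ?thesis by blast
  qed
  show ?thesis unfolding is_effect_def using 1[OF T] 1[OF aligned_compl[OF B T]] by blast
qed

text \<open>Bob measures both blocks independently and sends the pair of outcomes, coded by
  \<open>prod_encode\<close>. Only Alice knows whether E accepted, and she selects F or G by her own
  effects, which is possible as both are aligned with the same B2. Hence K and B are fixed before F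
  and G.\<close>

lemma aligned_branch:
  assumes B1: "bob_povm d N1 K1 B1" and E: "aligned d N1 K1 B1 E" and B2: "bob_povm d N2 K2 B2"
  obtains K B where "bob_povm d (N1 + N2) K B"
    "\<And>F G. aligned d N2 K2 B2 F \<Longrightarrow> aligned d N2 K2 B2 G \<Longrightarrow>
      aligned d (N1 + N2) K B (branch (bip_idx d) N1 E F G)"
proof -
  define K where "K = prod_encode ` (K1 \<times> K2)"
  define B where "B k = tcat N1 (B1 (fst (prod_decode k))) (B2 (snd (prod_decode k)))" for k
  have inj: "inj_on prod_encode X" for X by (rule inj_prod_encode)
  have sumK: "(\<Sum>k\<in>K. f (fst (prod_decode k)) (snd (prod_decode k))) = (\<Sum>i\<in>K1. \<Sum>j\<in>K2. f i j)"
    for f :: "nat \<Rightarrow> nat \<Rightarrow> complex"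
    unfolding K_def by (subst sum.reindex[OF inj]) (simp add: sum.cartesian_product case_prod_beta)
  have dec: "fst (prod_decode k) \<in> K1" "snd (prod_decode k) \<in> K2" if "k \<in> K" for k
    using that by (auto simp: K_def)
  have id1: "(\<Sum>i\<in>K1. B1 i u w) = id_op (party_idx d N1) u w"
    and id2: "(\<Sum>i\<in>K2. B2 i u w) = id_op (party_idx d N2) u w" for u w
    using B1 B2 by (simp_all add: bob_povm_def fun_eq_iff)
  have "bob_povm d (N1 + N2) K B"
    unfolding bob_povm_def
  proof (intro conjI ballI ext)
    show "finite K" using B1 B2 by (auto simp: K_def bob_povm_def)
    fix k assume "k \<in> K"
    with dec[OF this] B1 B2 show "supported_on (party_idx d (N1 + N2)) (B k)" "psd_on (party_idx d (N1 + N2)) (B k)"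
      unfolding B_def bob_povm_def party_idx_eq by (blast intro: supported_tcat psd_tcat)+
  next
    fix u w
    have "(\<Sum>k\<in>K. B k u w) = (\<Sum>i\<in>K1. \<Sum>j\<in>K2. tcat N1 (B1 i) (B2 j) u w)"
      unfolding B_def by (rule sumK)
    also have "\<dots> = tcat N1 (id_op (party_idx d N1)) (id_op (party_idx d N2)) u w"
      by (simp add: tcat_def id1[symmetric] id2[symmetric] sum_product)
    finally show "(\<Sum>k\<in>K. B k u w) = id_op (party_idx d (N1 + N2)) u w"
      by (simp add: party_idx_eq tcat_id)
  qed
  moreover have "aligned d (N1 + N2) K B (branch (bip_idx d) N1 E F G)"
    if "aligned d N2 K2 B2 F" "aligned d N2 K2 B2 G" for F G
  proof -
    let ?P = "party_idx d"
    note hF = that(1) and hG = that(2)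
    obtain eA where eA: "\<forall>m\<in>K1. is_effect (?P N1) (eA m)"
      and E: "E = (\<lambda>xs ys. \<Sum>m\<in>K1. eA m (map fst xs) (map fst ys) * B1 m (map snd xs) (map snd ys))"
      using E unfolding aligned_def by blast
    obtain fA where fA: "\<forall>m\<in>K2. is_effect (?P N2) (fA m)"
      and F: "F = (\<lambda>xs ys. \<Sum>m\<in>K2. fA m (map fst xs) (map fst ys) * B2 m (map snd xs) (map snd ys))"
      using hF unfolding aligned_def by blast
    obtain gA where gA: "\<forall>m\<in>K2. is_effect (?P N2) (gA m)"
      and G: "G = (\<lambda>xs ys. \<Sum>m\<in>K2. gA m (map fst xs) (map fst ys) * B2 m (map snd xs) (map snd ys))"
      using hG unfolding aligned_def by blast
    define A where "A k = branch {0..<d} N1 (eA (fst (prod_decode k))) (fA (snd (prod_decode k)))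
      (gA (snd (prod_decode k)))" for k
    have effA: "\<forall>k\<in>K. is_effect (?P (N1 + N2)) (A k)"
      unfolding A_def party_idx_eq using eA fA gA dec unfolding party_idx_eq
      by (intro ballI effect_branch) auto
    have "branch (bip_idx d) N1 E F G xs ys
       = (\<Sum>k\<in>K. A k (map fst xs) (map fst ys) * B k (map snd xs) (map snd ys))" for xs ys
    proof -
      \<comment> \<open>Rejection by E is a sum over the same messages of Bob, with Alice's
        complementary effects.\<close>
      have idE: "id_op (words (bip_idx d) N1) xs ys - E xs ys
        = (\<Sum>i\<in>K1. (id_op (?P N1) (map fst xs) (map fst ys) - eA i (map fst xs) (map fst ys))
            * B1 i (map snd xs) (map snd ys))" for xs ys
        unfolding copies_idx_eq[symmetric] id_op_copies E
        by (simp add: id1[symmetric] sum_distrib_left algebra_simps sum_subtractf)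
      have "branch (bip_idx d) N1 E F G xs ys
        = (\<Sum>i\<in>K1. \<Sum>j\<in>K2. branch {0..<d} N1 (eA i) (fA j) (gA j) (map fst xs) (map fst ys)
            * tcat N1 (B1 i) (B2 j) (map snd xs) (map snd ys))"
        unfolding branch_def tcat_def idE
        unfolding E F G party_idx_eq
        by (simp only: sum_product sum.distrib[symmetric] take_map drop_map)
           (intro sum.cong refl, simp add: algebra_simps)
      also have "\<dots> = (\<Sum>k\<in>K. A k (map fst xs) (map fst ys) * B k (map snd xs) (map snd ys))"
        unfolding A_def B_def by (rule sumK[symmetric])
      finally show ?thesis .
    qed
    then show ?thesis unfolding aligned_def using effA by blast
  qed
  ultimately show thesis by (rule that)
qed

lemma aligned_const:
  assumes B: "bob_povm d N K B"
  shows "aligned d N K B (\<lambda>_ _. 0)" "aligned d N K B (id_op (copies_idx d N))"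
proof -
  have e: "is_effect (party_idx d N) (\<lambda>_ _. 0)"
    by (auto simp: is_effect_def supported_on_def psd_on_def[of _ "\<lambda>_ _. 0"]
      intro: psd_on_id[OF finite_party_idx, THEN psd_on_cong[THEN iffD1, rotated]])
  show 0: "aligned d N K B (\<lambda>_ _. 0)"
    unfolding aligned_def using e by (intro exI[of _ "\<lambda>_ _ _. 0"]) auto
  show "aligned d N K B (id_op (copies_idx d N))"
    using aligned_compl[OF B 0] by simp
qed

lemma bob_povm_trivial: "bob_povm d N {0} (\<lambda>_. id_op (party_idx d N))"
  by (simp add: bob_povm_def supported_on_id psd_on_id finite_party_idx)

lemma tr_prod_zero: "tr_prod I (\<lambda>_ _. 0) R = 0"
  by (simp add: tr_prod_def)

lemma tr_prod_copies_id:
  assumes "trace_on (bip_idx d) \<rho> = 1"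
  shows "tr_prod (copies_idx d n) (id_op (copies_idx d n)) (tensor_power n \<rho>) = 1"
  unfolding tr_prod_id[OF finite_copies_idx] unfolding copies_idx_eq trace_tensor_power assms by simp

lemma tr_prod_copies_branch:
  assumes "trace_on (bip_idx d) \<rho> = 1"
  shows "tr_prod (copies_idx d (m + n)) (branch (bip_idx d) m E F G) (tensor_power (m + n) \<rho>)
    = tr_prod (copies_idx d m) E (tensor_power m \<rho>) * tr_prod (copies_idx d n) F (tensor_power n \<rho>)
      + (1 - tr_prod (copies_idx d m) E (tensor_power m \<rho>)) * tr_prod (copies_idx d n) G (tensor_power n \<rho>)"
  unfolding copies_idx_eq tr_prod_branch[OF finite_bip_idx] assms by simp

section \<open>The twirled maximally entangled operator\<close>

definition frobenius_sq :: "'i set \<Rightarrow> 'i op \<Rightarrow> real" where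
  "frobenius_sq I J = (\<Sum>x\<in>I. \<Sum>y\<in>I. (cmod (J x y))\<^sup>2)"

lemma frobenius_sq_nonneg: "0 \<le> frobenius_sq I J"
  by (simp add: frobenius_sq_def sum_nonneg)

lemma frobenius_sq_trace: "of_real (frobenius_sq I J) = trace_on I (mat_mult I J (dagger J))"
  unfolding frobenius_sq_def trace_on_def mat_mult_def dagger_def of_real_sum complex_norm_square ..

lemma frobenius_sq_parallelogram:
  "frobenius_sq I J + frobenius_sq I J' = 2 * frobenius_sq I (\<lambda>x y. (J x y + J' x y) / 2) + frobenius_sq I (\<lambda>x y. J x y - J' x y) / 2"
proof -
  have "(cmod a)\<^sup>2 + (cmod b)\<^sup>2 = 2 * (cmod ((a + b) / 2))\<^sup>2 + (cmod (a - b))\<^sup>2 / 2" for a b :: complex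
  proof -
    have "(cmod (a + b))\<^sup>2 + (cmod (a - b))\<^sup>2 = 2 * (cmod a)\<^sup>2 + 2 * (cmod b)\<^sup>2"
      unfolding cmod_power2 by (simp add: power2_eq_square algebra_simps)
    then show ?thesis by (simp add: norm_divide power_divide)
  qed
  then show ?thesis
    by (simp add: frobenius_sq_def sum.distrib[symmetric] sum_distrib_left sum_divide_distrib)
qed

text \<open>A minimising sequence has bounded entries, hence a convergent subsequence. By the
  parallelogram law, the midpoint of two distinct minimisers would have smaller norm.\<close>

lemma minimal_frobenius_sq_element:
  fixes C :: "'i op set"
  assumes fin: "finite I" and ne: "C \<noteq> {}" and sup: "\<And>J. J \<in> C \<Longrightarrow> supported_on I J"
    and mid: "\<And>J J'. J \<in> C \<Longrightarrow> J' \<in> C \<Longrightarrow> (\<lambda>x y. (J x y + J' x y) / 2) \<in> C"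
    and closed: "\<And>f J. (\<And>k::nat. f k \<in> C) \<Longrightarrow> supported_on I J \<Longrightarrow>
      (\<And>x y. x \<in> I \<Longrightarrow> y \<in> I \<Longrightarrow> (\<lambda>k. f k x y) \<longlonglongrightarrow> J x y) \<Longrightarrow> J \<in> C"
  shows "\<exists>J\<in>C. \<forall>J'\<in>C. frobenius_sq I J' \<le> frobenius_sq I J \<longrightarrow> J' = J"
proof -
  define \<mu> where "\<mu> = Inf (frobenius_sq I ` C)"
  have bdd: "bdd_below (frobenius_sq I ` C)" by (intro bdd_belowI2[of _ 0] frobenius_sq_nonneg)
  have low: "\<mu> \<le> frobenius_sq I J" if "J \<in> C" for J
    unfolding \<mu>_def using bdd that by (intro cInf_lower) auto
  have "\<exists>J\<in>C. frobenius_sq I J < \<mu> + 1 / real (Suc k)" for k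
  proof -
    have "Inf (frobenius_sq I ` C) < \<mu> + 1 / real (Suc k)" by (simp add: \<mu>_def)
    from cInf_lessD[OF _ this] ne show ?thesis by auto
  qed
  then obtain f where f: "\<And>k. f k \<in> C" "\<And>k. frobenius_sq I (f k) < \<mu> + 1 / real (Suc k)" by metis
  \<comment> \<open>The squared entry is at most \<mu> + 1, and \<mu> + 2 is a bound whose square
    exceeds this without a root.\<close>
  have bound: "cmod (f k x y) \<le> \<mu> + 2" if "x \<in> I" "y \<in> I" for k x y
  proof -
    have \<mu>0: "0 \<le> \<mu>" unfolding \<mu>_def using ne by (intro cInf_greatest) (auto simp: frobenius_sq_nonneg)
    have "(cmod (f k x y))\<^sup>2 \<le> (\<Sum>y\<in>I. (cmod (f k x y))\<^sup>2)"
      using fin that by (intro member_le_sum) auto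
    also have "\<dots> \<le> frobenius_sq I (f k)"
      unfolding frobenius_sq_def using fin that
      by (intro member_le_sum[where f = "\<lambda>x. \<Sum>y\<in>I. (cmod (f k x y))\<^sup>2"]) (auto simp: sum_nonneg)
    also have "\<dots> \<le> \<mu> + 1"
    proof -
      have "1 / real (Suc k) \<le> 1" by simp
      then show ?thesis using f(2)[of k] by linarith
    qed
    also have "\<dots> \<le> (\<mu> + 2)\<^sup>2" using \<mu>0 by (simp add: power2_eq_square algebra_simps)
    finally show ?thesis using \<mu>0 by (simp add: power2_le_iff_abs_le)
  qed
  have "\<exists>r l. strict_mono (r::nat \<Rightarrow> nat) \<and>
      (\<forall>p\<in>I \<times> I. (\<lambda>k. (\<lambda>k (x, y). f k x y) (r k) p) \<longlonglongrightarrow> l p)"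
    by (rule convergent_subsequence_on_finite[where B = "\<mu> + 2"]) (use fin bound in auto)
  then obtain r l where r: "strict_mono (r::nat \<Rightarrow> nat)"
    and l: "\<And>x y. x \<in> I \<Longrightarrow> y \<in> I \<Longrightarrow> (\<lambda>k. f (r k) x y) \<longlonglongrightarrow> l (x, y)" by auto
  define J where "J = (\<lambda>x y. if x \<in> I \<and> y \<in> I then l (x, y) else 0)"
  have lJ: "(\<lambda>k. f (r k) x y) \<longlonglongrightarrow> J x y" if "x \<in> I" "y \<in> I" for x y
    using l that by (simp add: J_def)
  have JC: "J \<in> C"
  proof (rule closed)
    show "f (r k) \<in> C" for k by (rule f(1))
    show "supported_on I J" by (auto simp: supported_on_def J_def)
  qed (rule lJ)
  have "(\<lambda>k. \<mu> + 1 / real (Suc k)) \<longlonglongrightarrow> \<mu> + 0"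
    by (intro tendsto_intros LIMSEQ_Suc[OF lim_1_over_n])
  from LIMSEQ_subseq_LIMSEQ[OF this r] have lim: "(\<lambda>k. \<mu> + 1 / real (Suc (r k))) \<longlonglongrightarrow> \<mu>"
    by (simp add: o_def)
  have "(\<lambda>k. frobenius_sq I (f (r k))) \<longlonglongrightarrow> frobenius_sq I J"
    unfolding frobenius_sq_def by (intro tendsto_intros lJ)
  then have J\<mu>: "frobenius_sq I J \<le> \<mu>"
    using f(2) by (intro LIMSEQ_le[OF _ lim]) (auto intro: less_imp_le)
  have "J' = J" if J': "J' \<in> C" "frobenius_sq I J' \<le> frobenius_sq I J" for J'
  proof -
    have "frobenius_sq I (\<lambda>x y. J x y - J' x y) \<le> 0"
      using frobenius_sq_parallelogram[of I J J'] low[OF mid[OF JC J'(1)]] J\<mu> J'(2) by linarith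
    then have "frobenius_sq I (\<lambda>x y. J x y - J' x y) = 0" using frobenius_sq_nonneg[of I] by (meson antisym)
    then have "\<forall>x\<in>I. \<forall>y\<in>I. J x y = J' x y"
      using fin by (simp add: frobenius_sq_def sum_nonneg_eq_0_iff sum_nonneg)
    then show ?thesis using sup[OF JC] sup[OF J'(1)] unfolding supported_on_def fun_eq_iff by metis
  qed
  with JC show ?thesis by blast
qed

definition rank_one :: "('i \<Rightarrow> complex) \<Rightarrow> 'i op" where
  "rank_one v = (\<lambda>x y. v x * cnj (v y))"

lemma mat_mult_rank_one: "mat_mult I W (mat_mult I (rank_one v) (dagger W)) = rank_one (mat_vec I W v)"
  unfolding mat_mult_def dagger_def rank_one_def mat_vec_def cnj_sum
  unfolding sum_product
  unfolding sum_distrib_left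
  by (simp add: mult_ac)

lemma tr_prod_rank_one: "tr_prod I L (rank_one v) = (\<Sum>x\<in>I. \<Sum>y\<in>I. cnj (v x) * L x y * v y)"
  by (simp add: tr_prod_def rank_one_def algebra_simps)

lemma tr_prod_commute: "tr_prod I A B = tr_prod I B A"
  unfolding tr_prod_eq_trace by (rule trace_mat_mult_commute)

lemma tr_prod_conj: "tr_prod I L (mat_mult I W (mat_mult I J (dagger W))) = tr_prod I (mat_mult I (dagger W) (mat_mult I L W)) J"
  unfolding tr_prod_eq_trace
  by (metis mat_mult_assoc trace_mat_mult_commute)

section \<open>Kronecker products and one-copy matrices acting on Alice's copies\<close>

definition tens :: "'a op \<Rightarrow> 'b op \<Rightarrow> ('a \<times> 'b) op" where
  "tens A B = (\<lambda>x y. A (fst x) (fst y) * B (snd x) (snd y))"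

lemma mat_mult_tens: "mat_mult (I \<times> J) (tens A B) (tens A' B') = tens (mat_mult I A A') (mat_mult J B B')"
  by (auto simp: fun_eq_iff mat_mult_def tens_def sum_product sum.cartesian_product case_prod_beta
      intro!: sum.cong)

lemma dagger_tens: "dagger (tens A B) = tens (dagger A) (dagger B)"
  by (simp add: dagger_def tens_def)

lemma tens_id: "tens (id_op I) (id_op J) = id_op (I \<times> J)"
  by (auto simp: fun_eq_iff tens_def id_op_def)

lemma dagger_id: "dagger (id_op I) = id_op I"
  by (auto simp: fun_eq_iff dagger_def id_op_def)

lemma supported_tens: "supported_on I A \<Longrightarrow> supported_on J B \<Longrightarrow> supported_on (I \<times> J) (tens A B)"
  by (auto simp: supported_on_def tens_def)

definition lift_A :: "nat \<Rightarrow> nat \<Rightarrow> nat op \<Rightarrow> (nat list \<times> nat list) op" where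
  "lift_A d n X = tens (tensor_power n X) (id_op (party_idx d n))"

text \<open>The basis \<open>copies_idx\<close> regrouped with all of Alice's indices before all of
  Bob's, so that operators of one party are Kronecker products.\<close>

definition pair_idx :: "nat \<Rightarrow> nat \<Rightarrow> (nat list \<times> nat list) set" where
  "pair_idx d n = party_idx d n \<times> party_idx d n"

lemma finite_pair_idx: "finite (pair_idx d n)"
  by (simp add: pair_idx_def finite_party_idx)

lemma mat_mult_id_party: "mat_mult (party_idx d n) (id_op (party_idx d n)) (id_op (party_idx d n)) = id_op (party_idx d n)"
  by (intro mat_mult_id_left finite_party_idx) (simp add: id_op_def)

lemma lift_A_mat_mult: "mat_mult (pair_idx d n) (lift_A d n X) (lift_A d n Y) = lift_A d n (mat_mult {0..<d} X Y)"
  unfolding lift_A_def pair_idx_def mat_mult_tens mat_mult_id_party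
  unfolding party_idx_eq tensor_power_mat_mult ..

lemma lift_A_dagger: "dagger (lift_A d n X) = lift_A d n (dagger X)"
  by (simp add: lift_A_def dagger_tens dagger_id dagger_tensor_power)

lemma lift_A_id: "lift_A d n (id_op {0..<d}) = id_op (pair_idx d n)"
  unfolding lift_A_def tensor_power_id pair_idx_def party_idx_eq[symmetric] tens_id ..

lemma supported_lift_A: "supported_on {0..<d} X \<Longrightarrow> supported_on (pair_idx d n) (lift_A d n X)"
  unfolding lift_A_def pair_idx_def
  by (intro supported_tens supported_on_id) (simp add: party_idx_eq supported_tensor_power)

lemma unitary_on_iff:
  "unitary_on d U \<longleftrightarrow> supported_on {0..<d} U \<and> mat_mult {0..<d} U (dagger U) = id_op {0..<d}
    \<and> mat_mult {0..<d} (dagger U) U = id_op {0..<d}" (is "_ \<longleftrightarrow> ?R")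
proof
  assume U: "unitary_on d U"
  then have s: "supported_on {0..<d} U" by (simp add: unitary_on_def)
  note s' = supported_on_dagger[OF s]
  have "mat_mult {0..<d} U (dagger U) i j = id_op {0..<d} i j \<and> mat_mult {0..<d} (dagger U) U i j = id_op {0..<d} i j" for i j
  proof (cases "i < d \<and> j < d")
    case True
    then show ?thesis using U by (simp add: unitary_on_def mat_mult_def dagger_def id_op_def atLeast0LessThan)
  next
    case False
    then have "mat_mult {0..<d} U (dagger U) i j = 0" "mat_mult {0..<d} (dagger U) U i j = 0" "id_op {0..<d} i j = 0"
      using supported_on_mat_mult[OF s s'] supported_on_mat_mult[OF s' s] supported_on_id[of "{0..<d}"]
      unfolding supported_on_def by auto
    then show ?thesis by simp
  qed
  then show ?R using s by (auto simp: fun_eq_iff)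
next
  assume R: ?R
  then have "mat_mult {0..<d} U (dagger U) i j = id_op {0..<d} i j" "mat_mult {0..<d} (dagger U) U i j = id_op {0..<d} i j" for i j
    by auto
  then show "unitary_on d U"
    using R by (auto simp: unitary_on_def mat_mult_def dagger_def id_op_def atLeast0LessThan)
qed

lemma unitary_on_id: "unitary_on d (id_op {0..<d})"
  unfolding unitary_on_iff by (auto simp: dagger_id supported_on_id intro!: mat_mult_id_left) (simp_all add: id_op_def)

lemma unitary_on_mat_mult:
  assumes "unitary_on d U" "unitary_on d V"
  shows "unitary_on d (mat_mult {0..<d} U V)"
proof -
  let ?S = "{0..<d}"
  have U: "supported_on ?S U" "mat_mult ?S U (dagger U) = id_op ?S" "mat_mult ?S (dagger U) U = id_op ?S"
    and V: "supported_on ?S V" "mat_mult ?S V (dagger V) = id_op ?S" "mat_mult ?S (dagger V) V = id_op ?S"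
    using assms by (auto simp: unitary_on_iff)
  have idl: "mat_mult ?S (id_op ?S) A = A" if "supported_on ?S A" for A
    using that by (intro mat_mult_id_left) (auto simp: supported_on_def)
  have "mat_mult ?S (mat_mult ?S U V) (dagger (mat_mult ?S U V)) = mat_mult ?S U (mat_mult ?S (mat_mult ?S V (dagger V)) (dagger U))"
    by (simp add: dagger_mat_mult mat_mult_assoc)
  moreover have "mat_mult ?S (dagger (mat_mult ?S U V)) (mat_mult ?S U V) = mat_mult ?S (dagger V) (mat_mult ?S (mat_mult ?S (dagger U) U) V)"
    by (simp add: dagger_mat_mult mat_mult_assoc)
  ultimately show ?thesis
    unfolding unitary_on_iff using U V by (simp add: idl supported_on_mat_mult supported_on_dagger)
qed

lemma unitary_on_transpose:
  assumes "unitary_on d U"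
  shows "unitary_on d (\<lambda>i j. U j i)"
proof -
  have 1: "(\<Sum>k<d. U i k * cnj (U j k)) = (if i = j then 1 else 0)"
    and 2: "(\<Sum>k<d. cnj (U k i) * U k j) = (if i = j then 1 else 0)" if "i < d" "j < d" for i j
    using assms that by (auto simp: unitary_on_def)
  have "(\<Sum>k<d. U k i * cnj (U k j)) = (if i = j then 1 else 0)" if "i < d" "j < d" for i j
    using 2[OF that(2,1)] by (simp add: mult.commute)
  moreover have "(\<Sum>k<d. cnj (U i k) * U j k) = (if i = j then 1 else 0)" if "i < d" "j < d" for i j
    using 1[OF that(2,1)] by (simp add: mult.commute)
  ultimately show ?thesis
    using assms by (auto simp: unitary_on_def supported_on_def)
qed

text \<open>The vector (1 (x) U^n) \<Omega>, where \<Omega> is the sum of all basis vectors indexed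
  by (a, a).\<close>

definition omega_vec :: "nat \<Rightarrow> nat op \<Rightarrow> nat list \<times> nat list \<Rightarrow> complex" where
  "omega_vec n U = (\<lambda>(a, b). tensor_power n U b a)"

abbreviation orbit_op :: "nat \<Rightarrow> nat op \<Rightarrow> (nat list \<times> nat list) op" where
  "orbit_op n U \<equiv> rank_one (omega_vec n U)"

text \<open>The closed convex hull of the operators \<open>orbit_op n U\<close>, described by its supporting
  half-spaces.\<close>

definition orbit_hull :: "nat \<Rightarrow> nat \<Rightarrow> (nat list \<times> nat list) op set" where
  "orbit_hull d n = {J. supported_on (pair_idx d n) J \<and>
     (\<forall>L b. (\<forall>U. unitary_on d U \<longrightarrow> Re (tr_prod (pair_idx d n) L (orbit_op n U)) \<le> b)
        \<longrightarrow> Re (tr_prod (pair_idx d n) L J) \<le> b)}"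

lemma tr_prod_scale: "tr_prod I (\<lambda>x y. z * L x y) J = z * tr_prod I L J"
  by (simp add: tr_prod_def sum_distrib_left mult.assoc)

lemma orbit_hull_le:
  assumes "J \<in> orbit_hull d n"
    and "\<And>U. unitary_on d U \<Longrightarrow> Re (tr_prod (pair_idx d n) L (orbit_op n U)) \<le> b"
  shows "Re (tr_prod (pair_idx d n) L J) \<le> b"
  using assms by (auto simp: orbit_hull_def)

lemma orbit_hull_ge:
  assumes "J \<in> orbit_hull d n"
    and "\<And>U. unitary_on d U \<Longrightarrow> b \<le> Re (tr_prod (pair_idx d n) L (orbit_op n U))"
  shows "b \<le> Re (tr_prod (pair_idx d n) L J)"
  using orbit_hull_le[OF assms(1), of "\<lambda>x y. (-1) * L x y" "- b"] assms(2)
  unfolding tr_prod_scale by simp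

text \<open>The half-spaces see real parts only; testing i L as well recovers the imaginary
  part.\<close>

lemma orbit_hull_eq:
  assumes J: "J \<in> orbit_hull d n"
    and *: "\<And>U. unitary_on d U \<Longrightarrow> tr_prod (pair_idx d n) L (orbit_op n U) = z"
  shows "tr_prod (pair_idx d n) L J = z"
proof (rule complex_eqI)
  show "Re (tr_prod (pair_idx d n) L J) = Re z"
    by (intro antisym orbit_hull_le[OF J] orbit_hull_ge[OF J]) (simp_all add: *)
  have "Re (tr_prod (pair_idx d n) (\<lambda>x y. \<i> * L x y) J) = Re (\<i> * z)"
    by (intro antisym orbit_hull_le[OF J] orbit_hull_ge[OF J]) (simp_all add: * tr_prod_scale)
  then show "Im (tr_prod (pair_idx d n) L J) = Im z" unfolding tr_prod_scale by simp
qed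

lemma supported_orbit_op:
  assumes "unitary_on d U"
  shows "supported_on (pair_idx d n) (orbit_op n U)"
proof -
  have "supported_on (party_idx d n) (tensor_power n U)"
    using assms by (simp add: unitary_on_def party_idx_eq supported_tensor_power)
  then show ?thesis by (auto simp: supported_on_def rank_one_def omega_vec_def pair_idx_def)
qed

text \<open>The quadratic form at v is the functional given by \<open>rank_one v\<close>, whose
  value on the orbit is a squared modulus.\<close>

lemma psd_orbit_hull:
  assumes J: "J \<in> orbit_hull d n"
  shows "psd_on (pair_idx d n) J"
  unfolding psd_on_def
proof (intro allI)
  fix v :: "nat list \<times> nat list \<Rightarrow> complex"
  let ?I = "pair_idx d n"
  have eq: "(\<Sum>x\<in>?I. \<Sum>y\<in>?I. cnj (v x) * A x y * v y) = tr_prod ?I (rank_one v) A" for A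
    by (simp add: tr_prod_commute[of _ "rank_one v"] tr_prod_rank_one)
  have orb: "tr_prod ?I (rank_one v) (orbit_op n U) = of_real ((cmod (\<Sum>x\<in>?I. cnj (v x) * omega_vec n U x))\<^sup>2)" for U
    unfolding complex_norm_square eq[symmetric]
    unfolding rank_one_def cnj_sum sum_product by (simp add: mult_ac)
  have "0 \<le> Re (tr_prod ?I (rank_one v) J)"
    by (rule orbit_hull_ge[OF J]) (simp add: orb)
  moreover have "Re (tr_prod ?I (\<lambda>x y. \<i> * rank_one v x y) J) = 0"
    by (intro antisym orbit_hull_le[OF J] orbit_hull_ge[OF J]) (simp_all add: tr_prod_scale orb)
  ultimately show "Im (\<Sum>x\<in>?I. \<Sum>y\<in>?I. cnj (v x) * J x y * v y) = 0 \<and>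
      0 \<le> Re (\<Sum>x\<in>?I. \<Sum>y\<in>?I. cnj (v x) * J x y * v y)"
    unfolding eq tr_prod_scale by simp
qed

text \<open>Acting by X on Alice's side of \<Omega> equals acting by its transpose on Bob's side. If
  X is the coefficient matrix of a vector, the result is n copies of that vector with U applied on
  Bob's side.\<close>

lemma omega_vec_lift:
  assumes U: "unitary_on d U"
  shows "mat_vec (pair_idx d n) (lift_A d n X) (omega_vec n U) (a, b)
    = tensor_power n (mat_mult {0..<d} X (\<lambda>i j. U j i)) a b"
proof -
  let ?P = "party_idx d n"
  have sup: "supported_on ?P (tensor_power n U)"
    using U by (simp add: unitary_on_def party_idx_eq supported_tensor_power)
  have "mat_vec (pair_idx d n) (lift_A d n X) (omega_vec n U) (a, b)
     = (\<Sum>a'\<in>?P. \<Sum>b'\<in>?P. tensor_power n X a a' * (if b' = b then tensor_power n U b' a' else 0))"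
    unfolding mat_vec_def pair_idx_def lift_A_def tens_def omega_vec_def sum.cartesian_product
    by (intro sum.cong) (auto simp: id_op_def)
  also have "\<dots> = (\<Sum>a'\<in>?P. tensor_power n X a a' * tensor_power n U b a')"
  proof (intro sum.cong refl)
    fix a'
    have "(\<Sum>b'\<in>?P. if b' = b then tensor_power n U b' a' else 0) = tensor_power n U b a'"
      using sup finite_party_idx[of d n] by (auto simp: supported_on_def)
    then show "(\<Sum>b'\<in>?P. tensor_power n X a a' * (if b' = b then tensor_power n U b' a' else 0))
        = tensor_power n X a a' * tensor_power n U b a'"
      by (simp only: sum_distrib_left[symmetric])
  qed
  also have "\<dots> = mat_mult ?P (tensor_power n X) (tensor_power n (\<lambda>i j. U j i)) a b"
    by (simp add: mat_mult_def tensor_power_def conj_commute)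
  finally show ?thesis unfolding party_idx_eq tensor_power_mat_mult .
qed

text \<open>Conjugation by V^n (x) 1 moves the orbit point of U to that of U V^T, so it preserves
  the hull, and it preserves the Frobenius norm. The unique minimiser is therefore fixed: an
  operator built from Bob's unitaries commutes with Alice's.\<close>

lemma twirled_op:
  obtains J where "J \<in> orbit_hull d n"
    "\<And>V. unitary_on d V \<Longrightarrow> mat_mult (pair_idx d n) (lift_A d n V) J = mat_mult (pair_idx d n) J (lift_A d n V)"
proof -
  let ?I = "pair_idx d n"
  note fin = finite_pair_idx[of d n]
  have "orbit_op n (id_op {0..<d}) \<in> orbit_hull d n"
    using supported_orbit_op[OF unitary_on_id] unitary_on_id by (auto simp: orbit_hull_def)
  then have ne: "orbit_hull d n \<noteq> {}" by blast
  have sup: "supported_on ?I J" if "J \<in> orbit_hull d n" for J using that by (simp add: orbit_hull_def)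
  have mid: "(\<lambda>x y. (J x y + J' x y) / 2) \<in> orbit_hull d n" if "J \<in> orbit_hull d n" "J' \<in> orbit_hull d n" for J J'
  proof -
    have half: "tr_prod ?I L (\<lambda>x y. (J x y + J' x y) / 2) = (tr_prod ?I L J + tr_prod ?I L J') / 2" for L
      by (simp add: tr_prod_def sum.distrib[symmetric] sum_divide_distrib algebra_simps add_divide_distrib)
    have "Re (tr_prod ?I L (\<lambda>x y. (J x y + J' x y) / 2)) \<le> b"
      if "\<And>U. unitary_on d U \<Longrightarrow> Re (tr_prod ?I L (orbit_op n U)) \<le> b" for L b
    proof -
      have "Re (tr_prod ?I L J) \<le> b" "Re (tr_prod ?I L J') \<le> b"
        using that \<open>J \<in> orbit_hull d n\<close> \<open>J' \<in> orbit_hull d n\<close> by (auto intro: orbit_hull_le)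
      then show ?thesis unfolding half by simp
    qed
    moreover have "supported_on ?I (\<lambda>x y. (J x y + J' x y) / 2)"
      using sup[OF that(1)] sup[OF that(2)] by (simp add: supported_on_def)
    ultimately show ?thesis unfolding orbit_hull_def by auto
  qed
  have closed: "J \<in> orbit_hull d n" if f: "\<And>k::nat. f k \<in> orbit_hull d n" and "supported_on ?I J"
    and lim: "\<And>x y. x \<in> ?I \<Longrightarrow> y \<in> ?I \<Longrightarrow> (\<lambda>k. f k x y) \<longlonglongrightarrow> J x y" for f J
  proof -
    have "Re (tr_prod ?I L J) \<le> b"
      if *: "\<And>U. unitary_on d U \<Longrightarrow> Re (tr_prod ?I L (orbit_op n U)) \<le> b" for L b
    proof (rule LIMSEQ_le_const2)
      show "(\<lambda>k. Re (tr_prod ?I L (f k))) \<longlonglongrightarrow> Re (tr_prod ?I L J)"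
        unfolding tr_prod_def by (intro tendsto_intros lim)
      show "\<exists>N. \<forall>k\<ge>N. Re (tr_prod ?I L (f k)) \<le> b" using orbit_hull_le[OF f *] by blast
    qed
    then show ?thesis using that(2) by (simp add: orbit_hull_def)
  qed
  have "\<exists>J\<in>orbit_hull d n. \<forall>J'\<in>orbit_hull d n. frobenius_sq ?I J' \<le> frobenius_sq ?I J \<longrightarrow> J' = J"
    by (rule minimal_frobenius_sq_element[OF fin ne]) (fact sup mid closed)+
  then obtain J where J: "J \<in> orbit_hull d n"
    and uniq: "\<And>J'. J' \<in> orbit_hull d n \<Longrightarrow> frobenius_sq ?I J' \<le> frobenius_sq ?I J \<Longrightarrow> J' = J"
    by blast
  have idl: "mat_mult ?I (id_op ?I) A = A" if "supported_on ?I A" for A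
    using that by (intro mat_mult_id_left fin) (auto simp: supported_on_def)
  have idr: "mat_mult ?I A (id_op ?I) = A" if "supported_on ?I A" for A
    using that by (intro mat_mult_id_right fin) (auto simp: supported_on_def)
  have "mat_mult ?I (lift_A d n V) J = mat_mult ?I J (lift_A d n V)" if V: "unitary_on d V" for V
  proof -
    define W where "W = lift_A d n V"
    have Vs: "supported_on {0..<d} V" and VV: "mat_mult {0..<d} (dagger V) V = id_op {0..<d}"
      using V by (auto simp: unitary_on_iff)
    have Ws: "supported_on ?I W" unfolding W_def by (rule supported_lift_A[OF Vs])
    have WW: "mat_mult ?I (dagger W) W = id_op ?I"
      unfolding W_def lift_A_dagger lift_A_mat_mult VV lift_A_id ..
    define J' where "J' = mat_mult ?I W (mat_mult ?I J (dagger W))"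
    have orb: "mat_mult ?I W (mat_mult ?I (orbit_op n U) (dagger W)) = orbit_op n (mat_mult {0..<d} U (\<lambda>i j. V j i))"
      if U: "unitary_on d U" for U
    proof -
      have "mat_vec ?I W (omega_vec n U) = omega_vec n (mat_mult {0..<d} U (\<lambda>i j. V j i))"
      proof
        fix x :: "nat list \<times> nat list"
        obtain a b where x: "x = (a, b)" by fastforce
        have "mat_mult {0..<d} V (\<lambda>i j. U j i) = (\<lambda>i j. mat_mult {0..<d} U (\<lambda>i j. V j i) j i)"
          by (simp add: mat_mult_def fun_eq_iff mult.commute)
        then show "mat_vec ?I W (omega_vec n U) x = omega_vec n (mat_mult {0..<d} U (\<lambda>i j. V j i)) x"
          unfolding x W_def omega_vec_lift[OF U] by (simp add: omega_vec_def tensor_power_def conj_commute)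
      qed
      then show ?thesis by (simp add: mat_mult_rank_one)
    qed
    have "J' \<in> orbit_hull d n"
      unfolding orbit_hull_def
    proof (intro CollectI conjI allI impI)
      show "supported_on ?I J'"
        unfolding J'_def using Ws sup[OF J] by (intro supported_on_mat_mult supported_on_dagger)
      fix L b assume *: "\<forall>U. unitary_on d U \<longrightarrow> Re (tr_prod ?I L (orbit_op n U)) \<le> b"
      show "Re (tr_prod ?I L J') \<le> b"
        unfolding J'_def tr_prod_conj
      proof (rule orbit_hull_le[OF J])
        fix U assume U: "unitary_on d U"
        show "Re (tr_prod ?I (mat_mult ?I (dagger W) (mat_mult ?I L W)) (orbit_op n U)) \<le> b"
          unfolding tr_prod_conj[symmetric] orb[OF U]
          using * unitary_on_mat_mult[OF U unitary_on_transpose[OF V]] by blast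
      qed
    qed
    moreover have "frobenius_sq ?I J' = frobenius_sq ?I J"
    proof -
      have a: "dagger J' = mat_mult ?I W (mat_mult ?I (dagger J) (dagger W))"
        unfolding J'_def dagger_mat_mult dagger_dagger mat_mult_assoc ..
      have "mat_mult ?I J' (dagger J') = mat_mult ?I W (mat_mult ?I J (mat_mult ?I (mat_mult ?I (dagger W) W) (mat_mult ?I (dagger J) (dagger W))))"
        unfolding a unfolding J'_def mat_mult_assoc ..
      also have "\<dots> = mat_mult ?I W (mat_mult ?I (mat_mult ?I J (dagger J)) (dagger W))"
        unfolding WW using Ws sup[OF J] by (subst idl) (simp_all add: supported_on_mat_mult supported_on_dagger mat_mult_assoc)
      finally have "trace_on ?I (mat_mult ?I J' (dagger J')) = trace_on ?I (mat_mult ?I (mat_mult ?I (mat_mult ?I J (dagger J)) (dagger W)) W)"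
        by (simp add: trace_mat_mult_commute[of ?I ?I W])
      also have "\<dots> = trace_on ?I (mat_mult ?I J (dagger J))"
        unfolding mat_mult_assoc WW using sup[OF J] by (subst idr) (simp_all add: supported_on_dagger)
      finally show ?thesis unfolding frobenius_sq_trace[symmetric] by simp
    qed
    ultimately have "J' = J" by (intro uniq) auto
    then have "mat_mult ?I J W = mat_mult ?I J' W" by simp
    also have "\<dots> = mat_mult ?I W (mat_mult ?I J (mat_mult ?I (dagger W) W))" by (simp add: J'_def mat_mult_assoc)
    also have "\<dots> = mat_mult ?I W J" unfolding WW idr[OF sup[OF J]] ..
    finally show ?thesis by (simp add: W_def)
  qed
  with J show thesis by (rule that)
qed

section \<open>From unitaries to all matrices: what commutes with J\<close>

definition diag_op :: "nat \<Rightarrow> (nat \<Rightarrow> complex) \<Rightarrow> nat op" where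
  "diag_op d z = (\<lambda>i j. if i < d \<and> i = j then z i else 0)"

lemma supported_diag_op: "supported_on {0..<d} (diag_op d z)"
  by (auto simp: supported_on_def diag_op_def)

lemma unitary_diag_op:
  assumes "\<And>i. cmod (z i) = 1"
  shows "unitary_on d (diag_op d z)"
proof -
  have "z i * cnj (z i) = 1" for i
    using assms[of i] complex_norm_square[of "z i"] by simp
  then have *: "cnj (z i) * z i = 1" "z i * cnj (z i) = 1" for i by (auto simp: mult.commute)
  have "(\<Sum>k<d. diag_op d z i k * cnj (diag_op d z j k)) = (\<Sum>k<d. if k = i then (if i = j then 1 else 0) else 0)"
    for i j using * by (intro sum.cong) (auto simp: diag_op_def)
  moreover have "(\<Sum>k<d. cnj (diag_op d z k i) * diag_op d z k j) = (\<Sum>k<d. if k = i then (if i = j then 1 else 0) else 0)"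
    for i j using * by (intro sum.cong) (auto simp: diag_op_def)
  ultimately show ?thesis by (simp add: unitary_on_def supported_diag_op)
qed

lemma tensor_power_diag:
  assumes "a \<in> party_idx d n" "a' \<in> party_idx d n"
  shows "tensor_power n (diag_op d z) a a' = (if a = a' then prod_list (map z a) else 0)"
proof (cases "a = a'")
  case True
  have "tensor_power n (diag_op d z) a a = (\<Prod>k<n. z (a ! k))"
    using assms by (auto simp: tensor_power_def party_idx_def diag_op_def subset_iff intro!: prod.cong)
  also have "\<dots> = prod_list (map z a)"
    using assms by (simp add: prod.list_conv_set_nth party_idx_def atLeast0LessThan)
  finally show ?thesis using True by simp
next
  case False
  then obtain k where "k < n" "a ! k \<noteq> a' ! k"
    using assms by (auto simp: party_idx_def list_eq_iff_nth_eq)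
  then have "(\<Prod>k<n. diag_op d z (a ! k) (a' ! k)) = 0"
    by (intro prod_zero) (auto simp: diag_op_def)
  then show ?thesis using False assms by (simp add: tensor_power_def party_idx_def)
qed

lemma mat_mult_lift_diag:
  assumes "x \<in> pair_idx d n" "y \<in> pair_idx d n"
  shows "mat_mult (pair_idx d n) (lift_A d n (diag_op d z)) J x y = prod_list (map z (fst x)) * J x y"
    and "mat_mult (pair_idx d n) J (lift_A d n (diag_op d z)) x y = J x y * prod_list (map z (fst y))"
proof -
  have l: "lift_A d n (diag_op d z) u w = (if u = w then prod_list (map z (fst u)) else 0)"
    if "u \<in> pair_idx d n" "w \<in> pair_idx d n" for u w
    using that by (simp add: lift_A_def tens_def pair_idx_def mem_Times_iff tensor_power_diag id_op_def prod_eq_iff)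
  have "mat_mult (pair_idx d n) (lift_A d n (diag_op d z)) J x y
      = (\<Sum>w\<in>pair_idx d n. if w = x then prod_list (map z (fst x)) * J x y else 0)"
    unfolding mat_mult_def using assms l by (intro sum.cong) auto
  then show "mat_mult (pair_idx d n) (lift_A d n (diag_op d z)) J x y = prod_list (map z (fst x)) * J x y"
    using assms finite_pair_idx by simp
  have "mat_mult (pair_idx d n) J (lift_A d n (diag_op d z)) x y
      = (\<Sum>w\<in>pair_idx d n. if w = y then J x y * prod_list (map z (fst y)) else 0)"
    unfolding mat_mult_def using assms l by (intro sum.cong) auto
  then show "mat_mult (pair_idx d n) J (lift_A d n (diag_op d z)) x y = J x y * prod_list (map z (fst y))"
    using assms finite_pair_idx by simp
qed

lemma prod_list_single: "prod_list (map (\<lambda>j. if j = i then w else 1) a) = w ^ count_list a i"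
  for w :: complex
  by (induction a) auto

text \<open>Characters of the torus separate multisets: a phase placed at the single letter i reads
  off how often i occurs.\<close>

lemma mset_eq_if_torus_eq:
  assumes "\<And>z :: nat \<Rightarrow> complex. (\<And>i. cmod (z i) = 1) \<Longrightarrow> prod_list (map z a) = prod_list (map z a')"
  shows "mset a = mset a'"
proof (rule multiset_eqI)
  fix i
  define N where "N = length a + length a' + 1"
  \<comment> \<open>Since N exceeds both lengths, the angles count / N lie between 0 and 1, where
    the cosine is injective.\<close>
  define w where "w = cis (1 / real N)"
  have "prod_list (map (\<lambda>j. if j = i then w else 1) a) = prod_list (map (\<lambda>j. if j = i then w else 1) a')"
    by (rule assms) (auto simp: w_def)
  then have "w ^ count_list a i = w ^ count_list a' i" unfolding prod_list_single .
  then have "cos (real (count_list a i) * (1 / real N)) = cos (real (count_list a' i) * (1 / real N))"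
    unfolding w_def Complex.DeMoivre by (metis cis.sel(1))
  moreover have "0 \<le> real k * (1 / real N) \<and> real k * (1 / real N) \<le> pi" if "k \<le> N" for k
  proof -
    have "real k * (1 / real N) \<le> 1" using that by (simp add: N_def divide_le_eq)
    then show ?thesis using pi_gt3 by (intro conjI) (simp, linarith)
  qed
  moreover have "count_list a i \<le> N" "count_list a' i \<le> N"
    using count_le_length[of a i] count_le_length[of a' i] by (auto simp: N_def)
  ultimately have "real (count_list a i) * (1 / real N) = real (count_list a' i) * (1 / real N)"
    using cos_inj_pi by blast
  then have "count_list a i = count_list a' i" by (simp add: N_def)
  then show "count (mset a) i = count (mset a') i" by (simp add: count_mset)
qed

text \<open>Commuting with all diagonals of phases forces J x y = 0 unless Alice's words in x and y
  are permutations of each other. On the remaining entries any diagonal gives the same product on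
  both sides.\<close>

lemma commute_diag:
  assumes J: "supported_on (pair_idx d n) J"
    and unit: "\<And>V. unitary_on d V \<Longrightarrow> mat_mult (pair_idx d n) (lift_A d n V) J = mat_mult (pair_idx d n) J (lift_A d n V)"
  shows "mat_mult (pair_idx d n) (lift_A d n (diag_op d z)) J = mat_mult (pair_idx d n) J (lift_A d n (diag_op d z))"
proof (intro ext)
  fix x y
  let ?I = "pair_idx d n"
  show "mat_mult ?I (lift_A d n (diag_op d z)) J x y = mat_mult ?I J (lift_A d n (diag_op d z)) x y"
  proof (cases "x \<in> ?I \<and> y \<in> ?I")
    case xy: True
    show ?thesis
    proof (cases "J x y = 0")
      case False
      have "mset (fst x) = mset (fst y)"
      proof (rule mset_eq_if_torus_eq)
        fix u :: "nat \<Rightarrow> complex" assume "\<And>i. cmod (u i) = 1"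
        then have "mat_mult ?I (lift_A d n (diag_op d u)) J x y = mat_mult ?I J (lift_A d n (diag_op d u)) x y"
          by (simp only: unit[OF unitary_diag_op])
        then show "prod_list (map u (fst x)) = prod_list (map u (fst y))"
          using xy False by (simp add: mat_mult_lift_diag)
      qed
      then have "prod_mset (mset (map z (fst x))) = prod_mset (mset (map z (fst y)))"
        unfolding mset_map by simp
      then have "prod_list (map z (fst x)) = prod_list (map z (fst y))"
        unfolding prod_mset_prod_list .
      then show ?thesis using xy by (simp add: mat_mult_lift_diag)
    qed (use xy in \<open>simp add: mat_mult_lift_diag\<close>)
  next
    case False
    have s: "supported_on ?I (lift_A d n (diag_op d z))" by (intro supported_lift_A supported_diag_op)
    show ?thesis using supported_on_mat_mult[OF s J] supported_on_mat_mult[OF J s] False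
      unfolding supported_on_def by (metis (no_types))
  qed
qed

text \<open>H = U D U^dagger, and \<open>lift_A\<close> is multiplicative. The unitary factors
  commute with J by assumption; D has eigenvalues on its diagonal, not phases, so it needs
  \<open>commute_diag\<close>.\<close>

lemma commute_hermitian:
  assumes J: "supported_on (pair_idx d n) J"
    and unit: "\<And>V. unitary_on d V \<Longrightarrow> mat_mult (pair_idx d n) (lift_A d n V) J = mat_mult (pair_idx d n) J (lift_A d n V)"
    and H: "supported_on {0..<d} H" "hermitian_on {0..<d} H"
  shows "mat_mult (pair_idx d n) (lift_A d n H) J = mat_mult (pair_idx d n) J (lift_A d n H)"
proof -
  let ?S = "{0..<d}" and ?I = "pair_idx d n"
  obtain V l where on: "\<And>j k. j < d \<Longrightarrow> k < d \<Longrightarrow> inner_on ?S (V j) (V k) = (if j = k then 1 else 0)"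
    and compl: "\<And>i j. i < d \<Longrightarrow> j < d \<Longrightarrow> (\<Sum>k<d. V k i * cnj (V k j)) = (if i = j then 1 else 0)"
    and ev: "\<And>k i. k < d \<Longrightarrow> i < d \<Longrightarrow> mat_vec ?S H (V k) i = of_real (l k :: real) * V k i"
    using spectral_theorem[OF _ H(2)] by auto
  define U where "U = (\<lambda>i k. if i < d \<and> k < d then V k i else 0)"
  have Us: "supported_on ?S U" by (auto simp: supported_on_def U_def)
  have U: "unitary_on d U"
    unfolding unitary_on_def
  proof (intro conjI Us allI impI)
    fix i j assume ij: "i < d" "j < d"
    show "(\<Sum>k<d. U i k * cnj (U j k)) = (if i = j then 1 else 0)"
      using compl[OF ij] ij by (simp add: U_def)
    show "(\<Sum>k<d. cnj (U k i) * U k j) = (if i = j then 1 else 0)"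
      using on[OF ij] ij by (simp add: U_def inner_on_def atLeast0LessThan)
  qed
  note Ua = U[unfolded unitary_on_iff]
  have UH: "unitary_on d (dagger U)"
    unfolding unitary_on_iff using Ua by (simp add: supported_on_dagger)
  have HU: "mat_mult ?S H U = mat_mult ?S U (diag_op d (\<lambda>k. of_real (l k)))"
  proof (intro ext)
    fix i k
    have r: "mat_mult ?S U (diag_op d (\<lambda>k. of_real (l k))) i k = U i k * of_real (l k)"
    proof -
      have "mat_mult ?S U (diag_op d (\<lambda>k. of_real (l k))) i k
          = (\<Sum>m\<in>?S. if m = k then U i k * of_real (l k) else 0)"
        unfolding mat_mult_def by (intro sum.cong) (auto simp: diag_op_def)
      then show ?thesis by (auto simp: U_def)
    qed
    show "mat_mult ?S H U i k = mat_mult ?S U (diag_op d (\<lambda>k. of_real (l k))) i k"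
    proof (cases "i < d \<and> k < d")
      case True
      then have "mat_mult ?S H U i k = mat_vec ?S H (V k) i"
        by (simp add: mat_mult_def mat_vec_def U_def)
      then show ?thesis unfolding r using ev[of k i] True by (simp add: U_def)
    next
      case False
      then show ?thesis unfolding r using supported_on_mat_mult[OF H(1) Us, of ?S]
        by (auto simp: supported_on_def U_def)
    qed
  qed
  have "H = mat_mult ?S H (mat_mult ?S U (dagger U))"
    using Ua H(1) by (subst mat_mult_id_right[symmetric, where I = ?S]) (auto simp: supported_on_def)
  also have "\<dots> = mat_mult ?S U (mat_mult ?S (diag_op d (\<lambda>k. of_real (l k))) (dagger U))"
    unfolding mat_mult_assoc[symmetric] HU ..
  finally have dec: "lift_A d n H
      = mat_mult ?I (lift_A d n U) (mat_mult ?I (lift_A d n (diag_op d (\<lambda>k. of_real (l k)))) (lift_A d n (dagger U)))"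
    by (simp add: lift_A_mat_mult)
  define D where "D = diag_op d (\<lambda>k. of_real (l k))"
  have DJ: "mat_mult ?I (lift_A d n D) J = mat_mult ?I J (lift_A d n D)"
    unfolding D_def by (rule commute_diag[OF J unit])
  have "mat_mult ?I (lift_A d n H) J = mat_mult ?I (lift_A d n U) (mat_mult ?I (lift_A d n D) (mat_mult ?I (lift_A d n (dagger U)) J))"
    unfolding dec D_def mat_mult_assoc ..
  also have "mat_mult ?I (lift_A d n (dagger U)) J = mat_mult ?I J (lift_A d n (dagger U))" by (rule unit[OF UH])
  also have "mat_mult ?I (lift_A d n D) (mat_mult ?I J (lift_A d n (dagger U))) = mat_mult ?I J (mat_mult ?I (lift_A d n D) (lift_A d n (dagger U)))"
    unfolding mat_mult_assoc[symmetric] DJ ..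
  also have "mat_mult ?I (lift_A d n U) (mat_mult ?I J (mat_mult ?I (lift_A d n D) (lift_A d n (dagger U))))
      = mat_mult ?I J (mat_mult ?I (lift_A d n U) (mat_mult ?I (lift_A d n D) (lift_A d n (dagger U))))"
    unfolding mat_mult_assoc[symmetric] unit[OF U] ..
  finally show ?thesis unfolding dec D_def .
qed

definition polynomial_fun :: "(complex \<Rightarrow> complex) \<Rightarrow> bool" where
  "polynomial_fun f \<longleftrightarrow> (\<exists>p. \<forall>z. f z = poly p z)"

lemma polynomial_fun_const: "polynomial_fun (\<lambda>z. c)"
  unfolding polynomial_fun_def by (rule exI[of _ "[:c:]"]) simp

lemma polynomial_fun_ident: "polynomial_fun (\<lambda>z. z)"
  unfolding polynomial_fun_def by (rule exI[of _ "[:0, 1:]"]) simp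

lemma polynomial_fun_add: "polynomial_fun f \<Longrightarrow> polynomial_fun g \<Longrightarrow> polynomial_fun (\<lambda>z. f z + g z)"
  unfolding polynomial_fun_def by (metis poly_add)

lemma polynomial_fun_diff: "polynomial_fun f \<Longrightarrow> polynomial_fun g \<Longrightarrow> polynomial_fun (\<lambda>z. f z - g z)"
  unfolding polynomial_fun_def by (metis poly_diff)

lemma polynomial_fun_mult: "polynomial_fun f \<Longrightarrow> polynomial_fun g \<Longrightarrow> polynomial_fun (\<lambda>z. f z * g z)"
  unfolding polynomial_fun_def by (metis poly_mult)

lemma polynomial_fun_sum:
  "(\<And>i. i \<in> A \<Longrightarrow> polynomial_fun (f i)) \<Longrightarrow> polynomial_fun (\<lambda>z. \<Sum>i\<in>A. f i z)"
  by (induction A rule: infinite_finite_induct)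
     (auto intro: polynomial_fun_add polynomial_fun_const)

lemma polynomial_fun_prod:
  "(\<And>i. i \<in> A \<Longrightarrow> polynomial_fun (f i)) \<Longrightarrow> polynomial_fun (\<lambda>z. \<Prod>i\<in>A. f i z)"
  by (induction A rule: infinite_finite_induct)
     (auto intro: polynomial_fun_mult polynomial_fun_const)

text \<open>A nonzero polynomial has finitely many roots. This carries vanishing from real
  parameters to the imaginary unit; commutation with two Hermitian parts separately would not do, as
  \<open>lift_A\<close> is not additive in its matrix.\<close>

lemma polynomial_fun_zero:
  assumes "polynomial_fun f" and "\<And>t::real. f (of_real t) = 0"
  shows "f z = 0"
proof -
  obtain p where p: "\<And>z. f z = poly p z" using assms(1) by (auto simp: polynomial_fun_def)
  have "p = 0"
  proof (rule ccontr)
    assume "p \<noteq> 0"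
    then have "finite {z. poly p z = 0}" by (rule poly_roots_finite)
    moreover have "range complex_of_real \<subseteq> {z. poly p z = 0}" using assms(2) p by auto
    ultimately have "finite (range complex_of_real)" by (rule finite_subset[rotated])
    then show False using finite_imageD[of complex_of_real UNIV] infinite_UNIV_char_0[where 'a = real]
      by (auto simp: inj_on_def)
  qed
  then show ?thesis using p by simp
qed

text \<open>Every matrix is \<open>H\<^sub>1 + \<i> H\<^sub>2\<close> with \<open>H\<^sub>1, H\<^sub>2\<close> Hermitian, and \<open>H\<^sub>1 + t H\<^sub>2\<close> is Hermitian for real \<open>t\<close>;
  the commutator is a polynomial in \<open>t\<close>.\<close>

lemma commute_all:
  assumes J: "supported_on (pair_idx d n) J"
    and unit: "\<And>V. unitary_on d V \<Longrightarrow> mat_mult (pair_idx d n) (lift_A d n V) J = mat_mult (pair_idx d n) J (lift_A d n V)"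
    and X: "supported_on {0..<d} X"
  shows "mat_mult (pair_idx d n) (lift_A d n X) J = mat_mult (pair_idx d n) J (lift_A d n X)"
proof (intro ext)
  fix x y
  let ?I = "pair_idx d n"
  define H1 where "H1 = (\<lambda>i j. (1 / 2) * (X i j + cnj (X j i)))"
  define H2 where "H2 = (\<lambda>i j. (\<i> / 2) * (cnj (X j i) - X i j))"
  define Y where "Y z = (\<lambda>i j. H1 i j + z * H2 i j)" for z
  have XY: "X = Y \<i>"
    by (simp add: Y_def H1_def H2_def fun_eq_iff complex_eq_iff) (simp add: field_simps)
  define f where "f z = mat_mult ?I (lift_A d n (Y z)) J x y - mat_mult ?I J (lift_A d n (Y z)) x y" for z
  have pl: "polynomial_fun (\<lambda>z. lift_A d n (Y z) u w)" for u w
  proof -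
    have "polynomial_fun (\<lambda>z. tensor_power n (Y z) a b)" for a b
      unfolding tensor_power_def Y_def
      by (cases "length a = n \<and> length b = n")
         (auto intro!: polynomial_fun_prod polynomial_fun_add polynomial_fun_mult polynomial_fun_const polynomial_fun_ident)
    then show ?thesis unfolding lift_A_def tens_def
      by (intro polynomial_fun_mult polynomial_fun_const)
  qed
  have "polynomial_fun f"
    unfolding f_def mat_mult_def
    by (intro polynomial_fun_diff polynomial_fun_sum polynomial_fun_mult polynomial_fun_const pl)
  moreover have "f (of_real t) = 0" for t
  proof -
    have "supported_on {0..<d} (Y (of_real t))"
      using X by (auto simp: supported_on_def Y_def H1_def H2_def)
    moreover have "hermitian_on {0..<d} (Y (of_real t))"
      by (simp add: hermitian_on_def Y_def H1_def H2_def complex_eq_iff algebra_simps)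
    ultimately show ?thesis
      using commute_hermitian[OF J unit] by (simp add: f_def)
  qed
  ultimately have "f \<i> = 0" by (rule polynomial_fun_zero)
  then show "mat_mult ?I (lift_A d n X) J x y = mat_mult ?I J (lift_A d n X) x y"
    by (simp add: f_def XY)
qed

text \<open>Each entry of the partial trace over Bob is a linear functional that is constant on the
  orbit, by unitarity of U. This normalisation keeps Alice's operator below the identity.\<close>

lemma orbit_hull_partial_trace:
  assumes J: "J \<in> orbit_hull d n" and a: "a \<in> party_idx d n" "a' \<in> party_idx d n"
  shows "(\<Sum>b\<in>party_idx d n. J (a, b) (a', b)) = id_op (party_idx d n) a a'"
proof -
  let ?P = "party_idx d n"
  \<comment> \<open>The matrix unit with row a' and column a on Alice's side, tensored with the
    identity of Bob.\<close>
  define L where "L = (\<lambda>x y :: nat list \<times> nat list. if x = (a', snd x) \<and> y = (a, snd x) then 1 else 0 :: complex)"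
  have tr: "tr_prod (pair_idx d n) L A = (\<Sum>b\<in>?P. A (a, b) (a', b))" for A
  proof -
    have "tr_prod (pair_idx d n) L A
        = (\<Sum>c\<in>?P. \<Sum>b\<in>?P. \<Sum>c'\<in>?P. \<Sum>b'\<in>?P. if b' = b then if c' = a then if c = a' then A (a, b) (a', b) else 0 else 0 else 0)"
      unfolding tr_prod_def pair_idx_def sum.cartesian_product[symmetric]
      unfolding sum.cartesian_product'
      by (intro sum.cong refl) (auto simp: L_def)
    also have "\<dots> = (\<Sum>c\<in>?P. \<Sum>b\<in>?P. if c = a' then A (a, b) (a', b) else 0)"
      using a finite_party_idx[of d n] by (intro sum.cong refl) simp
    also have "\<dots> = (\<Sum>b\<in>?P. A (a, b) (a', b))"
      using a finite_party_idx[of d n] by (subst sum.swap) simp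
    finally show ?thesis .
  qed
  have "tr_prod (pair_idx d n) L J = id_op ?P a a'"
  proof (rule orbit_hull_eq[OF J])
    fix U assume U: "unitary_on d U"
    have "tr_prod (pair_idx d n) L (orbit_op n U) = mat_mult ?P (dagger (tensor_power n U)) (tensor_power n U) a' a"
      unfolding tr by (simp add: rank_one_def omega_vec_def mat_mult_def dagger_def mult.commute)
    also have "\<dots> = id_op ?P a' a"
      using U unfolding dagger_tensor_power party_idx_eq tensor_power_mat_mult unitary_on_iff
      by (simp add: tensor_power_id)
    finally show "tr_prod (pair_idx d n) L (orbit_op n U) = id_op ?P a a'"
      by (auto simp: id_op_def)
  qed
  then show ?thesis unfolding tr .
qed

section \<open>Testing pure states on Alice's side\<close>

definition pair_op :: "(nat \<times> nat) list op \<Rightarrow> (nat list \<times> nat list) op" where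
  "pair_op T = (\<lambda>x y. T (zip (fst x) (snd x)) (zip (fst y) (snd y)))"

text \<open>After regrouping, n copies of \<psi> form the vector whose coefficient matrix is the
  n-th tensor power of that of \<psi>.\<close>

lemma tr_prod_tensor_power_rank_one:
  "tr_prod (copies_idx d n) T (tensor_power n (rank_one \<psi>))
    = tr_prod (pair_idx d n) (pair_op T) (rank_one (\<lambda>(a, b). tensor_power n (\<lambda>i j. \<psi> (i, j)) a b))"
proof -
  define g where "g = (\<lambda>x. case x of (a, b) \<Rightarrow> tensor_power n (\<lambda>i j. \<psi> (i, j)) a b)"
  have tp: "tensor_power n (rank_one \<psi>) ys xs = rank_one g (map fst ys, map snd ys) (map fst xs, map snd xs)"
    if "xs \<in> copies_idx d n" "ys \<in> copies_idx d n" for xs ys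
    using that by (simp add: tensor_power_def rank_one_def g_def copies_idx_def prod.distrib)
  have "tr_prod (copies_idx d n) T (tensor_power n (rank_one \<psi>))
     = (\<Sum>xs\<in>copies_idx d n. \<Sum>ys\<in>copies_idx d n.
          pair_op T (map fst xs, map snd xs) (map fst ys, map snd ys)
          * rank_one g (map fst ys, map snd ys) (map fst xs, map snd xs))"
    unfolding tr_prod_def
    by (intro sum.cong refl) (simp add: tp pair_op_def zip_map_fst_snd)
  also have "\<dots> = (\<Sum>a\<in>party_idx d n. \<Sum>b\<in>party_idx d n. \<Sum>a'\<in>party_idx d n. \<Sum>b'\<in>party_idx d n.
       pair_op T (a, b) (a', b') * rank_one g (a', b') (a, b))"
    by (simp only: sum_words_unzip[of "\<lambda>a' b'. pair_op T x (a', b') * rank_one g (a', b') x" d n for x]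
      sum_words_unzip[of "\<lambda>a b. \<Sum>a'\<in>party_idx d n. \<Sum>b'\<in>party_idx d n.
        pair_op T (a, b) (a', b') * rank_one g (a', b') (a, b)"])
  finally show ?thesis
    unfolding tr_prod_def pair_idx_def g_def sum.cartesian_product' .
qed

lemma psd_pair_op:
  assumes "psd_on (copies_idx d n) T"
  shows "psd_on (pair_idx d n) (pair_op T)"
  unfolding pair_op_def
proof (rule psd_on_reindex[OF finite_copies_idx assms])
  show "(\<lambda>x. zip (fst x) (snd x)) ` pair_idx d n \<subseteq> copies_idx d n"
    by (auto simp: pair_idx_def copies_iff) (auto simp: party_idx_def)
qed

definition ptrace_B :: "nat \<Rightarrow> nat \<Rightarrow> (nat list \<times> nat list) op \<Rightarrow> nat list op" where
  "ptrace_B d n N = (\<lambda>a a'. \<Sum>b\<in>party_idx d n. N (a, b) (a', b))"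

lemma psd_ptrace_B:
  assumes "psd_on (pair_idx d n) N"
  shows "psd_on (party_idx d n) (ptrace_B d n N)"
  unfolding ptrace_B_def
  by (intro psd_on_sum psd_on_reindex[OF finite_pair_idx assms]) (auto simp: pair_idx_def)

lemma tr_prod_ptrace_B:
  "tr_prod (party_idx d n) (ptrace_B d n N) R = tr_prod (pair_idx d n) N (tens R (id_op (party_idx d n)))"
proof -
  let ?P = "party_idx d n"
  have "tr_prod (pair_idx d n) N (tens R (id_op ?P))
      = (\<Sum>a\<in>?P. \<Sum>b\<in>?P. \<Sum>a'\<in>?P. \<Sum>b'\<in>?P. if b' = b then N (a, b) (a', b) * R a' a else 0)"
    unfolding tr_prod_def pair_idx_def sum.cartesian_product'
    by (intro sum.cong refl) (auto simp: tens_def id_op_def)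
  also have "\<dots> = (\<Sum>a\<in>?P. \<Sum>b\<in>?P. \<Sum>a'\<in>?P. N (a, b) (a', b) * R a' a)"
    using finite_party_idx[of d n] by (intro sum.cong refl) simp
  also have "\<dots> = (\<Sum>a\<in>?P. \<Sum>a'\<in>?P. \<Sum>b\<in>?P. N (a, b) (a', b) * R a' a)"
    by (intro sum.cong refl sum.swap)
  finally show ?thesis by (simp add: tr_prod_def ptrace_B_def sum_distrib_right)
qed

definition alice_op :: "nat \<Rightarrow> nat \<Rightarrow> nat list op \<Rightarrow> (nat \<times> nat) list op" where
  "alice_op d n M = (\<lambda>xs ys. M (map fst xs) (map fst ys) * id_op (party_idx d n) (map snd xs) (map snd ys))"

lemma conj_B_rank_one:
  "conj_B d U (rank_one \<psi>) = rank_one (\<lambda>(a, b). mat_mult {0..<d} (\<lambda>i j. \<psi> (i, j)) (\<lambda>i j. U j i) a b)"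
proof -
  have "conj_B d U (rank_one \<psi>) (a, b) (a', b')
      = (\<Sum>c<d. U b c * \<psi> (a, c)) * cnj (\<Sum>c'<d. U b' c' * \<psi> (a', c'))" for a b a' b'
    unfolding cnj_sum sum_product by (simp add: conj_B_def rank_one_def mult_ac)
  then show ?thesis
    by (auto simp: fun_eq_iff rank_one_def mat_mult_def atLeast0LessThan mult.commute)
qed

text \<open>With X the coefficient matrix of \<psi> and x = X^n (x) 1, the acceptance value of M is
  tr (K T K x x^dagger) = tr (x^dagger T x J). This is linear in J, and at the orbit point of U it
  is the value of T on (1 (x) U) \<psi>, so bounds valid for all U pass to J. \<psi> need not be
  normalised, which matters for the dominant part of a mixed state.\<close>

theorem alice_effect:
  assumes T: "is_effect (copies_idx d n) T"
  obtains M where "is_effect (party_idx d n) M"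
    "\<And>\<psi> c. (\<And>x. x \<notin> bip_idx d \<Longrightarrow> \<psi> x = 0) \<Longrightarrow>
      (\<And>U. unitary_on d U \<Longrightarrow> c \<le> Re (tr_prod (copies_idx d n) T (tensor_power n (conj_B d U (rank_one \<psi>))))) \<Longrightarrow>
      c \<le> Re (tr_prod (copies_idx d n) (alice_op d n M) (tensor_power n (rank_one \<psi>)))"
    "\<And>\<psi> s. (\<And>x. x \<notin> bip_idx d \<Longrightarrow> \<psi> x = 0) \<Longrightarrow>
      (\<And>U. unitary_on d U \<Longrightarrow> Re (tr_prod (copies_idx d n) T (tensor_power n (conj_B d U (rank_one \<psi>)))) \<le> s) \<Longrightarrow>
      Re (tr_prod (copies_idx d n) (alice_op d n M) (tensor_power n (rank_one \<psi>))) \<le> s"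
proof -
  let ?P = "party_idx d n" and ?I = "pair_idx d n"
  obtain J where J: "J \<in> orbit_hull d n"
    and Ju: "\<And>V. unitary_on d V \<Longrightarrow> mat_mult ?I (lift_A d n V) J = mat_mult ?I J (lift_A d n V)"
    using twirled_op by blast
  have Js: "supported_on ?I J" using J by (simp add: orbit_hull_def)
  obtain K where Ks: "supported_on ?I K" and Ka: "dagger K = K" and KK: "mat_mult ?I K K = J"
    and Kc: "\<And>C. supported_on ?I C \<Longrightarrow> mat_mult ?I C J = mat_mult ?I J C \<Longrightarrow> mat_mult ?I C K = mat_mult ?I K C"
    using psd_on_sqrt[OF finite_pair_idx Js psd_orbit_hull[OF J]] by blast
  define N where "N S = mat_mult ?I (dagger K) (mat_mult ?I (pair_op S) K)" for S
  define M where "M = ptrace_B d n (N T)"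
  have Ns: "supported_on ?I (N S)" for S
  proof -
    have "N S x y = 0" if "x \<notin> ?I \<or> y \<notin> ?I" for x y
      using that Ks unfolding N_def Ka mat_mult_def supported_on_def
      by (metis (no_types, lifting) mult_zero_left mult_zero_right sum.neutral)
    then show ?thesis by (auto simp: supported_on_def)
  qed
  have psdM: "psd_on ?P (ptrace_B d n (N S))" if "psd_on (copies_idx d n) S" for S
    unfolding N_def by (intro psd_ptrace_B psd_on_congruence psd_pair_op that)
  \<comment> \<open>Sandwiching the identity gives K K = J, whose partial trace is the identity; so
    the complement of T yields the complement of M.\<close>
  have compl: "ptrace_B d n (N (\<lambda>x y. id_op (copies_idx d n) x y - T x y)) a a' = id_op ?P a a' - M a a'"
    if aa: "a \<in> ?P" "a' \<in> ?P" for a a'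
  proof -
    have "pair_op (id_op (copies_idx d n)) x y = id_op ?I x y" if "x \<in> ?I" "y \<in> ?I" for x y
    proof -
      have "length (fst x) = n" "length (snd x) = n" "length (fst y) = n" "length (snd y) = n"
        using that by (auto simp: pair_idx_def party_idx_def)
      then have "pair_op (id_op (copies_idx d n)) x y = tens (id_op ?P) (id_op ?P) x y"
        unfolding pair_op_def id_op_copies tens_def by simp
      then show ?thesis unfolding tens_id pair_idx_def .
    qed
    then have "mat_mult ?I (pair_op (id_op (copies_idx d n))) K x y = mat_mult ?I (id_op ?I) K x y" if "x \<in> ?I" for x y
      using that by (simp add: mat_mult_def)
    also have "mat_mult ?I (id_op ?I) K = K"
      using Ks by (intro mat_mult_id_left finite_pair_idx) (auto simp: supported_on_def)
    finally have pid: "mat_mult ?I (pair_op (id_op (copies_idx d n))) K x y = K x y" if "x \<in> ?I" for x y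
      using that .
    have "N (\<lambda>x y. id_op (copies_idx d n) x y - T x y) x y = J x y - N T x y" for x y
    proof -
      have "N (\<lambda>x y. id_op (copies_idx d n) x y - T x y) x y
          = (\<Sum>u\<in>?I. K x u * (mat_mult ?I (pair_op (id_op (copies_idx d n))) K u y - mat_mult ?I (pair_op T) K u y))"
        unfolding N_def Ka mat_mult_def pair_op_def by (simp add: sum_subtractf algebra_simps)
      also have "\<dots> = mat_mult ?I K K x y - N T x y"
        unfolding N_def Ka by (simp add: pid mat_mult_def[of _ K] sum_subtractf algebra_simps)
      finally show ?thesis unfolding KK .
    qed
    then show ?thesis
      using orbit_hull_partial_trace[OF J aa] by (simp add: ptrace_B_def M_def sum_subtractf)
  qed
  have effM: "is_effect ?P M"
    unfolding is_effect_def
  proof (intro conjI)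
    show "supported_on ?P M"
      using Ns[of T] by (auto simp: supported_on_def M_def ptrace_B_def pair_idx_def intro!: sum.neutral)
    show "psd_on ?P M" unfolding M_def using T by (intro psdM) (simp add: is_effect_def)
    have "psd_on ?P (ptrace_B d n (N (\<lambda>x y. id_op (copies_idx d n) x y - T x y)))"
      using T by (intro psdM) (simp add: is_effect_def)
    then show "psd_on ?P (\<lambda>i j. id_op ?P i j - M i j)"
      using psd_on_cong[of ?P "ptrace_B d n (N (\<lambda>x y. id_op (copies_idx d n) x y - T x y))"] compl by simp
  qed
  have main: "tr_prod (copies_idx d n) (alice_op d n M) (tensor_power n (rank_one \<psi>))
      = tr_prod ?I (mat_mult ?I (dagger (lift_A d n (\<lambda>i j. \<psi> (i, j)))) (mat_mult ?I (pair_op T) (lift_A d n (\<lambda>i j. \<psi> (i, j))))) J"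
    if \<psi>: "\<forall>x. x \<notin> bip_idx d \<longrightarrow> \<psi> x = 0" for \<psi>
  proof -
    define X where "X = (\<lambda>i j. \<psi> (i, j))"
    define x where "x = lift_A d n X"
    have Xs: "supported_on {0..<d} X" using \<psi> by (auto simp: supported_on_def X_def bip_idx_def)
    have xs: "supported_on ?I x" unfolding x_def by (rule supported_lift_A[OF Xs])
    \<comment> \<open>K commutes with whatever commutes with J = K K, and J commutes with x although
      X is arbitrary.\<close>
    have xK: "mat_mult ?I x K = mat_mult ?I K x"
      using commute_all[OF Js Ju Xs] xs unfolding x_def by (intro Kc) auto
    have "dagger x = lift_A d n (dagger X)" by (simp add: x_def lift_A_dagger)
    then have xK': "mat_mult ?I (dagger x) K = mat_mult ?I K (dagger x)"
      using commute_all[OF Js Ju supported_on_dagger[OF Xs]] supported_on_dagger[OF xs] by (intro Kc) auto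
    have "tr_prod (copies_idx d n) (alice_op d n M) (tensor_power n (rank_one \<psi>))
      = tr_prod ?I (tens M (id_op ?P)) (rank_one (\<lambda>(a, b). tensor_power n X a b))"
      unfolding tr_prod_tensor_power_rank_one X_def[symmetric]
      unfolding tr_prod_def pair_idx_def
      by (intro sum.cong refl)
         (auto simp: pair_op_def alice_op_def tens_def party_idx_def)
    also have "\<dots> = (\<Sum>a\<in>?P. \<Sum>b\<in>?P. \<Sum>a'\<in>?P. \<Sum>b'\<in>?P.
        if b' = b then M a a' * (tensor_power n X a' b * cnj (tensor_power n X a b)) else 0)"
      unfolding tr_prod_def pair_idx_def sum.cartesian_product'
      by (intro sum.cong refl) (auto simp: tens_def id_op_def rank_one_def)
    also have "\<dots> = (\<Sum>a\<in>?P. \<Sum>b\<in>?P. \<Sum>a'\<in>?P. M a a' * (tensor_power n X a' b * cnj (tensor_power n X a b)))"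
      using finite_party_idx[of d n] by (intro sum.cong refl) simp
    also have "\<dots> = (\<Sum>a\<in>?P. \<Sum>a'\<in>?P. \<Sum>b\<in>?P. M a a' * (tensor_power n X a' b * cnj (tensor_power n X a b)))"
      by (intro sum.cong refl sum.swap)
    also have "\<dots> = tr_prod ?P M (mat_mult ?P (tensor_power n X) (dagger (tensor_power n X)))"
      by (simp add: tr_prod_def mat_mult_def dagger_def sum_distrib_left)
    also have "\<dots> = tr_prod ?I (N T) (mat_mult ?I x (dagger x))"
      unfolding M_def tr_prod_ptrace_B
      by (simp add: x_def lift_A_def dagger_tens dagger_id pair_idx_def mat_mult_tens mat_mult_id_party)
    also have "\<dots> = trace_on ?I (mat_mult ?I K (mat_mult ?I (pair_op T) (mat_mult ?I K (mat_mult ?I x (dagger x)))))"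
      unfolding tr_prod_eq_trace N_def Ka mat_mult_assoc ..
    also have "\<dots> = trace_on ?I (mat_mult ?I (pair_op T) (mat_mult ?I K (mat_mult ?I x (mat_mult ?I (dagger x) K))))"
      by (subst trace_mat_mult_commute) (simp add: mat_mult_assoc)
    \<comment> \<open>Commutation with x and with its adjoint moves both roots between x and
      x^dagger, where they meet.\<close>
    also have "mat_mult ?I K (mat_mult ?I x (mat_mult ?I (dagger x) K)) = mat_mult ?I x (mat_mult ?I (mat_mult ?I K K) (dagger x))"
      unfolding xK' by (metis mat_mult_assoc xK)
    also have "trace_on ?I (mat_mult ?I (pair_op T) (mat_mult ?I x (mat_mult ?I (mat_mult ?I K K) (dagger x))))
        = tr_prod ?I (mat_mult ?I (dagger x) (mat_mult ?I (pair_op T) x)) J"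
      unfolding KK tr_prod_conj[symmetric] unfolding tr_prod_eq_trace ..
    finally show ?thesis by (simp add: x_def X_def)
  qed
  have orb: "tr_prod ?I (mat_mult ?I (dagger (lift_A d n (\<lambda>i j. \<psi> (i, j)))) (mat_mult ?I (pair_op T) (lift_A d n (\<lambda>i j. \<psi> (i, j)))))
        (orbit_op n U) = tr_prod (copies_idx d n) T (tensor_power n (conj_B d U (rank_one \<psi>)))"
    if U: "unitary_on d U" for U \<psi>
  proof -
    have "mat_vec ?I (lift_A d n (\<lambda>i j. \<psi> (i, j))) (omega_vec n U)
        = (\<lambda>(a, b). tensor_power n (mat_mult {0..<d} (\<lambda>i j. \<psi> (i, j)) (\<lambda>i j. U j i)) a b)"
      using omega_vec_lift[OF U] by (auto simp: fun_eq_iff)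
    then show ?thesis
      unfolding tr_prod_conj[symmetric] mat_mult_rank_one conj_B_rank_one tr_prod_tensor_power_rank_one by simp
  qed
  show thesis
  proof (rule that[OF effM])
    fix \<psi> :: "nat \<times> nat \<Rightarrow> complex" and c assume \<psi>: "\<And>x. x \<notin> bip_idx d \<Longrightarrow> \<psi> x = 0"
      and *: "\<And>U. unitary_on d U \<Longrightarrow> c \<le> Re (tr_prod (copies_idx d n) T (tensor_power n (conj_B d U (rank_one \<psi>))))"
    have \<psi>': "\<forall>x. x \<notin> bip_idx d \<longrightarrow> \<psi> x = 0" using \<psi> by blast
    show "c \<le> Re (tr_prod (copies_idx d n) (alice_op d n M) (tensor_power n (rank_one \<psi>)))"
      unfolding main[OF \<psi>'] using * by (intro orbit_hull_ge[OF J]) (simp add: orb)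
  next
    fix \<psi> :: "nat \<times> nat \<Rightarrow> complex" and s assume \<psi>: "\<And>x. x \<notin> bip_idx d \<Longrightarrow> \<psi> x = 0"
      and *: "\<And>U. unitary_on d U \<Longrightarrow> Re (tr_prod (copies_idx d n) T (tensor_power n (conj_B d U (rank_one \<psi>)))) \<le> s"
    have \<psi>': "\<forall>x. x \<notin> bip_idx d \<longrightarrow> \<psi> x = 0" using \<psi> by blast
    show "Re (tr_prod (copies_idx d n) (alice_op d n M) (tensor_power n (rank_one \<psi>))) \<le> s"
      unfolding main[OF \<psi>'] using * by (intro orbit_hull_le[OF J]) (simp add: orb)
  qed
qed

lemma aligned_alice:
  assumes "is_effect (party_idx d n) M"
  shows "aligned d n {0} (\<lambda>_. id_op (party_idx d n)) (alice_op d n M)"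
  unfolding aligned_def alice_op_def using assms by (intro exI[of _ "\<lambda>_. M"]) simp

section \<open>Swap tests\<close>

text \<open>Reversal of a word, which on two copies is the swap; it is compatible with splitting a
  word of pairs into the words of the two parties.\<close>

definition rev_op :: "'i list set \<Rightarrow> 'i list op" where
  "rev_op W = (\<lambda>u w. if u \<in> W \<and> w = rev u then 1 else 0)"

text \<open>For \<open>e = 1\<close> and \<open>e = - 1\<close> the projections onto the vectors that are symmetric and
  antisymmetric under reversal of the copies.\<close>

definition swap_proj :: "'i list set \<Rightarrow> complex \<Rightarrow> 'i list op" where
  "swap_proj W e = (\<lambda>u w. (id_op W u w + e * rev_op W u w) / 2)"

lemma sum_swap_proj:
  assumes "finite W" "rev ` W \<subseteq> W" "u \<in> W"
  shows "(\<Sum>w\<in>W. swap_proj W e u w * h w) = (h u + e * h (rev u)) / 2"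
proof -
  have "(\<Sum>w\<in>W. swap_proj W e u w * h w)
      = (\<Sum>w\<in>W. (if w = u then h u / 2 else 0) + (if w = rev u then e * h (rev u) / 2 else 0))"
    using assms(3) by (intro sum.cong) (auto simp: swap_proj_def id_op_def rev_op_def field_simps)
  also have "\<dots> = h u / 2 + e * h (rev u) / 2"
    unfolding sum.distrib using assms by (auto simp: image_subset_iff)
  finally show ?thesis by (simp add: add_divide_distrib)
qed

text \<open>For e = 1 or e = - 1 the operator is a Hermitian idempotent, hence its own Gram
  factor.\<close>

lemma psd_swap_proj:
  assumes fin: "finite W" and rev: "rev ` W \<subseteq> W" and e: "e = 1 \<or> e = - 1"
  shows "psd_on W (swap_proj W e)"
proof (rule psd_onI_gram[where L = W and G = "swap_proj W e"])
  fix u w assume uw: "u \<in> W" "w \<in> W"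
  have "(\<Sum>k\<in>W. swap_proj W e u k * cnj (swap_proj W e w k))
      = (cnj (swap_proj W e w u) + e * cnj (swap_proj W e w (rev u))) / 2"
    by (rule sum_swap_proj[OF fin rev uw(1)])
  also have "\<dots> = swap_proj W e u w"
    using uw e by (auto simp: swap_proj_def id_op_def rev_op_def rev_swap)
  finally show "swap_proj W e u w = (\<Sum>k\<in>W. swap_proj W e u k * cnj (swap_proj W e w k))" by simp
qed

lemma supported_swap_proj: "rev ` W \<subseteq> W \<Longrightarrow> supported_on W (swap_proj W e)"
  by (auto simp: supported_on_def swap_proj_def id_op_def rev_op_def)

lemma swap_proj_compl: "id_op W u w - swap_proj W e u w = swap_proj W (- e) u w"
  by (simp add: swap_proj_def field_simps)

lemma effect_swap_proj:
  assumes "finite W" "rev ` W \<subseteq> W" "e = 1 \<or> e = - 1"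
  shows "is_effect W (swap_proj W e)"
  unfolding is_effect_def swap_proj_compl
  using assms by (auto intro!: psd_swap_proj supported_swap_proj)

lemma rev_words: "rev ` words S n \<subseteq> words S n"
  by (auto simp: words_def)

lemma rev_op_copies:
  "rev_op (copies_idx d N) xs ys
    = rev_op (party_idx d N) (map fst xs) (map fst ys) * rev_op (party_idx d N) (map snd xs) (map snd ys)"
  using map_fst_snd_eq_iff[of ys "rev xs"] by (auto simp: rev_op_def copies_iff rev_map)

definition swap_sign :: "nat \<Rightarrow> complex" where
  "swap_sign m = (if m = 0 then 1 else - 1)"

lemma bob_povm_swap: "bob_povm d N {0, 1} (\<lambda>m. swap_proj (party_idx d N) (swap_sign m))"
  unfolding bob_povm_def
proof (intro conjI ballI ext)
  fix u w
  show "(\<Sum>m\<in>{0, 1}. swap_proj (party_idx d N) (swap_sign m) u w) = id_op (party_idx d N) u w"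
    by (simp add: swap_sign_def swap_proj_def field_simps)
qed (auto simp: party_idx_eq swap_sign_def finite_words
      intro!: psd_swap_proj supported_swap_proj rev_words)

text \<open>With F_A and F_B the swaps of the two parties, (1 + F_A F_B) / 2 = P+ (x) P+ + P- (x)
  P-: the pair is symmetric exactly when both parties find the same sign.\<close>

lemma aligned_swap:
  "aligned d N {0, 1} (\<lambda>m. swap_proj (party_idx d N) (swap_sign m)) (swap_proj (copies_idx d N) 1)"
  unfolding aligned_def
proof (intro exI conjI ballI ext)
  fix m :: nat
  show "is_effect (party_idx d N) (swap_proj (party_idx d N) (swap_sign m))"
    by (auto simp: party_idx_eq swap_sign_def finite_words intro!: effect_swap_proj rev_words)
next
  fix xs ys
  show "swap_proj (copies_idx d N) 1 xs ys = (\<Sum>m\<in>{0, 1}.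
      swap_proj (party_idx d N) (swap_sign m) (map fst xs) (map fst ys)
      * swap_proj (party_idx d N) (swap_sign m) (map snd xs) (map snd ys))"
    unfolding swap_proj_def id_op_copies rev_op_copies by (simp add: swap_sign_def field_simps)
qed

text \<open>The trace of the swap against \<rho> (x) \<rho> is the purity of \<rho>.\<close>

lemma tr_prod_swap:
  assumes fin: "finite S" and tr: "trace_on S \<rho> = 1"
  shows "tr_prod (words S 2) (swap_proj (words S 2) 1) (tensor_power 2 \<rho>) = (1 + tr_prod S \<rho> \<rho>) / 2"
proof -
  let ?W = "words S 2"
  have W: "?W = (\<lambda>(i, j). [i, j]) ` (S \<times> S)"
    by (auto simp: words_def length_Suc_conv numeral_2_eq_2 image_iff)
  have "tr_prod ?W (swap_proj ?W 1) (tensor_power 2 \<rho>)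
      = (\<Sum>x\<in>?W. (tensor_power 2 \<rho> x x + 1 * tensor_power 2 \<rho> (rev x) x) / 2)"
    unfolding tr_prod_def
    by (intro sum.cong refl sum_swap_proj[where h = "\<lambda>w. tensor_power 2 \<rho> w _"] finite_words fin rev_words)
  also have "\<dots> = (trace_on ?W (tensor_power 2 \<rho>) + (\<Sum>x\<in>?W. tensor_power 2 \<rho> (rev x) x)) / 2"
    by (simp add: trace_on_def sum_divide_distrib sum.distrib[symmetric])
  also have "(\<Sum>x\<in>?W. tensor_power 2 \<rho> (rev x) x) = (\<Sum>(i, j)\<in>S \<times> S. tensor_power 2 \<rho> [j, i] [i, j])"
    unfolding W by (subst sum.reindex) (auto simp: inj_on_def case_prod_beta)
  also have "\<dots> = tr_prod S \<rho> \<rho>"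
    unfolding tr_prod_def sum.cartesian_product[symmetric]
    by (simp add: tensor_power_def numeral_2_eq_2 mult.commute)
  finally show ?thesis by (simp add: trace_tensor_power tr)
qed

lemma swap_tests:
  "\<exists>K B T. bob_povm d (m * 2) K B \<and> aligned d (m * 2) K B T \<and>
     (\<forall>\<rho>. trace_on (bip_idx d) \<rho> = 1 \<longrightarrow>
       tr_prod (copies_idx d (m * 2)) T (tensor_power (m * 2) \<rho>) = ((1 + tr_prod (bip_idx d) \<rho> \<rho>) / 2) ^ m)"
proof (induction m)
  case 0
  show ?case
    using bob_povm_trivial[of d 0] aligned_const(2)[OF bob_povm_trivial[of d 0]] tr_prod_copies_id[of d _ 0]
    by (intro exI conjI) auto
next
  case (Suc m)
  then obtain K2 B2 T2 where B2: "bob_povm d (m * 2) K2 B2" and T2: "aligned d (m * 2) K2 B2 T2"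
    and tr2: "\<And>\<rho>. trace_on (bip_idx d) \<rho> = 1 \<Longrightarrow>
       tr_prod (copies_idx d (m * 2)) T2 (tensor_power (m * 2) \<rho>) = ((1 + tr_prod (bip_idx d) \<rho> \<rho>) / 2) ^ m"
    by blast
  obtain K B where B: "bob_povm d (2 + m * 2) K B"
    and al: "\<And>F G. aligned d (m * 2) K2 B2 F \<Longrightarrow> aligned d (m * 2) K2 B2 G \<Longrightarrow>
      aligned d (2 + m * 2) K B (branch (bip_idx d) 2 (swap_proj (copies_idx d 2) 1) F G)"
    using aligned_branch[OF bob_povm_swap aligned_swap B2] by blast
  \<comment> \<open>The rejecting branch is 0, so all swap tests have to accept and their
    probabilities multiply.\<close>
  define T where "T = branch (bip_idx d) 2 (swap_proj (copies_idx d 2) 1) T2 (\<lambda>_ _. 0)"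
  have "aligned d (2 + m * 2) K B T"
    unfolding T_def by (intro al T2 aligned_const(1)[OF B2])
  moreover have "tr_prod (copies_idx d (2 + m * 2)) T (tensor_power (2 + m * 2) \<rho>)
      = ((1 + tr_prod (bip_idx d) \<rho> \<rho>) / 2) ^ Suc m" if \<rho>: "trace_on (bip_idx d) \<rho> = 1" for \<rho>
  proof -
    have "tr_prod (copies_idx d 2) (swap_proj (copies_idx d 2) 1) (tensor_power 2 \<rho>)
        = (1 + tr_prod (bip_idx d) \<rho> \<rho>) / 2"
      unfolding copies_idx_eq by (rule tr_prod_swap[OF finite_bip_idx \<rho>])
    then show ?thesis
      unfolding T_def tr_prod_copies_branch[OF \<rho>] tr2[OF \<rho>] tr_prod_zero by simp
  qed
  moreover have "2 + m * 2 = Suc m * 2" by simp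
  ultimately show ?case using B by metis
qed

section \<open>Amplification\<close>

text \<open>The probability of at least \<theta> successes in k trials, by recursion on the first
  trial, as \<open>branch\<close> composes tests.\<close>

fun binomial_tail :: "real \<Rightarrow> nat \<Rightarrow> nat \<Rightarrow> real" where
  "binomial_tail p 0 0 = 1"
| "binomial_tail p 0 (Suc \<theta>) = 0"
| "binomial_tail p (Suc k) 0 = 1"
| "binomial_tail p (Suc k) (Suc \<theta>) = p * binomial_tail p k \<theta> + (1 - p) * binomial_tail p k (Suc \<theta>)"

lemma binomial_tail_zero [simp]: "binomial_tail p k 0 = 1"
  by (cases k) auto

text \<open>Let S count the successes. The right side is the expectation of (S - u)^2; fewer than
  \<theta> successes means S <= \<theta> - 1, where (u - S)^2 is at least the square on the left.
  The free centre u makes the induction close: a success shifts u and \<theta> together.\<close>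

lemma binomial_tail_chebyshev:
  assumes p: "0 \<le> p" "p \<le> 1" and u: "u > real \<theta> - 1"
  shows "(1 - binomial_tail p k \<theta>) * (u - real \<theta> + 1)\<^sup>2 \<le> real k * p * (1 - p) + (real k * p - u)\<^sup>2"
  using u
proof (induction k arbitrary: \<theta> u)
  case 0
  show ?case
  proof (cases \<theta>)
    case (Suc t)
    have "(u - real t)\<^sup>2 \<le> u\<^sup>2"
      using 0 Suc by (intro power_mono) auto
    then show ?thesis using Suc by simp
  qed auto
next
  case (Suc k)
  show ?case
  proof (cases \<theta>)
    case 0
    then show ?thesis using p by simp
  next
    case (Suc t)
    let ?f = "\<lambda>u. real k * p * (1 - p) + (real k * p - u)\<^sup>2"
    have 1: "(1 - binomial_tail p k t) * (u - real \<theta> + 1)\<^sup>2 \<le> ?f (u - 1)"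
      using Suc.IH[of t "u - 1"] Suc.prems \<open>\<theta> = Suc t\<close> by (simp add: algebra_simps)
    have 2: "(1 - binomial_tail p k (Suc t)) * (u - real \<theta> + 1)\<^sup>2 \<le> ?f u"
      using Suc.IH[of "Suc t" u] Suc.prems \<open>\<theta> = Suc t\<close> by simp
    have "(1 - binomial_tail p (Suc k) \<theta>) * (u - real \<theta> + 1)\<^sup>2
      = p * ((1 - binomial_tail p k t) * (u - real \<theta> + 1)\<^sup>2)
        + (1 - p) * ((1 - binomial_tail p k (Suc t)) * (u - real \<theta> + 1)\<^sup>2)"
      unfolding \<open>\<theta> = Suc t\<close> by (simp add: algebra_simps)
    also have "\<dots> \<le> p * ?f (u - 1) + (1 - p) * ?f u"
      using p 1 2 by (intro add_mono mult_left_mono) auto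
    also have "\<dots> = real (Suc k) * p * (1 - p) + (real (Suc k) * p - u)\<^sup>2"
      by (simp add: algebra_simps power2_eq_square)
    finally show ?thesis .
  qed
qed

text \<open>Markov's inequality for exp (h S), unfolded as an induction over the trials.\<close>

lemma binomial_tail_chernoff:
  assumes p: "0 \<le> p" "p \<le> 1" and h: "0 \<le> h"
  shows "binomial_tail p k \<theta> \<le> exp (- h * real \<theta>) * (1 - p + p * exp h) ^ k"
proof (induction k arbitrary: \<theta>)
  case 0
  show ?case by (cases \<theta>) auto
next
  case (Suc k)
  have ge1: "1 \<le> 1 - p + p * exp h"
    using p h mult_left_mono[of 1 "exp h" p] by simp
  show ?case
  proof (cases \<theta>)
    case 0
    then show ?thesis using one_le_power[OF ge1, of "Suc k"] by simp
  next
    case (Suc t)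
    let ?B = "(1 - p + p * exp h) ^ k"
    have "binomial_tail p (Suc k) \<theta> \<le> p * (exp (- h * real t) * ?B) + (1 - p) * (exp (- h * real (Suc t)) * ?B)"
      unfolding \<open>\<theta> = Suc t\<close> binomial_tail.simps by (intro add_mono mult_left_mono Suc.IH) (use p in auto)
    also have "exp (- h * real t) = exp (- h * real (Suc t)) * exp h"
      by (simp add: exp_add[symmetric] algebra_simps)
    finally show ?thesis using \<open>\<theta> = Suc t\<close> by (simp add: algebra_simps)
  qed
qed

text \<open>The threshold lies at least g/4 below p, and 16 <= k g^2 says k (g/4)^2 >= 1, so
  Chebyshev's bound on failure is at most p (1 - p) <= 1 - c.\<close>

lemma binomial_tail_amplification_complete:
  assumes p: "c \<le> p" "p \<le> 1" and c: "0 < g" "0 \<le> c - g / 4"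
    and k: "16 \<le> real k * g\<^sup>2" and c1: "c \<le> 1"
  shows "c \<le> binomial_tail p k (nat \<lceil>(c - g / 4) * real k\<rceil>)"
proof -
  let ?\<tau> = "c - g / 4"
  let ?\<theta> = "nat \<lceil>?\<tau> * real k\<rceil>"
  have k0: "real k > 0" using k by (cases k) auto
  have p0: "p \<ge> 0" using p c by linarith
  \<comment> \<open>Rounding up costs at most 1; the summand 1 in Chebyshev's inequality pays for
    it.\<close>
  have th: "real ?\<theta> \<le> ?\<tau> * real k + 1"
    using c by (simp add: of_nat_nat)
  let ?u = "real k * p"
  have gap: "real k * (g / 4) \<le> ?u - ?\<tau> * real k"
    using p k0 mult_left_mono[of c p "real k"] by (simp add: algebra_simps)
  have pos: "0 < real k * (g / 4)" using k0 c by simp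
  have "?u > real ?\<theta> - 1" using gap pos th by linarith
  from binomial_tail_chebyshev[OF p0 p(2) this, of k]
  have ch: "(1 - binomial_tail p k ?\<theta>) * (?u - real ?\<theta> + 1)\<^sup>2 \<le> real k * p * (1 - p)" by simp
  show ?thesis
  proof (rule ccontr)
    assume "\<not> c \<le> binomial_tail p k ?\<theta>"
    then have lt: "1 - c < 1 - binomial_tail p k ?\<theta>" by simp
    have sq: "(real k * (g / 4))\<^sup>2 \<le> (?u - real ?\<theta> + 1)\<^sup>2"
      using gap pos th by (intro power_mono) linarith+
    have "real k \<le> (real k * (g / 4))\<^sup>2"
    proof -
      have "real k * 16 \<le> real k * (real k * g\<^sup>2)" using k k0 by (intro mult_left_mono) auto
      then show ?thesis by (simp add: power2_eq_square field_simps)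
    qed
    then have k2: "real k \<le> (?u - real ?\<theta> + 1)\<^sup>2" using sq by linarith
    have "(1 - c) * real k < (1 - binomial_tail p k ?\<theta>) * (?u - real ?\<theta> + 1)\<^sup>2"
    proof -
      have "(1 - c) * real k < (1 - binomial_tail p k ?\<theta>) * real k" using lt k0 by simp
      also have "\<dots> \<le> (1 - binomial_tail p k ?\<theta>) * (?u - real ?\<theta> + 1)\<^sup>2"
        using k2 lt c1 by (intro mult_left_mono) auto
      finally show ?thesis .
    qed
    also note ch
    also have "real k * p * (1 - p) \<le> real k * 1 * (1 - c)"
      using p p0 k0 by (intro mult_mono) auto
    finally show False by (simp add: algebra_simps)
  qed
qed

lemma exp_le_quadratic:
  fixes h :: real
  assumes "0 \<le> h" "h \<le> 1"
  shows "exp h \<le> 1 + h + h\<^sup>2"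
  using exp_bound[of h] assms by simp

text \<open>The threshold s + 3g/4 lies g/2 above the largest admissible p. Each trial then
  contributes an exponent at most - g^2/16, and k trials bring the bound down to s.\<close>

lemma binomial_tail_amplification_sound:
  assumes p: "0 \<le> p" "p \<le> 1" "p \<le> s + g / 4" and g: "0 < g" "g \<le> 1" and c: "c = s + g" and s: "0 < s"
    and k: "16 * ln (1 / s) \<le> real k * g\<^sup>2"
  shows "binomial_tail p k (nat \<lceil>(c - g / 4) * real k\<rceil>) \<le> s"
proof -
  let ?\<tau> = "c - g / 4"
  let ?\<theta> = "nat \<lceil>?\<tau> * real k\<rceil>"
  \<comment> \<open>The exponent per trial is at most h (h - g/2), which is least at h =
    g/4.\<close>
  define h where "h = g / 4"
  have h: "0 \<le> h" "h \<le> 1" using g by (auto simp: h_def)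
  have tau: "?\<tau> \<ge> 0" using c s g by simp
  have th: "?\<tau> * real k \<le> real ?\<theta>"
    using tau by (simp add: of_nat_nat)
  have "binomial_tail p k ?\<theta> \<le> exp (- h * real ?\<theta>) * (1 - p + p * exp h) ^ k"
    by (rule binomial_tail_chernoff) (use p h in auto)
  also have "\<dots> \<le> exp (- h * (?\<tau> * real k)) * (exp (p * (h + h\<^sup>2))) ^ k"
  proof (intro mult_mono power_mono)
    show "exp (- h * real ?\<theta>) \<le> exp (- h * (?\<tau> * real k))"
      using th h by (simp add: mult_left_mono)
    have "1 - p + p * exp h \<le> 1 + p * (h + h\<^sup>2)"
      using mult_left_mono[OF exp_le_quadratic[OF h] p(1)] by (simp add: algebra_simps)
    also have "\<dots> \<le> exp (p * (h + h\<^sup>2))" by (rule exp_ge_add_one_self)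
    finally show "1 - p + p * exp h \<le> exp (p * (h + h\<^sup>2))" .
    have "1 \<le> exp h" using h by simp
    then show "0 \<le> 1 - p + p * exp h" using p by simp
    then show "0 \<le> (1 - p + p * exp h) ^ k" by simp
  qed auto
  also have "\<dots> = exp (real k * (- h * ?\<tau> + p * h + p * h\<^sup>2))"
    by (simp add: exp_of_nat_mult[symmetric] exp_add[symmetric] algebra_simps)
  also have "\<dots> \<le> exp (real k * (- (g\<^sup>2 / 16)))"
  proof -
    have "p * h \<le> (s + g / 4) * h" using p h by (intro mult_right_mono) auto
    moreover have "p * h\<^sup>2 \<le> 1 * h\<^sup>2" using p by (intro mult_right_mono) auto
    ultimately have "- h * ?\<tau> + p * h + p * h\<^sup>2 \<le> - h * ?\<tau> + (s + g / 4) * h + h\<^sup>2" by linarith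
    also have "\<dots> = - (g\<^sup>2 / 16)" unfolding c h_def by (simp add: field_simps power2_eq_square)
    finally show ?thesis unfolding exp_le_cancel_iff by (intro mult_left_mono) auto
  qed
  also have "\<dots> \<le> exp (- ln (1 / s))" using k by simp
  also have "\<dots> = s" using s by (simp add: ln_div)
  finally show ?thesis .
qed

text \<open>Here \<mu> is the weight missing from the dominant rank-one part. With y = n \<mu>, the
  t n swap tests pass with probability at most exp (- t y / 2), and y exp (- t y / 2) <= 2 / (t e)
  for every y, so both small and large excess are covered.\<close>

lemma swap_damping:
  fixes g s \<mu> :: real
  assumes mu: "0 \<le> \<mu>" "\<mu> \<le> 1" and g: "0 < g" and t: "3 \<le> real t * g" and n: "0 < n"
    and q: "0 \<le> q" "q \<le> s + real n * \<mu>" and s: "0 < s"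
  shows "q * (1 - \<mu> / 2) ^ (t * n) \<le> s + g / 4"
proof -
  define y where "y = real n * \<mu>"
  define z where "z = real t * y / 2"
  have y0: "y \<ge> 0" and t0: "real t > 0" using mu t g by (auto simp: y_def intro: Nat.gr0I)
  have e: "(1 - \<mu> / 2) ^ (t * n) \<le> exp (- z)"
  proof -
    have "1 - \<mu> / 2 \<le> exp (- (\<mu> / 2))" using exp_ge_add_one_self[of "- (\<mu> / 2)"] by simp
    then have "(1 - \<mu> / 2) ^ (t * n) \<le> exp (- (\<mu> / 2)) ^ (t * n)"
      using mu by (intro power_mono) auto
    also have "\<dots> = exp (- z)"
      by (simp add: exp_of_nat_mult[symmetric] z_def y_def algebra_simps)
    finally show ?thesis .
  qed
  have z0: "z \<ge> 0" using y0 t0 by (simp add: z_def)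
  have ze: "z * exp (- z) \<le> 3 / 8"
  proof -
    \<comment> \<open>8/3 = 1 + 1 + 1/2 + 1/6. It yields the clean bound 2 * 3/8 = 3/4 <= t g / 4
      below.\<close>
    have e1: "exp (1::real) \<ge> 8 / 3"
    proof -
      have "(\<Sum>k<4. (1::real) ^ k / fact k) \<le> exp 1"
        by (intro sum_le_suminf[THEN order_trans[OF _ eq_refl]])
           (auto simp: exp_def scaleR_conv_of_real field_simps summable_exp intro!: summable_exp[of 1, simplified])
      then show ?thesis by (simp add: eval_nat_numeral)
    qed
    have "z \<le> exp (z - 1)" using exp_ge_add_one_self[of "z - 1"] by simp
    then have "z * exp (- z) \<le> exp (z - 1) * exp (- z)" by (intro mult_right_mono) auto
    also have "\<dots> = 1 / exp 1" by (simp add: exp_diff exp_minus divide_simps)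
    also have "\<dots> \<le> 1 / (8 / 3)" using e1 by (intro divide_left_mono) auto
    finally show ?thesis by simp
  qed
  have ye: "y * exp (- z) \<le> g / 4"
  proof -
    have "real t * (y * exp (- z)) = 2 * (z * exp (- z))" by (simp add: z_def)
    also have "\<dots> \<le> 3 / 4" using ze by simp
    also have "\<dots> \<le> real t * (g / 4)" using t by simp
    finally show ?thesis using t0 by simp
  qed
  have "q * (1 - \<mu> / 2) ^ (t * n) \<le> (s + y) * exp (- z)"
    using q e mu s y0 by (intro mult_mono) (auto simp: y_def)
  also have "\<dots> = s * exp (- z) + y * exp (- z)" by (simp add: algebra_simps)
  also have "\<dots> \<le> s * 1 + g / 4"
    using s z0 by (intro add_mono ye mult_left_mono) auto
  finally show ?thesis by simp
qed

text \<open>The summand 10 makes the logarithm L at least 1, so rounding up gives k <= 17 L / g^2;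
  also 1 + 2t <= 3 + 6/g <= 9/g. The product 153 L / g^3 is at most 200 L / g^4 as g <= 1.\<close>

lemma copies_budget:
  fixes g s :: real
  assumes g: "0 < g" "g \<le> 1" and s: "0 < s"
  defines "k \<equiv> nat \<lceil>16 * ln (1 / s + 10) / g\<^sup>2\<rceil>" and "t \<equiv> nat \<lceil>3 / g\<rceil>"
  shows "k * (n + 2 * (t * n)) \<le> nat \<lceil>200 * ln (1 / s + 10) * g powr (-4)\<rceil> * n"
    and "16 \<le> real k * g\<^sup>2" and "16 * ln (1 / s) \<le> real k * g\<^sup>2" and "3 \<le> real t * g"
proof -
  define L where "L = ln (1 / s + 10)"
  have L1: "L \<ge> 1"
  proof -
    have "exp 1 \<le> 1 / s + 10" using exp_le s by (simp add: add_increasing)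
    then have "ln (exp 1) \<le> L" unfolding L_def using s by (subst ln_le_cancel_iff) (auto intro: add_pos_pos)
    then show ?thesis by simp
  qed
  have g2: "g\<^sup>2 > 0" using g by simp
  have kge: "16 * L / g\<^sup>2 \<le> real k" unfolding k_def L_def[symmetric] using L1 g by (simp add: of_nat_nat)
  then have kge': "16 * L \<le> real k * g\<^sup>2" using g2 by (simp add: field_simps)
  show "16 \<le> real k * g\<^sup>2" using kge' L1 by linarith
  have "ln (1 / s) \<le> L" unfolding L_def using s by (subst ln_le_cancel_iff) (auto intro: add_pos_pos)
  then show "16 * ln (1 / s) \<le> real k * g\<^sup>2" using kge' by linarith
  have "3 / g \<le> real t" unfolding t_def using g by (simp add: of_nat_nat)
  then show "3 \<le> real t * g" using g by (simp add: field_simps)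
  have gi: "1 \<le> 1 / g" using g by simp
  have tle: "real t \<le> 3 / g + 1" unfolding t_def using g by (simp add: of_nat_nat)
  have tt: "1 + 2 * real t \<le> 9 / g" using tle gi by (simp add: field_simps)
  have gi2: "1 \<le> 1 / g\<^sup>2" using g by (simp add: power_le_one)
  have "real k \<le> 16 * L / g\<^sup>2 + 1" unfolding k_def L_def[symmetric] using L1 g by (simp add: of_nat_nat)
  also have "\<dots> = 16 * (L * (1 / g\<^sup>2)) + 1" by simp
  also have "\<dots> \<le> 17 * (L * (1 / g\<^sup>2))"
    using mult_mono[OF L1 gi2] L1 by linarith
  finally have kk: "real k \<le> 17 * L * (1 / g\<^sup>2)" by (simp only: mult.assoc)
  have "real (k * (1 + 2 * t)) \<le> 17 * L * (1 / g\<^sup>2) * (9 / g)"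
    unfolding of_nat_mult using kk tt L1 by (intro mult_mono) auto
  also have "\<dots> = 153 * L * (1 / g ^ 3)" by (simp add: field_simps eval_nat_numeral)
  also have "\<dots> \<le> 200 * L * (1 / g ^ 4)"
  proof (intro mult_mono)
    have "g ^ 4 \<le> g ^ 3" using g by (intro power_decreasing) auto
    then show "1 / g ^ 3 \<le> 1 / g ^ 4" using g by (intro divide_left_mono) auto
  qed (use L1 g in auto)
  also have "1 / g ^ 4 = g powr (-4)" using g powr_numeral[of g "Num.Bit0 (Num.Bit0 Num.One)"] by (simp only: powr_minus_divide)
  finally have "real (k * (1 + 2 * t)) \<le> 200 * L * g powr (-4)" .
  then have "k * (1 + 2 * t) \<le> nat \<lceil>200 * L * g powr (-4)\<rceil>" by linarith
  then have "k * (1 + 2 * t) * n \<le> nat \<lceil>200 * L * g powr (-4)\<rceil> * n" by simp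
  then show "k * (n + 2 * (t * n)) \<le> nat \<lceil>200 * ln (1 / s + 10) * g powr (-4)\<rceil> * n"
    unfolding L_def by (simp add: algebra_simps)
qed

lemma effect_prob:
  assumes T: "is_effect (copies_idx d n) T" and \<rho>: "density_on (bip_idx d) \<rho>"
  defines "p \<equiv> tr_prod (copies_idx d n) T (tensor_power n \<rho>)"
  shows "0 \<le> Re p" "Re p \<le> 1" "p = of_real (Re p)"
proof -
  have psd: "psd_on (copies_idx d n) (tensor_power n \<rho>)"
    unfolding copies_idx_eq using \<rho> by (intro psd_tensor_power finite_bip_idx) (simp add: density_on_def)
  have T1: "psd_on (copies_idx d n) T" "psd_on (copies_idx d n) (\<lambda>i j. id_op (copies_idx d n) i j - T i j)"
    using T by (auto simp: is_effect_def)
  note t = tr_prod_psd[OF finite_copies_idx T1(1) psd, folded p_def]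
  show "0 \<le> Re p" "p = of_real (Re p)" using t by (simp_all add: complex_eq_iff)
  have "tr_prod (copies_idx d n) (\<lambda>i j. id_op (copies_idx d n) i j - T i j) (tensor_power n \<rho>) = 1 - p"
    using \<rho> by (simp add: tr_prod_diff_left tr_prod_copies_id density_on_def p_def)
  then show "Re p \<le> 1" using tr_prod_psd(2)[OF finite_copies_idx T1(2) psd] by simp
qed

text \<open>Alice counts accepting blocks. One measurement of Bob serves all thresholds: after the
  first block she goes on with \<theta> - 1 or \<theta> according to a result that Bob does not
  know.\<close>

lemma threshold_test:
  assumes B1: "bob_povm d N K1 B1" and E: "aligned d N K1 B1 E"
  shows "\<exists>K B T. bob_povm d (k * N) K B \<and> (\<forall>\<theta>. aligned d (k * N) K B (T \<theta>)) \<and>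
     (\<forall>\<rho> \<theta>. density_on (bip_idx d) \<rho> \<longrightarrow>
       tr_prod (copies_idx d (k * N)) (T \<theta>) (tensor_power (k * N) \<rho>)
         = of_real (binomial_tail (Re (tr_prod (copies_idx d N) E (tensor_power N \<rho>))) k \<theta>))"
proof (induction k)
  case 0
  let ?T = "\<lambda>\<theta>::nat. if \<theta> = 0 then id_op (copies_idx d 0) else (\<lambda>_ _. 0)"
  have "tr_prod (copies_idx d 0) (?T \<theta>) (tensor_power 0 \<rho>) = of_real (binomial_tail p 0 \<theta>)"
    if "density_on (bip_idx d) \<rho>" for \<rho> \<theta> p
    using that tr_prod_copies_id[of d \<rho> 0] by (cases \<theta>) (auto simp: density_on_def tr_prod_zero)
  then show ?case
    using bob_povm_trivial[of d 0] aligned_const[OF bob_povm_trivial[of d 0]]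
    by (intro exI[of _ "{0}"] exI[of _ "\<lambda>_. id_op (party_idx d 0)"] exI[of _ ?T]) auto
next
  case (Suc k)
  then obtain K2 B2 T2 where B2: "bob_povm d (k * N) K2 B2" and T2: "\<And>\<theta>. aligned d (k * N) K2 B2 (T2 \<theta>)"
    and tr2: "\<And>\<rho> \<theta>. density_on (bip_idx d) \<rho> \<Longrightarrow>
       tr_prod (copies_idx d (k * N)) (T2 \<theta>) (tensor_power (k * N) \<rho>)
         = of_real (binomial_tail (Re (tr_prod (copies_idx d N) E (tensor_power N \<rho>))) k \<theta>)"
    by blast
  obtain K B where B: "bob_povm d (N + k * N) K B"
    and al: "\<And>F G. aligned d (k * N) K2 B2 F \<Longrightarrow> aligned d (k * N) K2 B2 G \<Longrightarrow>
      aligned d (N + k * N) K B (branch (bip_idx d) N E F G)"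
    using aligned_branch[OF B1 E B2] by blast
  \<comment> \<open>A threshold already reached accepts at once, matching
    \<open>binomial_tail\<close> at 0.\<close>
  define T where "T \<theta> = (case \<theta> of 0 \<Rightarrow> id_op (copies_idx d (N + k * N))
      | Suc \<theta>' \<Rightarrow> branch (bip_idx d) N E (T2 \<theta>') (T2 \<theta>))" for \<theta>
  have "aligned d (N + k * N) K B (T \<theta>)" for \<theta>
    by (cases \<theta>) (auto simp: T_def intro!: al T2 aligned_const(2)[OF B])
  moreover have "tr_prod (copies_idx d (N + k * N)) (T \<theta>) (tensor_power (N + k * N) \<rho>)
      = of_real (binomial_tail (Re (tr_prod (copies_idx d N) E (tensor_power N \<rho>))) (Suc k) \<theta>)"
    if \<rho>: "density_on (bip_idx d) \<rho>" for \<rho> \<theta>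
  proof (cases \<theta>)
    case 0
    then show ?thesis using \<rho> tr_prod_copies_id by (simp add: T_def density_on_def)
  next
    case (Suc \<theta>')
    have tr1: "trace_on (bip_idx d) \<rho> = 1" using \<rho> by (simp add: density_on_def)
    have p: "tr_prod (copies_idx d N) E (tensor_power N \<rho>)
        = of_real (Re (tr_prod (copies_idx d N) E (tensor_power N \<rho>)))"
      by (rule effect_prob(3)[OF aligned_effect[OF B1 E] \<rho>])
    show ?thesis
      unfolding Suc T_def nat.case tr_prod_copies_branch[OF tr1] tr2[OF \<rho>] binomial_tail.simps
        of_real_add of_real_mult of_real_diff of_real_1 p[symmetric] ..
  qed
  ultimately show ?case using B unfolding mult_Suc by blast
qed

section \<open>Mixed states\<close>

lemma cauchy_schwarz_complex:
  fixes u g :: "'k \<Rightarrow> complex"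
  shows "(cmod (\<Sum>k\<in>I. u k * cnj (g k)))\<^sup>2 \<le> (\<Sum>k\<in>I. (cmod (u k))\<^sup>2) * (\<Sum>k\<in>I. (cmod (g k))\<^sup>2)"
proof -
  have "cmod (\<Sum>k\<in>I. u k * cnj (g k)) \<le> (\<Sum>k\<in>I. cmod (u k) * cmod (g k))"
    by (rule sum_norm_le) (simp add: norm_mult)
  then have "(cmod (\<Sum>k\<in>I. u k * cnj (g k)))\<^sup>2 \<le> (\<Sum>k\<in>I. cmod (u k) * cmod (g k))\<^sup>2"
    by (intro power_mono) auto
  also have "\<dots> \<le> (\<Sum>k\<in>I. (cmod (u k))\<^sup>2) * (\<Sum>k\<in>I. (cmod (g k))\<^sup>2)"
    by (rule Cauchy_Schwarz_ineq_sum)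
  finally show ?thesis .
qed

text \<open>A suitable column of \<open>\<rho>\<close>, rescaled, plays the role of a top eigenvector: averaging over the
  columns with weights \<open>\<rho> a a\<close> shows that one of them has squared norm at least the purity.\<close>

lemma dominant_rank_one_part:
  assumes fin: "finite S" and \<rho>: "density_on S \<rho>"
  obtains \<psi> \<sigma> where "\<And>i. i \<notin> S \<Longrightarrow> \<psi> i = 0" "psd_on S \<sigma>"
    "\<And>i j. \<rho> i j = rank_one \<psi> i j + \<sigma> i j"
    "Re (tr_prod S \<rho> \<rho>) \<le> Re (trace_on S (rank_one \<psi>))" "Re (trace_on S (rank_one \<psi>)) \<le> 1"
    "trace_on S (rank_one \<psi>) = of_real (Re (trace_on S (rank_one \<psi>)))"
    "0 \<le> Re (trace_on S (rank_one \<psi>))"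
proof -
  have sup: "supported_on S \<rho>" and psd: "psd_on S \<rho>" and tr: "trace_on S \<rho> = 1"
    using \<rho> by (auto simp: density_on_def)
  have herm: "\<rho> j i = cnj (\<rho> i j)" if "i \<in> S" "j \<in> S" for i j
    using psd_on_hermitian[OF fin psd] that unfolding hermitian_on_def by blast
  obtain G where G: "\<And>i j. i \<in> S \<Longrightarrow> j \<in> S \<Longrightarrow> \<rho> i j = (\<Sum>k\<in>S. G i k * cnj (G j k))"
    using psd_on_gram[OF fin psd] by blast
  \<comment> \<open>r a is the diagonal entry of \<rho>, C a the squared norm of its column a, and p
    the purity.\<close>
  define r where "r a = (\<Sum>k\<in>S. (cmod (G a k))\<^sup>2)" for a
  define C where "C a = (\<Sum>j\<in>S. (cmod (\<rho> j a))\<^sup>2)" for a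
  define p where "p = (\<Sum>a\<in>S. C a)"
  have r: "\<rho> a a = of_real (r a)" if "a \<in> S" for a
    unfolding G[OF that that] r_def of_real_sum complex_norm_square ..
  have r0: "r a \<ge> 0" for a by (simp add: r_def sum_nonneg)
  have sumr: "(\<Sum>a\<in>S. r a) = 1"
  proof -
    have "of_real (\<Sum>a\<in>S. r a) = trace_on S \<rho>" using r by (simp add: trace_on_def)
    then show ?thesis unfolding tr by (metis of_real_eq_1_iff)
  qed
  \<comment> \<open>A zero on the diagonal of a positive operator kills its column; such columns
    cannot be rescaled and must not contribute to the average.\<close>
  have C_zero: "C a = 0" if "a \<in> S" "r a = 0" for a
  proof -
    have "\<rho> j a = 0" if "j \<in> S" for j
      using cauchy_schwarz_complex[of "G j" "G a" S] \<open>r a = 0\<close> G[OF that \<open>a \<in> S\<close>]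
      by (simp add: r_def[symmetric])
    then show ?thesis by (simp add: C_def)
  qed
  have pur: "tr_prod S \<rho> \<rho> = of_real p"
  proof -
    have "tr_prod S \<rho> \<rho> = (\<Sum>x\<in>S. \<Sum>y\<in>S. of_real ((cmod (\<rho> y x))\<^sup>2))"
      unfolding tr_prod_def complex_norm_square
    proof (intro sum.cong refl)
      fix x y assume "x \<in> S" "y \<in> S"
      then have "\<rho> x y = cnj (\<rho> y x)" by (intro herm)
      then show "\<rho> x y * \<rho> y x = \<rho> y x * cnj (\<rho> y x)" by (subst \<open>\<rho> x y = _\<close>) (rule mult.commute)
    qed
    then show ?thesis by (simp add: p_def C_def)
  qed
  \<comment> \<open>The weights r a sum to 1 and the C a sum to p, so C a cannot stay below p r a
    wherever r a > 0.\<close>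
  have "\<exists>a\<in>S. 0 < r a \<and> p * r a \<le> C a"
  proof (rule ccontr)
    assume neg: "\<not> ?thesis"
    obtain a0 where a0: "a0 \<in> S" "r a0 \<noteq> 0"
      using sumr by (metis sum.neutral zero_neq_one)
    have "(\<Sum>a\<in>S. C a) < (\<Sum>a\<in>S. p * r a)"
    proof (rule sum_strict_mono_ex1[OF fin])
      show "\<forall>a\<in>S. C a \<le> p * r a"
        using neg C_zero r0 by (metis less_eq_real_def mult_zero_right not_le)
      show "\<exists>a\<in>S. C a < p * r a"
        using neg a0 r0[of a0] by (intro bexI[of _ a0]) (auto simp: not_le)
    qed
    then show False by (simp add: p_def[symmetric] sum_distrib_left[symmetric] sumr)
  qed
  then obtain a where a: "a \<in> S" "0 < r a" "p * r a \<le> C a" by blast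
  \<comment> \<open>Its squared norm is C a / r a >= p, and subtracting it from \<rho> is one Schur
    complement step at the diagonal entry a.\<close>
  define \<psi> where "\<psi> i = \<rho> i a / of_real (sqrt (r a))" for i
  define \<sigma> where "\<sigma> i j = \<rho> i j - rank_one \<psi> i j" for i j
  have rk: "rank_one \<psi> i j = \<rho> i a * cnj (\<rho> j a) / of_real (r a)" for i j
  proof -
    have "complex_of_real (sqrt (r a)) * complex_of_real (sqrt (r a)) = of_real (r a)"
      using a(2) by (simp only: of_real_mult[symmetric] real_sqrt_mult_self) simp
    then show ?thesis by (simp add: rank_one_def \<psi>_def)
  qed
  have trk: "trace_on S (rank_one \<psi>) = of_real (C a / r a)"
  proof -
    have "trace_on S (rank_one \<psi>) = (\<Sum>i\<in>S. of_real ((cmod (\<rho> i a))\<^sup>2)) / of_real (r a)"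
      unfolding trace_on_def rk complex_norm_square sum_divide_distrib ..
    then show ?thesis by (simp add: C_def)
  qed
  have psd\<sigma>: "psd_on S \<sigma>"
    unfolding psd_on_def
  proof (intro allI)
    fix v :: "'a \<Rightarrow> complex"
    define u where "u k = (\<Sum>i\<in>S. cnj (v i) * G i k)" for k
    define U where "U = (\<Sum>k\<in>S. (cmod (u k))\<^sup>2)"
    define w where "w = (\<Sum>k\<in>S. u k * cnj (G a k))"
    have "(\<Sum>i\<in>S. \<Sum>j\<in>S. cnj (v i) * \<rho> i j * v j) = of_real U"
    proof -
      have "(\<Sum>i\<in>S. \<Sum>j\<in>S. cnj (v i) * \<rho> i j * v j)
          = (\<Sum>i\<in>S. \<Sum>j\<in>S. \<Sum>k\<in>S. (cnj (v i) * G i k) * cnj (cnj (v j) * G j k))"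
        using G by (intro sum.cong refl) (simp add: sum_distrib_left sum_distrib_right mult_ac)
      also have "\<dots> = (\<Sum>i\<in>S. \<Sum>k\<in>S. \<Sum>j\<in>S. (cnj (v i) * G i k) * cnj (cnj (v j) * G j k))"
        by (intro sum.cong refl sum.swap)
      also have "\<dots> = (\<Sum>k\<in>S. \<Sum>i\<in>S. \<Sum>j\<in>S. (cnj (v i) * G i k) * cnj (cnj (v j) * G j k))"
        by (rule sum.swap)
      also have "\<dots> = (\<Sum>k\<in>S. u k * cnj (u k))"
        unfolding u_def cnj_sum sum_product ..
      finally show ?thesis unfolding U_def of_real_sum complex_norm_square .
    qed
    moreover have "(\<Sum>i\<in>S. \<Sum>j\<in>S. cnj (v i) * rank_one \<psi> i j * v j) = of_real ((cmod w)\<^sup>2 / r a)"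
    proof -
      have w: "w = (\<Sum>i\<in>S. cnj (v i) * \<rho> i a)"
      proof -
        have "w = (\<Sum>k\<in>S. \<Sum>i\<in>S. cnj (v i) * (G i k * cnj (G a k)))"
          by (simp add: w_def u_def sum_distrib_right mult.assoc)
        also have "\<dots> = (\<Sum>i\<in>S. \<Sum>k\<in>S. cnj (v i) * (G i k * cnj (G a k)))" by (rule sum.swap)
        finally show ?thesis using G a(1) by (simp add: sum_distrib_left)
      qed
      have "(\<Sum>i\<in>S. \<Sum>j\<in>S. cnj (v i) * rank_one \<psi> i j * v j)
          = (\<Sum>i\<in>S. \<Sum>j\<in>S. (cnj (v i) * \<rho> i a) * cnj (cnj (v j) * \<rho> j a)) / of_real (r a)"
        unfolding rk sum_divide_distrib by (intro sum.cong refl) (simp add: mult_ac)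
      also have "\<dots> = w * cnj w / of_real (r a)"
        unfolding w cnj_sum sum_product ..
      finally show ?thesis by (simp only: of_real_divide complex_norm_square)
    qed
    ultimately have q: "(\<Sum>i\<in>S. \<Sum>j\<in>S. cnj (v i) * \<sigma> i j * v j) = of_real (U - (cmod w)\<^sup>2 / r a)"
      by (simp add: \<sigma>_def algebra_simps sum_subtractf)
    \<comment> \<open>Cauchy-Schwarz between the Gram vectors of v and of the basis vector at a:
      positivity of the Schur complement.\<close>
    have "(cmod w)\<^sup>2 \<le> U * r a"
      unfolding w_def U_def r_def by (rule cauchy_schwarz_complex)
    then have "(cmod w)\<^sup>2 / r a \<le> U" using a(2) by (simp add: field_simps)
    then show "Im (\<Sum>i\<in>S. \<Sum>j\<in>S. cnj (v i) * \<sigma> i j * v j) = 0 \<and>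
        0 \<le> Re (\<Sum>i\<in>S. \<Sum>j\<in>S. cnj (v i) * \<sigma> i j * v j)"
      unfolding q by simp
  qed
  show thesis
  proof (rule that[of \<psi> \<sigma>])
    show "\<psi> i = 0" if "i \<notin> S" for i using sup that by (simp add: \<psi>_def supported_on_def)
    show "psd_on S \<sigma>" by (rule psd\<sigma>)
    show "\<rho> i j = rank_one \<psi> i j + \<sigma> i j" for i j by (simp add: \<sigma>_def)
    show "Re (tr_prod S \<rho> \<rho>) \<le> Re (trace_on S (rank_one \<psi>))"
      using a by (simp add: trk pur field_simps)
    have "trace_on S \<sigma> = 1 - trace_on S (rank_one \<psi>)"
      using tr by (simp add: \<sigma>_def trace_on_def sum_subtractf)
    then show "Re (trace_on S (rank_one \<psi>)) \<le> 1" using trace_psd(2)[OF fin psd\<sigma>] by simp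
    show "trace_on S (rank_one \<psi>) = of_real (Re (trace_on S (rank_one \<psi>)))"
      unfolding trk by simp
    show "0 \<le> Re (trace_on S (rank_one \<psi>))"
      unfolding trk using a by (simp add: C_def sum_nonneg)
  qed
qed

lemma psd_conj_B:
  assumes "psd_on (bip_idx d) \<sigma>"
  shows "psd_on (bip_idx d) (conj_B d U \<sigma>)"
proof -
  obtain G where G: "\<And>i j. i \<in> bip_idx d \<Longrightarrow> j \<in> bip_idx d \<Longrightarrow> \<sigma> i j = (\<Sum>k\<in>bip_idx d. G i k * cnj (G j k))"
    using psd_on_gram[OF finite_bip_idx assms] by blast
  show ?thesis
  proof (rule psd_onI_gram[where L = "bip_idx d" and G = "\<lambda>(a, b) k. \<Sum>c<d. U b c * G (a, c) k"])
    fix x y assume "x \<in> bip_idx d" "y \<in> bip_idx d"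
    then obtain a b a' b' where xy: "x = (a, b)" "y = (a', b')" "a < d" "a' < d" by (auto simp: bip_idx_def)
    have "conj_B d U \<sigma> x y = (\<Sum>c<d. \<Sum>c'<d. \<Sum>k\<in>bip_idx d. (U b c * G (a, c) k) * cnj (U b' c' * G (a', c') k))"
      using G xy unfolding conj_B_def
      by (auto simp: bip_idx_def sum_distrib_left sum_distrib_right mult_ac intro!: sum.cong)
    also have "\<dots> = (\<Sum>c<d. \<Sum>k\<in>bip_idx d. \<Sum>c'<d. (U b c * G (a, c) k) * cnj (U b' c' * G (a', c') k))"
      by (intro sum.cong refl sum.swap)
    also have "\<dots> = (\<Sum>k\<in>bip_idx d. \<Sum>c<d. \<Sum>c'<d. (U b c * G (a, c) k) * cnj (U b' c' * G (a', c') k))"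
      by (rule sum.swap)
    also have "\<dots> = (\<Sum>k\<in>bip_idx d. (\<Sum>c<d. U b c * G (a, c) k) * cnj (\<Sum>c<d. U b' c * G (a', c) k))"
      unfolding cnj_sum sum_product ..
    finally show "conj_B d U \<sigma> x y = (\<Sum>k\<in>bip_idx d. (case x of (a, b) \<Rightarrow> \<lambda>k. \<Sum>c<d. U b c * G (a, c) k) k
        * cnj ((case y of (a, b) \<Rightarrow> \<lambda>k. \<Sum>c<d. U b c * G (a, c) k) k))"
      by (simp add: xy)
  qed
qed

lemma conj_B_add:
  assumes "\<And>i j. \<rho> i j = \<tau> i j + \<sigma> i j"
  shows "conj_B d U \<rho> i j = conj_B d U \<tau> i j + conj_B d U \<sigma> i j"
  unfolding conj_B_def assms by (simp add: case_prod_beta sum.distrib[symmetric] algebra_simps)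

lemma psd_rank_one: "psd_on S (rank_one \<psi>)"
  by (rule psd_onI_gram[where L = "{()}" and G = "\<lambda>i _. \<psi> i"]) (simp add: rank_one_def)

lemma tr_prod_mono_tensor_power:
  assumes T: "psd_on (copies_idx d n) T" and "psd_on (bip_idx d) \<tau>" "psd_on (bip_idx d) \<sigma>"
    and "\<And>i j. \<rho> i j = \<tau> i j + \<sigma> i j"
  shows "Re (tr_prod (copies_idx d n) T (tensor_power n \<tau>)) \<le> Re (tr_prod (copies_idx d n) T (tensor_power n \<rho>))"
proof -
  have "psd_on (copies_idx d n) (\<lambda>xs ys. tensor_power n \<rho> xs ys - tensor_power n \<tau> xs ys)"
    unfolding copies_idx_eq using assms by (intro psd_tensor_power_mono[OF finite_bip_idx, of d \<tau> \<sigma>])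
  from tr_prod_psd(2)[OF finite_copies_idx T this] show ?thesis
    unfolding tr_prod_diff_right by simp
qed

text \<open>Alice's test is controlled on rank-one operators only. For a no-state it is compared
  with the dominant rank-one part, and the t n swap tests suppress the resulting error, which grows
  with n.\<close>

lemma block_test:
  fixes d n t :: nat
  assumes property: "is_property d Pyes Pno" and inv: "unitarily_invariant_B d Pyes Pno"
    and pure: "\<forall>\<rho>\<in>Pyes. pure_state d \<rho>" and s: "0 < s" and g: "0 < g" and n: "0 < n"
    and t: "3 \<le> real t * g" and tester: "is_tester d n T0 Pyes Pno c s"
  shows "\<exists>K B E. bob_povm d (n + t * n * 2) K B \<and> aligned d (n + t * n * 2) K B E \<and>
    (\<forall>\<rho>\<in>Pyes. c \<le> Re (tr_prod (copies_idx d (n + t * n * 2)) E (tensor_power (n + t * n * 2) \<rho>))) \<and>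
    (\<forall>\<rho>\<in>Pno. Re (tr_prod (copies_idx d (n + t * n * 2)) E (tensor_power (n + t * n * 2) \<rho>)) \<le> s + g / 4)"
proof -
  let ?C = "copies_idx d n"
  have T0: "is_effect ?C T0" and yes: "\<And>\<rho>. \<rho> \<in> Pyes \<Longrightarrow> c \<le> Re (tr_prod ?C T0 (tensor_power n \<rho>))"
    and no: "\<And>\<rho>. \<rho> \<in> Pno \<Longrightarrow> Re (tr_prod ?C T0 (tensor_power n \<rho>)) \<le> s"
    using tester by (auto simp: is_tester_def)
  have dens: "density_on (bip_idx d) \<rho>" if "\<rho> \<in> Pyes \<union> Pno" for \<rho>
    using property that by (auto simp: is_property_def)
  obtain M where M: "is_effect (party_idx d n) M"
    and ge: "\<And>\<psi> c. (\<And>x. x \<notin> bip_idx d \<Longrightarrow> \<psi> x = 0) \<Longrightarrow>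
      (\<And>U. unitary_on d U \<Longrightarrow> c \<le> Re (tr_prod ?C T0 (tensor_power n (conj_B d U (rank_one \<psi>))))) \<Longrightarrow>
      c \<le> Re (tr_prod ?C (alice_op d n M) (tensor_power n (rank_one \<psi>)))"
    and le: "\<And>\<psi> s. (\<And>x. x \<notin> bip_idx d \<Longrightarrow> \<psi> x = 0) \<Longrightarrow>
      (\<And>U. unitary_on d U \<Longrightarrow> Re (tr_prod ?C T0 (tensor_power n (conj_B d U (rank_one \<psi>)))) \<le> s) \<Longrightarrow>
      Re (tr_prod ?C (alice_op d n M) (tensor_power n (rank_one \<psi>))) \<le> s"
    using alice_effect[OF T0] by blast
  let ?A = "alice_op d n M"
  have effA: "is_effect ?C ?A" by (rule aligned_effect[OF bob_povm_trivial aligned_alice[OF M]])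
  obtain K2 B2 T2 where B2: "bob_povm d (t * n * 2) K2 B2" and T2: "aligned d (t * n * 2) K2 B2 T2"
    and tr2: "\<And>\<rho>. trace_on (bip_idx d) \<rho> = 1 \<Longrightarrow>
       tr_prod (copies_idx d (t * n * 2)) T2 (tensor_power (t * n * 2) \<rho>)
         = ((1 + tr_prod (bip_idx d) \<rho> \<rho>) / 2) ^ (t * n)"
    using swap_tests[of d "t * n"] by blast
  obtain K B where B: "bob_povm d (n + t * n * 2) K B"
    and al: "\<And>F G. aligned d (t * n * 2) K2 B2 F \<Longrightarrow> aligned d (t * n * 2) K2 B2 G \<Longrightarrow>
      aligned d (n + t * n * 2) K B (branch (bip_idx d) n ?A F G)"
    using aligned_branch[OF bob_povm_trivial aligned_alice[OF M] B2] by blast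
  define E where "E = branch (bip_idx d) n ?A T2 (\<lambda>_ _. 0)"
  have E: "aligned d (n + t * n * 2) K B E"
    unfolding E_def by (intro al T2 aligned_const(1)[OF B2])
  have trE: "tr_prod (copies_idx d (n + t * n * 2)) E (tensor_power (n + t * n * 2) \<rho>)
      = tr_prod ?C ?A (tensor_power n \<rho>) * ((1 + tr_prod (bip_idx d) \<rho> \<rho>) / 2) ^ (t * n)"
    if "density_on (bip_idx d) \<rho>" for \<rho>
  proof -
    have tr1: "trace_on (bip_idx d) \<rho> = 1" using that by (simp add: density_on_def)
    show ?thesis unfolding E_def tr_prod_copies_branch[OF tr1] tr2[OF tr1] tr_prod_zero by simp
  qed
  have "c \<le> Re (tr_prod (copies_idx d (n + t * n * 2)) E (tensor_power (n + t * n * 2) \<rho>))"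
    if \<rho>: "\<rho> \<in> Pyes" for \<rho>
  proof -
    obtain v where v: "\<And>i. i \<notin> bip_idx d \<Longrightarrow> v i = 0" and \<rho>v: "\<rho> = rank_one v"
      using pure \<rho> unfolding pure_state_def rank_one_def by blast
    have tr1: "trace_on (bip_idx d) (rank_one v) = 1" using dens[of \<rho>] \<rho> \<rho>v by (simp add: density_on_def)
    have "tr_prod (bip_idx d) (rank_one v) (rank_one v) = trace_on (bip_idx d) (rank_one v) * trace_on (bip_idx d) (rank_one v)"
      unfolding tr_prod_def trace_on_def sum_product by (simp add: rank_one_def mult_ac)
    \<comment> \<open>Purity one: a yes-state passes every swap test with certainty.\<close>
    then have "tr_prod (bip_idx d) \<rho> \<rho> = 1" using tr1 \<rho>v by simp
    then have "tr_prod (copies_idx d (n + t * n * 2)) E (tensor_power (n + t * n * 2) \<rho>) = tr_prod ?C ?A (tensor_power n \<rho>)"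
      using trE dens \<rho> by simp
    moreover have "c \<le> Re (tr_prod ?C ?A (tensor_power n \<rho>))"
      unfolding \<rho>v
    proof (rule ge[OF v])
      fix U assume "unitary_on d U"
      then have "conj_B d U (rank_one v) \<in> Pyes"
        using inv \<rho> \<rho>v by (auto simp: unitarily_invariant_B_def)
      then show "c \<le> Re (tr_prod ?C T0 (tensor_power n (conj_B d U (rank_one v))))" by (rule yes)
    qed
    ultimately show ?thesis by simp
  qed
  moreover have "Re (tr_prod (copies_idx d (n + t * n * 2)) E (tensor_power (n + t * n * 2) \<rho>)) \<le> s + g / 4"
    if \<rho>: "\<rho> \<in> Pno" for \<rho>
  proof -
    have d\<rho>: "density_on (bip_idx d) \<rho>" using dens \<rho> by blast
    then have psd\<rho>: "psd_on (bip_idx d) \<rho>" and tr1: "trace_on (bip_idx d) \<rho> = 1" by (auto simp: density_on_def)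
    obtain \<psi> \<sigma> where \<psi>: "\<And>i. i \<notin> bip_idx d \<Longrightarrow> \<psi> i = 0" and \<sigma>: "psd_on (bip_idx d) \<sigma>"
      and dec: "\<And>i j. \<rho> i j = rank_one \<psi> i j + \<sigma> i j"
      and pur: "Re (tr_prod (bip_idx d) \<rho> \<rho>) \<le> Re (trace_on (bip_idx d) (rank_one \<psi>))"
      and l1: "Re (trace_on (bip_idx d) (rank_one \<psi>)) \<le> 1"
      and lr: "trace_on (bip_idx d) (rank_one \<psi>) = of_real (Re (trace_on (bip_idx d) (rank_one \<psi>)))"
      and l0: "0 \<le> Re (trace_on (bip_idx d) (rank_one \<psi>))"
      using dominant_rank_one_part[OF finite_bip_idx d\<rho>] by blast
    define l where "l = Re (trace_on (bip_idx d) (rank_one \<psi>))"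
    define q where "q = Re (tr_prod ?C ?A (tensor_power n \<rho>))"
    define x where "x = Re (tr_prod (bip_idx d) \<rho> \<rho>)"
    have xr: "tr_prod (bip_idx d) \<rho> \<rho> = of_real x" "0 \<le> x"
      using tr_prod_psd[OF finite_bip_idx psd\<rho> psd\<rho>] by (auto simp: x_def complex_eq_iff)
    have qr: "tr_prod ?C ?A (tensor_power n \<rho>) = of_real q" "0 \<le> q"
      using effect_prob[OF effA d\<rho>] by (auto simp: q_def)
    \<comment> \<open>\<rho> dominates \<open>rank_one \<psi>\<close>, and so it does after Bob's
      rotation and in tensor powers. Hence the bound s for the rotated no-state also bounds T0 on
      the rotated \<psi>, though \<psi> itself lies in no promise set.\<close>
    have A\<psi>: "Re (tr_prod ?C ?A (tensor_power n (rank_one \<psi>))) \<le> s"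
    proof (rule le[OF \<psi>])
      fix U assume "unitary_on d U"
      then have "conj_B d U \<rho> \<in> Pno" using inv \<rho> by (auto simp: unitarily_invariant_B_def)
      from no[OF this]
      show "Re (tr_prod ?C T0 (tensor_power n (conj_B d U (rank_one \<psi>)))) \<le> s"
        using T0 by (intro order_trans[OF tr_prod_mono_tensor_power[OF _ psd_conj_B psd_conj_B conj_B_add[OF dec]]]
          psd_rank_one \<sigma>) (auto simp: is_effect_def)
    qed
    \<comment> \<open>Dominance is used for the complementary effect: 1 - q >= l^n - s, and
      Bernoulli's inequality gives l^n >= 1 - n (1 - l).\<close>
    have "q \<le> s + real n * (1 - l)"
    proof -
      let ?A' = "\<lambda>i j. id_op ?C i j - ?A i j"
      have "Re (tr_prod ?C ?A' (tensor_power n (rank_one \<psi>))) \<le> Re (tr_prod ?C ?A' (tensor_power n \<rho>))"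
        using effA by (intro tr_prod_mono_tensor_power[OF _ psd_rank_one \<sigma> dec]) (auto simp: is_effect_def)
      also have "tr_prod ?C ?A' (tensor_power n \<rho>) = of_real (1 - q)"
        unfolding tr_prod_diff_left tr_prod_copies_id[OF tr1] qr by simp
      also have "tr_prod ?C ?A' (tensor_power n (rank_one \<psi>)) = of_real (l ^ n) - tr_prod ?C ?A (tensor_power n (rank_one \<psi>))"
        unfolding tr_prod_diff_left tr_prod_id[OF finite_copies_idx]
        unfolding copies_idx_eq trace_tensor_power by (subst lr) (simp add: l_def)
      finally have "l ^ n - s \<le> 1 - q" using A\<psi> by simp
      moreover have "1 + real n * (l - 1) \<le> (1 + (l - 1)) ^ n"
        using l0 by (intro Bernoulli_inequality) (simp add: l_def)
      ultimately show ?thesis by (simp add: algebra_simps)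
    qed
    then have damp: "q * (1 - (1 - l) / 2) ^ (t * n) \<le> s + g / 4"
      using l0 l1 g t n qr s by (intro swap_damping) (auto simp: l_def)
    have "tr_prod (copies_idx d (n + t * n * 2)) E (tensor_power (n + t * n * 2) \<rho>) = of_real (q * ((1 + x) / 2) ^ (t * n))"
      unfolding trE[OF d\<rho>] qr xr by simp
    moreover have "q * ((1 + x) / 2) ^ (t * n) \<le> q * (1 - (1 - l) / 2) ^ (t * n)"
      using pur xr(2) qr(2) by (intro mult_left_mono power_mono) (auto simp: x_def l_def field_simps)
    ultimately show ?thesis using damp by simp
  qed
  ultimately show ?thesis using B E by blast
qed

theorem theorem1p4:
  fixes d N0 :: nat and Pyes Pno :: "(nat \<times> nat) op set" and c s :: real
    and T0 :: "(nat \<times> nat) list op"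
  assumes "is_property d Pyes Pno"
    and "unitarily_invariant_B d Pyes Pno"
    and "\<forall>\<rho>\<in>Pyes. pure_state d \<rho>"
    and "0 < s" and "s < c" and "c \<le> 1"
    and "is_tester d N0 T0 Pyes Pno c s"
  shows "\<exists>N T. N \<le> nat \<lceil>200 * ln (1 / s + 10) * (c - s) powr (-4)\<rceil> * N0 \<and>
           is_tester d N T Pyes Pno c s \<and> oneway_LOCC_BA d N T"
proof -
  have dens: "density_on (bip_idx d) \<rho>" if "\<rho> \<in> Pyes \<union> Pno" for \<rho>
    using assms(1) that by (auto simp: is_property_def)
  then have tr1: "trace_on (bip_idx d) \<rho> = 1" if "\<rho> \<in> Pyes \<union> Pno" for \<rho>
    using that by (simp add: density_on_def)
  note triv = bob_povm_trivial[of d 0]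
  \<comment> \<open>With one promise set empty, a constant answer on zero copies suffices; N0 = 0 is
    possible there, while \<open>block_test\<close> wants a positive number of copies.\<close>
  consider "Pno = {}" | "Pyes = {}" | "Pyes \<noteq> {}" "Pno \<noteq> {}" by blast
  then show ?thesis
  proof cases
    case 1
    have "is_tester d 0 (id_op (copies_idx d 0)) Pyes Pno c s"
      using 1 assms(6) tr1 aligned_effect[OF triv aligned_const(2)[OF triv]]
      by (auto simp: is_tester_def tr_prod_copies_id)
    then show ?thesis
      using triv aligned_const(2)[OF triv] unfolding oneway_LOCC_BA_iff
      by (intro exI[of _ 0] exI[of _ "id_op (copies_idx d 0)"]) blast
  next
    case 2
    have "is_tester d 0 (\<lambda>_ _. 0) Pyes Pno c s"
      using 2 assms(4) aligned_effect[OF triv aligned_const(1)[OF triv]]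
      by (auto simp: is_tester_def tr_prod_zero)
    then show ?thesis
      using triv aligned_const(1)[OF triv] unfolding oneway_LOCC_BA_iff
      by (intro exI[of _ 0] exI[of _ "\<lambda>_ _. 0"]) blast
  next
    case 3
    \<comment> \<open>On zero copies every state is accepted with the same probability, which cannot
      be both at least c and at most s < c.\<close>
    have N0: "0 < N0"
    proof (rule ccontr)
      assume "\<not> 0 < N0"
      then have [simp]: "N0 = 0" by simp
      obtain \<rho> \<rho>' where "\<rho> \<in> Pyes" "\<rho>' \<in> Pno" using 3 by blast
      then have "c \<le> Re (tr_prod (copies_idx d 0) T0 (tensor_power 0 \<rho>))"
        "Re (tr_prod (copies_idx d 0) T0 (tensor_power 0 \<rho>')) \<le> s"
        using assms(7) by (auto simp: is_tester_def)
      moreover have "tensor_power 0 \<rho> = tensor_power 0 \<rho>'" by (simp add: tensor_power_def fun_eq_iff)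
      ultimately show False using assms(5) by simp
    qed
    define g where "g = c - s"
    have g: "0 < g" "g \<le> 1" "c = s + g" using assms(4-6) by (auto simp: g_def)
    define k where "k = nat \<lceil>16 * ln (1 / s + 10) / g\<^sup>2\<rceil>"
    define t where "t = nat \<lceil>3 / g\<rceil>"
    note budget = copies_budget[OF g(1,2) assms(4), folded k_def t_def]
    obtain K1 B1 E where B1: "bob_povm d (N0 + t * N0 * 2) K1 B1" and E: "aligned d (N0 + t * N0 * 2) K1 B1 E"
      and yes: "\<And>\<rho>. \<rho> \<in> Pyes \<Longrightarrow> c \<le> Re (tr_prod (copies_idx d (N0 + t * N0 * 2)) E (tensor_power (N0 + t * N0 * 2) \<rho>))"
      and no: "\<And>\<rho>. \<rho> \<in> Pno \<Longrightarrow> Re (tr_prod (copies_idx d (N0 + t * N0 * 2)) E (tensor_power (N0 + t * N0 * 2) \<rho>)) \<le> s + g / 4"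
      using block_test[OF assms(1-4) g(1) N0 budget(4) assms(7)] by blast
    let ?N = "N0 + t * N0 * 2"
    obtain K B T where B: "bob_povm d (k * ?N) K B" and T: "\<And>\<theta>. aligned d (k * ?N) K B (T \<theta>)"
      and tr: "\<And>\<rho> \<theta>. density_on (bip_idx d) \<rho> \<Longrightarrow>
        tr_prod (copies_idx d (k * ?N)) (T \<theta>) (tensor_power (k * ?N) \<rho>)
          = of_real (binomial_tail (Re (tr_prod (copies_idx d ?N) E (tensor_power ?N \<rho>))) k \<theta>)"
      using threshold_test[OF B1 E, of k] by blast
    define \<theta> where "\<theta> = nat \<lceil>(c - g / 4) * real k\<rceil>"
    note effE = aligned_effect[OF B1 E]
    have "is_tester d (k * ?N) (T \<theta>) Pyes Pno c s"
      unfolding is_tester_def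
    proof (intro conjI ballI)
      show "is_effect (copies_idx d (k * ?N)) (T \<theta>)" by (rule aligned_effect[OF B T])
      fix \<rho> assume \<rho>: "\<rho> \<in> Pyes"
      then have d\<rho>: "density_on (bip_idx d) \<rho>" using dens by blast
      have "c \<le> binomial_tail (Re (tr_prod (copies_idx d ?N) E (tensor_power ?N \<rho>))) k \<theta>"
        unfolding \<theta>_def
        using yes[OF \<rho>] effect_prob(2)[OF effE d\<rho>] g assms(4,6) budget(2)
        by (intro binomial_tail_amplification_complete) auto
      then show "c \<le> Re (tr_prod (copies_idx d (k * ?N)) (T \<theta>) (tensor_power (k * ?N) \<rho>))"
        by (simp add: tr[OF d\<rho>])
    next
      fix \<rho> assume \<rho>: "\<rho> \<in> Pno"
      then have d\<rho>: "density_on (bip_idx d) \<rho>" using dens by blast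
      have "binomial_tail (Re (tr_prod (copies_idx d ?N) E (tensor_power ?N \<rho>))) k \<theta> \<le> s"
        unfolding \<theta>_def
        using no[OF \<rho>] effect_prob(1,2)[OF effE d\<rho>] g assms(4) budget(3)
        by (intro binomial_tail_amplification_sound) auto
      then show "Re (tr_prod (copies_idx d (k * ?N)) (T \<theta>) (tensor_power (k * ?N) \<rho>)) \<le> s"
        by (simp add: tr[OF d\<rho>])
    qed
    moreover have "k * ?N \<le> nat \<lceil>200 * ln (1 / s + 10) * (c - s) powr (-4)\<rceil> * N0"
      using budget(1)[of N0] by (simp add: g_def mult.commute)
    ultimately show ?thesis
      using B T unfolding oneway_LOCC_BA_iff by blast
  qed
qed

end
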